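(* For all $a,b\in\mathcal{A}(D_n)$, the map $H\ni\hbar\mapsto a\star_\hbar b\in\mathcal{A}(D_n)$ is holomorphic, and its singularities at the points $\hbar=-1/(2m)$, $m\in\mathbb{N}$, are at most poles of order $1$.
   Context: Fix $n\ge1$; indices $\mu,\nu\in\{0,\dots,n\}$. Multi-index conventions: $|P|=\sum P_i$, $P!=\prod P_i!$, $\binom PT=\prod\binom{P_i}{T_i}$, $\le,\min$ componentwise, $P'=(P_1,\dots,P_n)$. $D_n=Z/U(1)$, $Z=\{r\in\mathbb{C}^{1+n}:-|r^0|^2+\sum_{i\ge1}|r^i|^2=-1\}$, identified with the open unit ball via $w^i=r^i/r^0$. $\hat D_n=\hat Z/\mathbb{C}^*$, $\hat Z=\{(p,q)\in\mathbb{C}^{1+n}\times\mathbb{C}^{1+n}:-p^0q^0+\sum_{i\ge1}p^iq^i=-1\}$, $z\cdot(p,q)=(zp,q/z)$; $\Delta_D([r])=[r,\bar r]$. $\mathcal{A}(D_n)=\{\hat a\circ\Delta_D:\hat a\in\mathcal{O}(\hat D_n)\}$ with the Fréchet topology of seminorms $\|a\|_{D_n,K}=\sup_K|\hat a|$ ($K\subseteq\hat D_n$ compact, $\hat a$ unique). $f_{P,Q}([r])=r^P\bar r^Q$ for $P,Q\in\mathbb{N}_0^{1+n}$, $|P|=|Q|$; $\mathcal{P}(D_n)$ = their span, dense in $\mathcal{A}(D_n)$. $H=\mathbb{C}\setminus(\{0\}\cup\{-1/(2m):m\in\mathbb{N}\})$, $(z)_m=\prod_{k=0}^{m-1}(z+k)$.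 For $\hbar\in H$, $\star_\hbar$ is the associative product on $\mathcal{P}(D_n)$ with $f_{P,Q}\star_\hbar f_{R,S}=\sum_{T\in\mathbb{N}_0^{1+n},T\le\min\{P,S\}}(-1)^{T_0}\frac{(\frac1{2\hbar})_{|P+S-T|}T!}{(\frac1{2\hbar})_{|P|}(\frac1{2\hbar})_{|S|}}\binom PT\binom ST f_{P+R-T,Q+S-T}$ (obtained by reduction of the Wick product on $\mathbb{C}^{1+n}$), extended (as is known) to a continuous product on $\mathcal{A}(D_n)$, still denoted $\star_\hbar$. *)

theory Defs
  imports "HOL-Analysis.Analysis"
begin

text \<open>Points of C^(1+n) are vectors indexed by the type 'n option, where None is
the index 0 and Some i (i :: 'n) are the indices 1..n; thus n = CARD('n) >= 1.
Multi-indices in N_0^(1+n) are functions 'n option => nat.\<close>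

type_synonym 'n cvec = "complex ^ ('n option)"
type_synonym 'n midx = "'n option \<Rightarrow> nat"

definition cnjv :: "('n::finite) cvec \<Rightarrow> 'n cvec" where
  "cnjv r = (\<chi> i. cnj (r $ i))"

text \<open>The hypersurface Z (D_n = Z/U(1)); functions on D_n are represented as
functions on Z (U(1)-invariant), set to 0 outside Z.\<close>
definition ZZ :: "('n::finite) cvec set" where
  "ZZ = {r. - (cmod (r $ None))\<^sup>2 + (\<Sum>i\<in>UNIV. (cmod (r $ Some i))\<^sup>2) = -1}"

definition hatZ :: "(('n::finite) cvec \<times> 'n cvec) set" where
  "hatZ = {(p, q). - (p $ None) * (q $ None) + (\<Sum>i\<in>UNIV. p $ Some i * q $ Some i) = -1}"

definition holo_on :: "(('n::finite) cvec \<times> 'n cvec) set \<Rightarrow> ('n cvec \<times> 'n cvec \<Rightarrow> complex) \<Rightarrow> bool" where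
  "holo_on U g \<longleftrightarrow> open U \<and> (\<forall>x\<in>U. \<exists>L. (g has_derivative L) (at x) \<and>
      (\<forall>v. L (\<i> *s fst v, \<i> *s snd v) = \<i> * L v))"

definition holo_hatZ :: "(('n::finite) cvec \<times> 'n cvec \<Rightarrow> complex) \<Rightarrow> bool" where
  "holo_hatZ h \<longleftrightarrow> (\<forall>z\<in>hatZ. \<exists>U g. z \<in> U \<and> holo_on U g \<and> (\<forall>w\<in>U \<inter> hatZ. h w = g w))"

text \<open>O(hat D_n) = C^*-invariant holomorphic functions on hat Z.\<close>
definition holo_hatD :: "(('n::finite) cvec \<times> 'n cvec \<Rightarrow> complex) \<Rightarrow> bool" where
  "holo_hatD h \<longleftrightarrow> holo_hatZ h \<and>
     (\<forall>z::complex. z \<noteq> 0 \<longrightarrow> (\<forall>p q. (p, q) \<in> hatZ \<longrightarrow> h (z *s p, (1 / z) *s q) = h (p, q)))"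

definition AD :: "(('n::finite) cvec \<Rightarrow> complex) set" where
  "AD = {a. (\<forall>r. r \<notin> ZZ \<longrightarrow> a r = 0) \<and>
            (\<exists>h. holo_hatD h \<and> (\<forall>r\<in>ZZ. a r = h (r, cnjv r)))}"

text \<open>The (unique) holomorphic extension hat a, set to 0 outside hat Z.\<close>
definition hatA :: "(('n::finite) cvec \<Rightarrow> complex) \<Rightarrow> ('n cvec \<times> 'n cvec \<Rightarrow> complex)" where
  "hatA a = (THE h. holo_hatD h \<and> (\<forall>w. w \<notin> hatZ \<longrightarrow> h w = 0) \<and> (\<forall>r\<in>ZZ. a r = h (r, cnjv r)))"

text \<open>Convergence in the Frechet topology of the seminorms sup_K |hat a|
(K compact; compact sets of hat D_n are images of compact sets of hat Z).\<close>
definition convA :: "(nat \<Rightarrow> ('n::finite) cvec \<Rightarrow> complex) \<Rightarrow> ('n cvec \<Rightarrow> complex) \<Rightarrow> bool" where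
  "convA s a \<longleftrightarrow> (\<forall>K. compact K \<and> K \<subseteq> hatZ \<longrightarrow>
      uniform_limit K (\<lambda>k. hatA (s k)) (hatA a) sequentially)"

definition holoA :: "complex set \<Rightarrow> (complex \<Rightarrow> ('n::finite) cvec \<Rightarrow> complex) \<Rightarrow> bool" where
  "holoA U F \<longleftrightarrow> open U \<and> (\<forall>t\<in>U. F t \<in> AD) \<and>
     (\<forall>t0\<in>U. \<exists>D\<in>AD. \<forall>K. compact K \<and> K \<subseteq> hatZ \<longrightarrow>
        uniform_limit K (\<lambda>t w. (hatA (F t) w - hatA (F t0) w) / (t - t0)) (hatA D) (at t0))"

definition msum :: "('n::finite) midx \<Rightarrow> nat" where
  "msum P = (\<Sum>i\<in>UNIV. P i)"

definition mfact :: "('n::finite) midx \<Rightarrow> nat" where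
  "mfact P = (\<Prod>i\<in>UNIV. fact (P i))"

definition mbinom :: "('n::finite) midx \<Rightarrow> 'n midx \<Rightarrow> nat" where
  "mbinom P T = (\<Prod>i\<in>UNIV. P i choose T i)"

definition mono :: "('n::finite) midx \<Rightarrow> 'n midx \<Rightarrow> 'n cvec \<Rightarrow> complex" where
  "mono P Q r = (\<Prod>i\<in>UNIV. (r $ i) ^ P i * (cnj (r $ i)) ^ Q i)"

text \<open>Coefficient families of elements of P(D_n): finitely supported, |P| = |Q|.\<close>
definition admissible :: "(('n::finite) midx \<times> 'n midx \<Rightarrow> complex) \<Rightarrow> bool" where
  "admissible \<alpha> \<longleftrightarrow> finite {x. \<alpha> x \<noteq> 0} \<and> (\<forall>x. \<alpha> x \<noteq> 0 \<longrightarrow> msum (fst x) = msum (snd x))"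

definition polyA :: "(('n::finite) midx \<times> 'n midx \<Rightarrow> complex) \<Rightarrow> 'n cvec \<Rightarrow> complex" where
  "polyA \<alpha> r = (if r \<in> ZZ then (\<Sum>x\<in>{x. \<alpha> x \<noteq> 0}. \<alpha> x * mono (fst x) (snd x) r) else 0)"

definition star_mono :: "complex \<Rightarrow> ('n::finite) midx \<times> 'n midx \<Rightarrow> 'n midx \<times> 'n midx \<Rightarrow> 'n cvec \<Rightarrow> complex" where
  "star_mono hb x y r = (case x of (P, Q) \<Rightarrow> case y of (R, S) \<Rightarrow>
     (\<Sum>T\<in>{T. \<forall>i. T i \<le> P i \<and> T i \<le> S i}.
        (-1) ^ (T None) * pochhammer (1 / (2 * hb)) (msum (\<lambda>i. P i + S i - T i)) * of_nat (mfact T)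
        / (pochhammer (1 / (2 * hb)) (msum P) * pochhammer (1 / (2 * hb)) (msum S))
        * of_nat (mbinom P T * mbinom S T)
        * mono (\<lambda>i. P i + R i - T i) (\<lambda>i. Q i + S i - T i) r))"

definition starP :: "complex \<Rightarrow> (('n::finite) midx \<times> 'n midx \<Rightarrow> complex) \<Rightarrow> ('n midx \<times> 'n midx \<Rightarrow> complex) \<Rightarrow> 'n cvec \<Rightarrow> complex" where
  "starP hb \<alpha> \<beta> r = (if r \<in> ZZ then
     (\<Sum>x\<in>{x. \<alpha> x \<noteq> 0}. \<Sum>y\<in>{y. \<beta> y \<noteq> 0}. \<alpha> x * \<beta> y * star_mono hb x y r) else 0)"

text \<open>The continuous extension of star_hbar to A(D_n): a star b is the limit of
p_k star q_k for any polynomial sequences p_k -> a, q_k -> b.\<close>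
definition starA :: "complex \<Rightarrow> (('n::finite) cvec \<Rightarrow> complex) \<Rightarrow> ('n cvec \<Rightarrow> complex) \<Rightarrow> ('n cvec \<Rightarrow> complex)" where
  "starA hb a b = (THE c. c \<in> AD \<and>
     (\<forall>\<alpha> \<beta>. (\<forall>k. admissible (\<alpha> k) \<and> admissible (\<beta> k)) \<and>
        convA (\<lambda>k. polyA (\<alpha> k)) a \<and> convA (\<lambda>k. polyA (\<beta> k)) b \<longrightarrow>
        convA (\<lambda>k. starP hb (\<alpha> k) (\<beta> k)) c))"

definition Hset :: "complex set" where
  "Hset = - ({0} \<union> {- 1 / (2 * of_nat m) | m::nat. m \<ge> 1})"

end

theory Submission
  imports Defs "HOL-Complex_Analysis.Complex_Analysis"
begin

text \<open>
  A function in \<open>O(hat D_n)\<close> becomes an entire function of \<open>(p', q')\<close> in each of the two gauges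
  \<open>q_0 = 1\<close> and \<open>p_0 = 1\<close>.  Its Taylor coefficients at \<open>p'^A q'^B\<close>, taken in the first gauge if
  \<open>|A| \<ge> |B|\<close> and in the second one otherwise, are the coordinates with respect to the monomials
  \<open>p^P q^Q\<close> with \<open>P_0 = 0\<close> or \<open>Q_0 = 0\<close>.  By Cauchy's estimates the coordinates decay faster than every
  geometric sequence and depend continuously on the function; a function with vanishing coordinates
  is zero by Liouville's theorem.

  The star product of polynomials depends only on the functions because it respects the relation
  \<open>f_{P,Q} = f_{P+e_0,Q+e_0} - \<Sum>_i f_{P+e_i,Q+e_i}\<close>, which generates all relations between monomials.
  With \<open>x = 1/(2hbar)\<close>, its coefficients \<open>(x)_{|P+S-T|} T! / ((x)_{|P|} (x)_{|S|}) (P choose T) (S choose T)\<close>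
  grow at most geometrically in \<open>|P| + |S|\<close>, locally uniformly in \<open>hbar\<close>.  Hence the product of two
  expansions is a normally convergent series of holomorphic functions of \<open>hbar\<close>.  Since \<open>|P+S-T| \<ge> |S|\<close>,
  the factor \<open>(x)_{|S|}\<close> cancels, and the zeros of the remaining denominator \<open>(x)_{|P|}\<close> are simple.
\<close>

text \<open>The obstacle is that the monomials are linearly dependent on \<open>hatZ\<close>, while
  the product is a formula on pairs of exponents. Continuous coordinates dual to a basis are
  therefore needed. One gauge does not provide them: the basis monomials adapted to the other gauge
  become \<open>z^x * (1 + dotp z)^k\<close> there. These still have a fixed weight
  \<open>wA - wB\<close>, and reading each coordinate in the gauge selected by the sign of its
  weight restores duality. The price is that vanishing coordinates kill only half of the Taylor
  coefficients in either gauge, so that the two halves have to be glued by a Liouville argument.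
  Factorials in the structure constants might spoil geometric growth. With p = |P|, s = |S| and N =
  |P+S-T| they are tamed by N! |T|! \<le> (p+s)! \<le> 2^(p+s) p! s!. A geometric rate of any size
  is harmless against coordinates that decay faster than every geometric sequence, so one estimate
  serves continuity in the factors, holomorphy in the parameter and, with one factor of the
  denominator removed, the behaviour at a pole. The definite description in \<open>hatA\<close>
  rests on an identity theorem for the totally real diagonal.\<close>

no_notation fps_nth (infixl "$" 75)

type_synonym 'n hvec = "'n cvec \<times> 'n cvec"
type_synonym 'n hidx = "'n midx \<times> 'n midx"
type_synonym 'n bix = "'n + 'n \<Rightarrow> nat"
type_synonym 'n jix = "('n + 'n \<Rightarrow> nat) \<times> ('n + 'n \<Rightarrow> nat) \<times> ('n option \<Rightarrow> nat)"

section \<open>Taylor coefficients of entire functions of several variables\<close>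

abbreviation circle_integrand ::
    "real \<Rightarrow> 'i \<Rightarrow> nat \<Rightarrow> (('i \<Rightarrow> complex) \<Rightarrow> complex) \<Rightarrow> ('i \<Rightarrow> complex) \<Rightarrow> real \<Rightarrow> complex" where
  "circle_integrand R i k F z t \<equiv>
     F (z(i := of_real R * cis (2 * pi * t))) * cis (- 2 * pi * (real k * t))"

text \<open>Cauchy's formula for the \<open>k\<close>-th coefficient in the variable
  \<open>i\<close>, parametrised over the unit interval so that no factor 2 pi i remains. The result
  is again a function of all variables (constant in the \<open>i\<close>-th), so these operators can
  be iterated.\<close>

definition circle_coeff ::
    "real \<Rightarrow> 'i \<Rightarrow> nat \<Rightarrow> (('i \<Rightarrow> complex) \<Rightarrow> complex) \<Rightarrow> ('i \<Rightarrow> complex) \<Rightarrow> complex" where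
  "circle_coeff R i k F z =
     integral {0..1} (circle_integrand R i k F z) / of_real R ^ k"

text \<open>Joint continuity makes iterated circle integrals exist and commute; holomorphy is needed
  in only one variable at a time.\<close>

definition sep_entire :: "(('i \<Rightarrow> complex) \<Rightarrow> complex) \<Rightarrow> bool" where
  "sep_entire F \<longleftrightarrow> continuous_on UNIV F \<and> (\<forall>i z. (\<lambda>u. F (z(i := u))) holomorphic_on UNIV)"

lemma continuous_on_fun_upd [continuous_intros]:
  fixes f :: "'a::topological_space \<Rightarrow> 'i \<Rightarrow> 'b::topological_space"
  assumes "continuous_on S f" "continuous_on S g"
  shows "continuous_on S (\<lambda>x. (f x)(i := g x))"
proof (rule continuous_on_coordinatewise_then_product)
  fix j
  show "continuous_on S (\<lambda>x. ((f x)(i := g x)) j)"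
    using assms(2) continuous_on_product_then_coordinatewise[OF assms(1), of j]
    by (cases "j = i") auto
qed

lemma continuous_on_circle_integrand:
  fixes F :: "('i \<Rightarrow> complex) \<Rightarrow> complex" and f :: "'a::topological_space \<Rightarrow> 'i \<Rightarrow> complex"
  assumes "continuous_on UNIV F" "continuous_on S f" "continuous_on S g"
  shows "continuous_on S (\<lambda>x. circle_integrand R i k F (f x) (g x))"
proof -
  have "continuous_on S (\<lambda>x. (f x)(i := of_real R * cis (2 * pi * g x)))"
    by (intro continuous_intros assms(2,3))
  from continuous_on_compose2[OF assms(1) this]
  have "continuous_on S (\<lambda>x. F ((f x)(i := of_real R * cis (2 * pi * g x))))" by simp
  then show ?thesis by (intro continuous_intros assms(3))
qed

lemma integrable_circle_integrand:
  assumes "continuous_on UNIV F"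
  shows "(circle_integrand R i k F z) integrable_on {0..1::real}"
  by (rule integrable_continuous_interval)
     (rule continuous_on_circle_integrand[where f="\<lambda>_. z"], use assms in \<open>auto intro: continuous_intros\<close>)

lemma continuous_on_circle_coeff:
  assumes "continuous_on UNIV F"
  shows "continuous_on UNIV (circle_coeff R i k F)"
proof -
  have "continuous_on (UNIV \<times> cbox 0 1) (\<lambda>(z, t). circle_integrand R i k F z t)"
    unfolding split_def
    by (rule continuous_on_circle_integrand[OF assms]) (intro continuous_intros)+
  from integral_continuous_on_param[OF this] show ?thesis
    unfolding circle_coeff_def[abs_def] divide_inverse
    by (intro continuous_on_mult continuous_on_const) auto
qed

lemma norm_circle_coeff_le:
  assumes "continuous_on UNIV F" "R > 0"
    and "\<And>w. norm w = R \<Longrightarrow> norm (F (z(i := w))) \<le> M"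
  shows "norm (circle_coeff R i k F z) \<le> M / R ^ k"
proof -
  have "norm (integral (cbox 0 1) (circle_integrand R i k F z)) 
      \<le> M * measure lborel (cbox 0 (1::real))"
  proof (rule has_integral_bound)
    show "0 \<le> M" using assms(3)[of "of_real R"] assms(2) norm_ge_zero
      by (metis abs_of_pos norm_of_real order_trans)
    show "((circle_integrand R i k F z) has_integral
       integral (cbox 0 1) (circle_integrand R i k F z)) (cbox 0 1)"
      using integrable_circle_integrand[OF assms(1)] by (intro integrable_integral) auto
    fix t :: real
    show "norm (circle_integrand R i k F z t) \<le> M"
      using assms(2) by (auto simp: norm_mult intro!: assms(3))
  qed
  then show ?thesis using assms(2)
    by (simp add: circle_coeff_def norm_divide norm_power divide_right_mono)
qed

text \<open>Interchanging the integrals is all that is needed to treat several variables: holomorphic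
  dependence of the circle integrals on the remaining variables never enters.\<close>

lemma circle_coeff_commute:
  assumes "continuous_on UNIV F" "i \<noteq> j"
  shows "circle_coeff R i k (circle_coeff S j l F) = circle_coeff S j l (circle_coeff R i k F)"
proof
  fix z :: "'a \<Rightarrow> complex"
  define f where "f = (\<lambda>s t. F ((z(i := of_real R * cis (2 * pi * s)))(j := of_real S * cis (2 * pi * t)))
      * cis (- 2 * pi * (real l * t)) * cis (- 2 * pi * (real k * s)))"
  have c: "continuous_on (cbox (0,0) (1,1)) (\<lambda>(s,t). f s t)"
    unfolding f_def split_def
    by (intro continuous_on_mult continuous_on_circle_integrand[OF assms(1)]) (intro continuous_intros)+
  have f': "f s t = F ((z(j := of_real S * cis (2 * pi * t)))(i := of_real R * cis (2 * pi * s)))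
      * cis (- 2 * pi * (real k * s)) * cis (- 2 * pi * (real l * t))" for s t
    unfolding f_def using assms(2) by (simp add: fun_upd_twist)
  have "circle_coeff R i k (circle_coeff S j l F) z = 
      integral (cbox 0 1) (\<lambda>s. integral (cbox 0 1) (f s)) / (of_real R ^ k * of_real S ^ l)"
    by (simp add: circle_coeff_def f_def field_simps)
  also have "\<dots> = integral (cbox 0 1) (\<lambda>t. integral (cbox 0 1) (\<lambda>s. f s t)) / (of_real R ^ k * of_real S ^ l)"
    using integral_swap_continuous[OF c] by simp
  also have "\<dots> = circle_coeff S j l (circle_coeff R i k F) z"
    by (simp add: circle_coeff_def f' field_simps)
  finally show "circle_coeff R i k (circle_coeff S j l F) z = circle_coeff S j l (circle_coeff R i k F) z" .
qed

text \<open>The right-hand side does not mention \<open>R\<close>: independence of the radius comes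
  from here.\<close>

lemma circle_coeff_eq_deriv:
  assumes "(\<lambda>u. F (z(i := u))) holomorphic_on UNIV" "R > 0"
  shows "circle_coeff R i k F z = (deriv ^^ k) (\<lambda>u. F (z(i := u))) 0 / fact k"
proof -
  let ?f = "\<lambda>u. F (z(i := u))"
  have "((\<lambda>u. ?f u / (u - 0) ^ (Suc k)) has_contour_integral ((2 * pi * \<i>) / (fact k) * (deriv ^^ k) ?f 0)) (circlepath 0 R)"
    by (rule Cauchy_has_contour_integral_higher_derivative_circlepath)
       (use assms in \<open>auto intro: holomorphic_on_subset holomorphic_on_imp_continuous_on\<close>)
  then have *: "((\<lambda>t. ?f (circlepath 0 R t) / (circlepath 0 R t) ^ (Suc k) * vector_derivative (circlepath 0 R) (at t within {0..1}))
      has_integral ((2 * pi * \<i>) / (fact k) * (deriv ^^ k) ?f 0)) {0..1}"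
    by (simp add: has_contour_integral_def)
  have cp: "circlepath 0 R t = of_real R * cis (2 * pi * t)" for t
    by (simp add: circlepath cis_conv_exp mult_ac)
  have vd: "vector_derivative (circlepath 0 R) (at t within {0..1}) = 2 * pi * \<i> * of_real R * cis (2 * pi * t)"
    if "t \<in> {0..1}" for t
    using that by (simp add: vector_derivative_circlepath01 cis_conv_exp mult_ac)
  \<comment> \<open>One of the \<open>Suc k\<close> factors in the denominator cancels against the
    derivative of the circle, which leaves the constant factor \<open>2 * pi * \<i>\<close>.\<close>
  have "((\<lambda>t. (2 * pi * \<i>) * (?f (of_real R * cis (2 * pi * t)) * cis (- 2 * pi * (real k * t)) / of_real R ^ k))
      has_integral ((2 * pi * \<i>) / (fact k) * (deriv ^^ k) ?f 0)) {0..1}"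
  proof (rule has_integral_eq[OF _ *])
    fix t :: real assume t: "t \<in> {0..1}"
    have "real k * (2 * pi * t) + (- 2 * pi * (real k * t)) = 0" by (simp add: algebra_simps)
    then have e: "cis (2 * pi * t) ^ k * cis (- 2 * pi * (real k * t)) = 1"
      by (simp only: Complex.DeMoivre cis_mult cis_zero)
    then have e': "cis (- 2 * pi * (real k * t)) = 1 / cis (2 * pi * t) ^ k"
      by (simp add: eq_divide_eq mult.commute)
    show "?f (circlepath 0 R t) / (circlepath 0 R t) ^ (Suc k) * vector_derivative (circlepath 0 R) (at t within {0..1})
       = (2 * pi * \<i>) * (?f (of_real R * cis (2 * pi * t)) * cis (- 2 * pi * (real k * t)) / of_real R ^ k)"
      unfolding vd[OF t] unfolding cp e' using assms(2) by (simp add: power_mult_distrib mult_ac)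
  qed
  from integral_unique[OF this]
  have "(2 * pi * \<i>) * (integral {0..1} (\<lambda>t. ?f (of_real R * cis (2 * pi * t)) * cis (- 2 * pi * (real k * t))) / of_real R ^ k)
     = (2 * pi * \<i>) * ((deriv ^^ k) ?f 0 / fact k)"
    by simp
  then show ?thesis unfolding circle_coeff_def
    by (subst (asm) mult_cancel_left) auto
qed

lemma circle_coeff_cong:
  assumes "\<And>w. F (z(i := w)) = G (z'(i := w))"
  shows "circle_coeff R i k F z = circle_coeff R i k G z'"
  unfolding circle_coeff_def assms by simp

lemma circle_coeff_sum:
  assumes "\<And>a. a \<in> A \<Longrightarrow> continuous_on UNIV (F a)" 
  shows "circle_coeff R i k (\<lambda>z. \<Sum>a\<in>A. F a z) z = (\<Sum>a\<in>A. circle_coeff R i k (F a) z)"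
proof (cases "finite A")
  case True
  have "integral {0..1} (\<lambda>t. \<Sum>a\<in>A. circle_integrand R i k (F a) z t)
    = (\<Sum>a\<in>A. integral {0..1} (circle_integrand R i k (F a) z))"
    by (rule integral_sum[OF True]) (rule integrable_circle_integrand[OF assms])
  then show ?thesis by (simp add: circle_coeff_def sum_distrib_right sum_divide_distrib)
qed (simp add: circle_coeff_def)

lemma circle_coeff_mult_indep:
  assumes "\<And>w. c (z(i := w)) = c z"
  shows "circle_coeff R i k (\<lambda>z. c z * F z) z = c z * circle_coeff R i k F z"
  by (simp add: circle_coeff_def assms mult.assoc)

text \<open>A Taylor polynomial in one variable whose coefficients still depend on the others. As an
  operator on functions it can be folded over a list of variables.\<close>

definition circle_taylor ::
    "real \<Rightarrow> nat \<Rightarrow> 'i \<Rightarrow> (('i \<Rightarrow> complex) \<Rightarrow> complex) \<Rightarrow> ('i \<Rightarrow> complex) \<Rightarrow> complex" where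
  "circle_taylor R N i F z = (\<Sum>k<N. z i ^ k * circle_coeff R i k F z)"

lemma continuous_on_coord [continuous_intros]: "continuous_on S (\<lambda>z::'i \<Rightarrow> 'b::topological_space. z i)"
  by (rule continuous_on_product_then_coordinatewise) (rule continuous_on_id)

lemma continuous_on_circle_taylor:
  "continuous_on UNIV F \<Longrightarrow> continuous_on UNIV (circle_taylor R N i F)"
  unfolding circle_taylor_def[abs_def]
  by (intro continuous_intros continuous_on_circle_coeff)

lemma circle_taylor_diff:
  assumes "continuous_on UNIV F" "continuous_on UNIV G"
  shows "circle_taylor R N i (\<lambda>z. F z - G z) z = circle_taylor R N i F z - circle_taylor R N i G z"
proof -
  have "circle_coeff R i k (\<lambda>z. F z - G z) z = circle_coeff R i k F z - circle_coeff R i k G z" for k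
    unfolding circle_coeff_def left_diff_distrib
    by (subst integral_diff) (auto intro!: integrable_circle_integrand[OF assms(1), simplified] integrable_circle_integrand[OF assms(2), simplified] simp: diff_divide_distrib)
  then show ?thesis by (simp add: circle_taylor_def right_diff_distrib sum_subtractf)
qed

text \<open>For \<open>norm (z i) \<le> R / 2\<close> Cauchy's estimates leave a geometric series of
  ratio 1/2. The bound does not depend on \<open>N\<close>, so an error made in other variables
  passes through this operator with at most a factor 2.\<close>

lemma norm_circle_taylor_le:
  assumes "continuous_on UNIV F" "norm (z i) \<le> R / 2" "R > 0"
    and "\<And>w. norm w = R \<Longrightarrow> norm (F (z(i := w))) \<le> M"
  shows "norm (circle_taylor R N i F z) \<le> 2 * M"
proof -
  have M: "0 \<le> M" using assms(4)[of "of_real R"] assms(3) norm_ge_zero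
      by (metis abs_of_pos norm_of_real order_trans)
  have "norm (circle_taylor R N i F z) \<le> (\<Sum>k<N. norm (z i ^ k * circle_coeff R i k F z))"
    unfolding circle_taylor_def by (rule norm_sum)
  also have "\<dots> \<le> (\<Sum>k<N. M * (1/2) ^ k)"
  proof (rule sum_mono)
    fix k
    have "norm (z i ^ k * circle_coeff R i k F z) \<le> (R/2)^k * (M / R^k)"
      unfolding norm_mult norm_power
      by (intro mult_mono power_mono norm_circle_coeff_le) (use assms in auto)
    also have "\<dots> = M * (1/2)^k" using assms(3) by (simp add: power_divide)
    finally show "norm (z i ^ k * circle_coeff R i k F z) \<le> M * (1/2) ^ k" .
  qed
  also have "\<dots> = M * (\<Sum>k<N. (1/2) ^ k)" by (simp add: sum_distrib_left)
  also have "\<dots> \<le> M * 2"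
    by (intro mult_left_mono M) (simp add: sum_gp_strict)
  finally show ?thesis by simp
qed

text \<open>The error is the tail from \<open>N\<close> on of the same geometric series.\<close>

lemma norm_circle_taylor_error:
  assumes "continuous_on UNIV F" "(\<lambda>u. F (z(i := u))) holomorphic_on UNIV" "norm (z i) \<le> R / 2" "R > 0"
    and "\<And>w. norm w = R \<Longrightarrow> norm (F (z(i := w))) \<le> M"
  shows "norm (circle_taylor R N i F z - F z) \<le> 2 * M / 2 ^ N"
proof -
  let ?c = "\<lambda>k. circle_coeff R i k F z * z i ^ k"
  have M: "0 \<le> M" using assms(5)[of "of_real R"] assms(4) norm_ge_zero
      by (metis abs_of_pos norm_of_real order_trans)
  have "(\<lambda>n. (deriv ^^ n) (\<lambda>u. F (z(i := u))) 0 / (fact n) * (z i - 0)^n) sums F (z(i := z i))"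
    by (rule holomorphic_power_series[where r=R]) (use assms in \<open>auto intro: holomorphic_on_subset\<close>)
  then have s: "?c sums F z"
    unfolding circle_coeff_eq_deriv[OF assms(2,4)] by simp
  have b: "norm (?c k) \<le> M * (1/2)^k" for k
  proof -
    have "norm (?c k) \<le> (M / R^k) * (R/2)^k"
      unfolding norm_mult norm_power
      by (intro mult_mono power_mono norm_circle_coeff_le) (use assms M in auto)
    also have "\<dots> = M * (1/2)^k" using assms(4) by (simp add: power_divide)
    finally show ?thesis .
  qed
  have "(\<lambda>k. ?c (k + N)) sums (F z - (\<Sum>k<N. ?c k))"
    using s by (rule sums_split_initial_segment)
  moreover have "(\<lambda>k. M * (1/2)^(k+N)) sums (M * (2 / 2^N))"
  proof -
    have "(\<lambda>k. (M * (1/2)^N) * (1/2)^k) sums ((M * (1/2)^N) * (1 / (1 - 1/2)))"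
      by (intro sums_mult geometric_sums) simp
    then show ?thesis by (simp add: power_add mult_ac power_divide)
  qed
  ultimately have "norm (F z - (\<Sum>k<N. ?c k)) \<le> M * (2 / 2^N)"
    by (metis (no_types, lifting) b norm_suminf_le sums_iff)
  then show ?thesis by (simp add: circle_taylor_def norm_minus_commute mult_ac)
qed


section \<open>Iterated coefficients and the Taylor expansion in several variables\<close>

definition multi_coeff ::
    "real \<Rightarrow> 'i list \<Rightarrow> ('i \<Rightarrow> nat) \<Rightarrow> (('i \<Rightarrow> complex) \<Rightarrow> complex) \<Rightarrow> ('i \<Rightarrow> complex) \<Rightarrow> complex" where
  "multi_coeff R is x F = foldr (\<lambda>i. circle_coeff R i (x i)) is F"

lemma multi_coeff_simps [simp]:
  "multi_coeff R [] x F = F"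
  "multi_coeff R (i # is) x F = circle_coeff R i (x i) (multi_coeff R is x F)"
  by (simp_all add: multi_coeff_def)

lemma continuous_on_multi_coeff:
  "continuous_on UNIV F \<Longrightarrow> continuous_on UNIV (multi_coeff R is x F)"
  by (induction "is") (auto intro: continuous_on_circle_coeff)

lemma multi_coeff_commute:
  assumes "continuous_on UNIV F" "i \<notin> set is"
  shows "circle_coeff S i k (multi_coeff R is x F) = multi_coeff R is x (circle_coeff S i k F)"
  using assms(2)
proof (induction "is")
  case (Cons j js)
  then show ?case
    using circle_coeff_commute[OF continuous_on_multi_coeff[OF assms(1)], of i j]
    by auto
qed simp

text \<open>Holomorphy is known for \<open>F\<close> but not for its iterated coefficients. Each
  operator is therefore moved inwards past the others until it acts on \<open>F\<close> itself,
  where its radius can be changed, and is then moved back.\<close>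

lemma multi_coeff_radius_indep:
  assumes "sep_entire F" "distinct is" "R > 0" "S > 0"
  shows "multi_coeff R is x F = multi_coeff S is x F"
  using assms(2)
proof (induction "is")
  case (Cons i js)
  have cont: "continuous_on UNIV F" and hol: "\<And>z. (\<lambda>u. F (z(i := u))) holomorphic_on UNIV"
    using assms(1) by (auto simp: sep_entire_def)
  have "multi_coeff R (i # js) x F = circle_coeff R i (x i) (multi_coeff S js x F)"
    using Cons by simp
  also have "\<dots> = multi_coeff S js x (circle_coeff R i (x i) F)"
    using Cons cont by (simp add: multi_coeff_commute)
  also have "circle_coeff R i (x i) F = circle_coeff S i (x i) F"
    using circle_coeff_eq_deriv[OF hol] assms(3,4) by (auto simp: fun_eq_iff)
  also have "multi_coeff S js x (circle_coeff S i (x i) F) = multi_coeff S (i # js) x F"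
    using Cons cont by (simp add: multi_coeff_commute)
  finally show ?case .
qed simp

lemma multi_coeff_agree:
  assumes "\<And>j. j \<notin> set is \<Longrightarrow> z j = z' j"
  shows "multi_coeff R is x F z = multi_coeff R is x F z'"
  using assms
proof (induction "is" arbitrary: z z')
  case Nil
  then have "z = z'" by auto
  then show ?case by simp
next
  case (Cons i js)
  show ?case unfolding multi_coeff_simps
    by (rule circle_coeff_cong, rule Cons.IH) (use Cons.prems in auto)
qed

lemma multi_coeff_index_cong:
  assumes "\<And>i. i \<in> set is \<Longrightarrow> x i = y i"
  shows "multi_coeff R is x F = multi_coeff R is y F"
  using assms by (induction "is") auto

lemma norm_multi_coeff_le:
  assumes "continuous_on UNIV F" "R > 0" "distinct is"
    and "\<And>w. (\<forall>i\<in>set is. norm (w i) = R) \<Longrightarrow> (\<forall>i. i \<notin> set is \<longrightarrow> w i = z i) \<Longrightarrow> norm (F w) \<le> M"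
  shows "norm (multi_coeff R is x F z) \<le> M / R ^ (\<Sum>i\<in>set is. x i)"
  using assms(3,4)
proof (induction "is" arbitrary: z)
  case Nil
  then show ?case using Nil.prems(2)[of z] by simp
next
  case (Cons i js)
  have "norm (circle_coeff R i (x i) (multi_coeff R js x F) z) \<le> (M / R ^ (\<Sum>i\<in>set js. x i)) / R ^ x i"
  proof (rule norm_circle_coeff_le)
    fix w :: complex assume "norm w = R"
    then show "norm (multi_coeff R js x F (z(i := w))) \<le> M / R ^ (\<Sum>i\<in>set js. x i)"
      using Cons.prems by (intro Cons.IH) auto
  qed (use assms in \<open>auto intro: continuous_on_multi_coeff\<close>)
  then show ?case using Cons.prems by (simp add: power_add mult.commute)
qed

text \<open>One more variable turns an error d into at most 2d + 2M/2^N, which solves to the factor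
  \<open>2 ^ length is - 1\<close>. Coordinates outside the list are only required to satisfy
  \<open>norm (z i) \<le> R\<close>, because the induction hypothesis is applied where the
  coordinate being integrated lies on the circle of radius \<open>R\<close>.\<close>

lemma norm_multi_taylor_error:
  assumes "sep_entire F" "R > 0" "distinct is"
    and bound: "\<And>z. (\<forall>i. norm (z i) \<le> R) \<Longrightarrow> norm (F z) \<le> M"
    and "\<And>i. i \<in> set is \<Longrightarrow> norm (z i) \<le> R / 2" "\<And>i. norm (z i) \<le> R"
  shows "norm (foldr (circle_taylor R N) is F z - F z) \<le> (2 ^ length is - 1) * (2 * M / 2 ^ N)"
  using assms(3,5,6)
proof (induction "is" arbitrary: z)
  case (Cons i js)
  have cont: "continuous_on UNIV F" and hol: "\<And>i z. (\<lambda>u. F (z(i := u))) holomorphic_on UNIV"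
    using assms(1) by (auto simp: sep_entire_def)
  let ?G = "foldr (circle_taylor R N) js F"
  have contT: "continuous_on UNIV ?G"
    by (induction js) (auto intro: cont continuous_on_circle_taylor)
  have "norm (circle_taylor R N i (\<lambda>z. ?G z - F z) z) \<le> 2 * ((2 ^ length js - 1) * (2 * M / 2 ^ N))"
  proof (rule norm_circle_taylor_le)
    fix w :: complex assume w: "norm w = R"
    show "norm (?G (z(i := w)) - F (z(i := w))) \<le> (2 ^ length js - 1) * (2 * M / 2 ^ N)"
      by (rule Cons.IH) (use Cons.prems w in auto)
  qed (use Cons.prems cont contT assms(2) in \<open>auto intro: continuous_intros\<close>)
  moreover have "norm (circle_taylor R N i F z - F z) \<le> 2 * M / 2 ^ N"
  proof (rule norm_circle_taylor_error)
    fix w :: complex assume "norm w = R"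
    then show "norm (F (z(i := w))) \<le> M" using Cons.prems by (intro bound) auto
  qed (use Cons.prems cont hol assms(2) in auto)
  moreover have "circle_taylor R N i ?G z - F z = circle_taylor R N i (\<lambda>z. ?G z - F z) z + (circle_taylor R N i F z - F z)"
    by (simp add: circle_taylor_diff[OF contT cont])
  ultimately have "norm (circle_taylor R N i ?G z - F z) \<le> 2 * ((2 ^ length js - 1) * (2 * M / 2 ^ N)) + 2 * M / 2 ^ N"
    by (simp only: norm_triangle_mono)
  also have "\<dots> = (2 ^ length (i # js) - 1) * (2 * M / 2 ^ N)" by (simp add: field_simps)
  finally show ?case by simp
qed simp

lemma multi_taylor_eq_sum:
  assumes "continuous_on UNIV F" "distinct is"
  shows "foldr (circle_taylor R N) is F z =
    (\<Sum>x \<in> PiE (set is) (\<lambda>_. {..<N}). (\<Prod>i\<in>set is. z i ^ x i) * multi_coeff R is x F z)"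
  using assms(2)
proof (induction "is" arbitrary: z)
  case (Cons i js)
  let ?P = "\<lambda>S. PiE S (\<lambda>_. {..<N::nat})"
  let ?H = "\<lambda>k x. z i ^ k * ((\<Prod>i\<in>set js. z i ^ x i) * circle_coeff R i k (multi_coeff R js x F) z)"
  have i: "i \<notin> set js" and fin: "finite (?P (set js))" using Cons.prems by (auto intro: finite_PiE)
  have fold_eq: "foldr (circle_taylor R N) js F =
      (\<lambda>z. \<Sum>x \<in> ?P (set js). (\<Prod>i\<in>set js. z i ^ x i) * multi_coeff R js x F z)"
    using Cons by (auto simp: fun_eq_iff)
  have "foldr (circle_taylor R N) (i # js) F z =
     (\<Sum>k<N. z i ^ k * circle_coeff R i k (\<lambda>z. \<Sum>x \<in> ?P (set js). (\<Prod>i\<in>set js. z i ^ x i) * multi_coeff R js x F z) z)"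
    by (simp add: circle_taylor_def[of R N i] fold_eq)
  also have "\<dots> = (\<Sum>k<N. \<Sum>x\<in>?P (set js). ?H k x)"
  proof (rule sum.cong[OF refl])
    fix k
    have "circle_coeff R i k (\<lambda>z. \<Sum>x \<in> ?P (set js). (\<Prod>i\<in>set js. z i ^ x i) * multi_coeff R js x F z) z
       = (\<Sum>x\<in>?P (set js). circle_coeff R i k (\<lambda>z. (\<Prod>i\<in>set js. z i ^ x i) * multi_coeff R js x F z) z)"
      by (rule circle_coeff_sum) (intro continuous_intros continuous_on_multi_coeff assms(1))
    also have "\<dots> = (\<Sum>x\<in>?P (set js). (\<Prod>i\<in>set js. z i ^ x i) * circle_coeff R i k (multi_coeff R js x F) z)"
      using i by (intro sum.cong refl circle_coeff_mult_indep prod.cong) auto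
    finally show "z i ^ k * circle_coeff R i k (\<lambda>z. \<Sum>x \<in> ?P (set js). (\<Prod>i\<in>set js. z i ^ x i) * multi_coeff R js x F z) z
      = (\<Sum>x\<in>?P (set js). ?H k x)" by (simp add: sum_distrib_left)
  qed
  also have "\<dots> = (\<Sum>(k,x) \<in> {..<N} \<times> ?P (set js). ?H k x)"
    by (rule sum.cartesian_product)
  \<comment> \<open>A new exponent \<open>k\<close> and an old multi-index \<open>x\<close> are
    merged into the single multi-index \<open>x(i := k)\<close>.\<close>
  also have "\<dots> = (\<Sum>y \<in> (\<lambda>(k,x). x(i := k)) ` ({..<N} \<times> ?P (set js)).
      (\<Prod>i\<in>set (i # js). z i ^ y i) * multi_coeff R (i # js) y F z)"
  proof (subst sum.reindex)
    show "inj_on (\<lambda>(k,x). x(i := k)) ({..<N} \<times> ?P (set js))"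
      using inj_combinator[OF i, of "\<lambda>_. {..<N}"] .
    show "(\<Sum>(k,x) \<in> {..<N} \<times> ?P (set js). ?H k x) = 
      sum ((\<lambda>y. (\<Prod>i\<in>set (i # js). z i ^ y i) * multi_coeff R (i # js) y F z) \<circ> (\<lambda>(k,x). x(i := k))) ({..<N} \<times> ?P (set js))"
    proof (rule sum.cong[OF refl], clarify)
      fix k x
      have "multi_coeff R js (x(i := k)) F = multi_coeff R js x F"
        by (rule multi_coeff_index_cong) (use i in auto)
      moreover have "(\<Prod>l\<in>set js. z l ^ (x(i := k)) l) = (\<Prod>l\<in>set js. z l ^ x l)"
        by (rule prod.cong) (use i in auto)
      ultimately show "?H k x = ((\<lambda>y. (\<Prod>i\<in>set (i # js). z i ^ y i) * multi_coeff R (i # js) y F z) \<circ> (\<lambda>(k,x). x(i := k))) (k, x)"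
        using i by (simp del: fun_upd_apply) simp
    qed
  qed
  also have "(\<lambda>(k,x). x(i := k)) ` ({..<N} \<times> ?P (set js)) = ?P (set (i # js))"
    using PiE_insert_eq[of i "set js" "\<lambda>_. {..<N}"] by simp
  finally show ?case .
qed simp

definition index_list :: "'i::finite list" where
  "index_list = (SOME xs. set xs = UNIV \<and> distinct xs)"

lemma index_list: "set (index_list :: 'i::finite list) = UNIV" "distinct (index_list :: 'i list)"
  using someI_ex[OF finite_distinct_list[OF finite[of UNIV]]] unfolding index_list_def by auto

text \<open>The radius 1 and the base point are arbitrary choices; \<open>taylor_coeff_eq\<close>
  frees \<open>sep_entire\<close> functions from both.\<close>

definition taylor_coeff :: "('i::finite \<Rightarrow> nat) \<Rightarrow> (('i \<Rightarrow> complex) \<Rightarrow> complex) \<Rightarrow> complex" where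
  "taylor_coeff x F = multi_coeff 1 index_list x F (\<lambda>_. 0)"

lemma taylor_coeff_eq:
  assumes "sep_entire F" "R > 0"
  shows "multi_coeff R index_list x F z = taylor_coeff x F"
  unfolding taylor_coeff_def multi_coeff_radius_indep[OF assms(1) index_list(2) assms(2) zero_less_one]
  by (rule multi_coeff_agree) (simp add: index_list)

lemma norm_taylor_coeff_le:
  assumes "sep_entire F" "R > 0" "\<And>z. (\<And>i. norm (z i) = R) \<Longrightarrow> norm (F z) \<le> M"
  shows "norm (taylor_coeff x F) \<le> M / R ^ sum x UNIV"
  unfolding taylor_coeff_eq[OF assms(1,2), symmetric, of _ "\<lambda>_. 0"]
  using norm_multi_coeff_le[of F R index_list "\<lambda>_. 0" M x] assms
  by (auto simp: index_list sep_entire_def)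

text \<open>A finite set of multi-indices lies in a cube, and the sum over a cube factorises into
  geometric sums in one variable.\<close>

lemma multi_geometric_summable:
  fixes c :: real
  assumes "0 \<le> c" "c < 1"
  shows "(\<lambda>x::'i::finite \<Rightarrow> nat. c ^ sum x UNIV) summable_on UNIV"
proof (rule nonneg_bdd_above_summable_on)
  show "bdd_above (sum (\<lambda>x::'i \<Rightarrow> nat. c ^ sum x UNIV) ` {F. F \<subseteq> UNIV \<and> finite F})"
  proof (rule bdd_aboveI2)
    fix X :: "('i \<Rightarrow> nat) set" assume "X \<in> {F. F \<subseteq> UNIV \<and> finite F}"
    then have X: "finite X" by simp
    define N where "N = Suc (Max (insert 0 ((\<lambda>(x,i). x i) ` (X \<times> UNIV))))"
    have sub: "X \<subseteq> PiE UNIV (\<lambda>_. {..<N})"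
    proof
      fix x assume "x \<in> X"
      then have "x i \<le> Max (insert 0 ((\<lambda>(x,i). x i) ` (X \<times> UNIV)))" for i
        using X by (intro Max_ge) force+
      then show "x \<in> PiE UNIV (\<lambda>_. {..<N})" by (auto simp: N_def PiE_def le_imp_less_Suc)
    qed
    have "(\<Sum>x\<in>X. c ^ sum x UNIV) \<le> (\<Sum>x \<in> PiE (UNIV::'i set) (\<lambda>_. {..<N}). c ^ sum x UNIV)"
      by (rule sum_mono2) (use sub assms(1) in \<open>auto intro: finite_PiE\<close>)
    also have "\<dots> = (\<Prod>i\<in>(UNIV::'i set). \<Sum>k<N. c ^ k)"
      by (subst prod_sum_PiE) (auto simp: power_sum)
    also have "\<dots> \<le> (\<Prod>i\<in>(UNIV::'i set). 1 / (1 - c))"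
      using assms by (intro prod_mono) (auto simp: sum_gp_strict sum_nonneg divide_simps power_le_one)
    finally show "(\<Sum>x\<in>X. c ^ sum x UNIV) \<le> (\<Prod>i\<in>(UNIV::'i set). 1 / (1 - c))" .
  qed
qed (use assms in auto)

text \<open>Cubes are cofinal among the finite sets of multi-indices. This connects unordered sums
  with iterated Taylor polynomials, which run over cubes.\<close>

lemma filterlim_box_finite_subsets:
  "filterlim (\<lambda>N. PiE UNIV (\<lambda>_::'i::finite. {..<N::nat})) (finite_subsets_at_top UNIV) sequentially"
  unfolding filterlim_def le_filter_def eventually_filtermap
proof safe
  fix P :: "('i \<Rightarrow> nat) set \<Rightarrow> bool"
  assume "eventually P (finite_subsets_at_top UNIV)"
  then obtain X where X: "finite X" "\<And>Y. finite Y \<Longrightarrow> X \<subseteq> Y \<Longrightarrow> P Y"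
    unfolding eventually_finite_subsets_at_top by auto
  define N where "N = Suc (Max (insert 0 ((\<lambda>(x,i). x i) ` (X \<times> UNIV))))"
  have "X \<subseteq> PiE UNIV (\<lambda>_. {..<M})" if "M \<ge> N" for M
  proof
    fix x assume "x \<in> X"
    then have "x i \<le> Max (insert 0 ((\<lambda>(x,i). x i) ` (X \<times> UNIV)))" for i
      using X by (intro Max_ge) force+
    then show "x \<in> PiE UNIV (\<lambda>_. {..<M})" using that by (auto simp: N_def PiE_def Suc_le_eq intro: le_less_trans)
  qed
  then have "P (PiE UNIV (\<lambda>_. {..<M}))" if "M \<ge> N" for M
    using that by (intro X(2)) (auto intro: finite_PiE)
  then show "\<forall>\<^sub>F N in sequentially. P (PiE UNIV (\<lambda>_. {..<N}))"
    unfolding eventually_sequentially by auto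
qed

lemma compact_polydisc: "compact {z :: 'i::finite \<Rightarrow> complex. \<forall>i. norm (z i) \<le> R}"
proof -
  have "compact (Pi\<^sub>E UNIV (\<lambda>_::'i. cball (0::complex) R))"
    using compactin_PiE[of "\<lambda>_. euclidean" UNIV "\<lambda>_::'i. cball (0::complex) R"]
    by (simp add: euclidean_product_topology)
  moreover have "Pi\<^sub>E UNIV (\<lambda>_::'i. cball (0::complex) R) = {z. \<forall>i. norm (z i) \<le> R}"
    by (auto simp: PiE_def)
  ultimately show ?thesis by simp
qed

lemma sep_entire_bounded:
  fixes F :: "('i::finite \<Rightarrow> complex) \<Rightarrow> complex"
  assumes "continuous_on UNIV F"
  obtains M where "\<And>z. (\<forall>i. norm (z i) \<le> R) \<Longrightarrow> norm (F z) \<le> M"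
proof -
  have "compact (F ` {z. \<forall>i. norm (z i) \<le> R})"
    using assms by (intro compact_continuous_image compact_polydisc) (auto intro: continuous_on_subset)
  then obtain M where "\<And>y. y \<in> F ` {z. \<forall>i. norm (z i) \<le> R} \<Longrightarrow> norm y \<le> M"
    using compact_imp_bounded bounded_iff by metis
  then show ?thesis by (intro that[of M]) auto
qed

lemma taylor_coeff_abs_summable:
  assumes "sep_entire F"
  shows "(\<lambda>x. norm (taylor_coeff x F) * R ^ sum x UNIV) summable_on UNIV"
proof -
  define S where "S = 2 * \<bar>R\<bar> + 1"
  have S: "S > 0" "\<bar>R\<bar> / S \<ge> 0" "\<bar>R\<bar> / S < 1" by (auto simp: S_def)
  obtain M where M: "\<And>z. (\<forall>i. norm (z i) \<le> S) \<Longrightarrow> norm (F z) \<le> M"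
    using sep_entire_bounded[of F] assms unfolding sep_entire_def by blast
  have b: "norm (taylor_coeff x F) \<le> M / S ^ sum x UNIV" for x
    by (rule norm_taylor_coeff_le[OF assms S(1)]) (use M in auto)
  have "(\<lambda>x. M * (\<bar>R\<bar> / S) ^ sum x UNIV) summable_on (UNIV :: ('a \<Rightarrow> nat) set)"
    by (intro summable_on_cmult_right multi_geometric_summable S)
  then have "(\<lambda>x. norm (taylor_coeff x F * of_real R ^ sum x UNIV)) summable_on UNIV"
  proof (rule summable_on_comparison_test)
    fix x :: "'a \<Rightarrow> nat"
    show "norm (taylor_coeff x F * of_real R ^ sum x UNIV) \<le> M * (\<bar>R\<bar> / S) ^ sum x UNIV"
      using mult_right_mono[OF b, of "\<bar>R\<bar> ^ sum x UNIV" x]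
      by (simp add: norm_mult norm_power power_divide)
  qed auto
  then have "(\<lambda>x. norm (norm (taylor_coeff x F) * R ^ sum x UNIV)) summable_on UNIV"
    by (simp add: norm_mult norm_power abs_mult power_abs)
  then show ?thesis by (rule abs_summable_summable)
qed

text \<open>Absolute summability yields some value of the sum. The partial sums over cubes are
  iterated Taylor polynomials, and their error bound identifies this value as
  \<open>F z\<close>.\<close>

lemma taylor_coeff_has_sum:
  fixes F :: "('i::finite \<Rightarrow> complex) \<Rightarrow> complex"
  assumes "sep_entire F"
  shows "((\<lambda>x. taylor_coeff x F * (\<Prod>i\<in>UNIV. z i ^ x i)) has_sum F z) UNIV"
proof -
  define r where "r = Max (range (\<lambda>i. norm (z i)))"
  have r: "norm (z i) \<le> r" for i unfolding r_def by (intro Max_ge) auto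
  have r0: "r \<ge> 0" by (rule order_trans[OF norm_ge_zero r])
  let ?t = "\<lambda>x. taylor_coeff x F * (\<Prod>i\<in>UNIV. z i ^ x i)"
  have "(\<lambda>x. norm (?t x)) summable_on UNIV"
  proof (rule summable_on_comparison_test[OF taylor_coeff_abs_summable[OF assms, of r]])
    fix x
    have "(\<Prod>i\<in>UNIV. norm (z i) ^ x i) \<le> (\<Prod>i\<in>UNIV. r ^ x i)"
      using r by (intro prod_mono) (auto intro: power_mono)
    then show "norm (?t x) \<le> norm (taylor_coeff x F) * r ^ sum x UNIV"
      by (simp add: norm_mult norm_power power_sum mult_left_mono flip: prod_norm)
  qed auto
  then have sm: "(?t has_sum infsum ?t UNIV) UNIV"
    by (rule has_sum_infsum[OF abs_summable_summable])
  then have 1: "(\<lambda>N. sum ?t (PiE UNIV (\<lambda>_. {..<N}))) \<longlonglongrightarrow> infsum ?t UNIV"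
    unfolding has_sum_def by (rule filterlim_compose[OF _ filterlim_box_finite_subsets, where g="sum ?t"])
  define R where "R = 2 * r + 1"
  have R: "R > 0" "norm (z i) \<le> R / 2" "norm (z i) \<le> R" for i using r[of i] r0 by (auto simp: R_def)
  obtain M where M: "\<And>z. (\<forall>i. norm (z i) \<le> R) \<Longrightarrow> norm (F z) \<le> M"
    using sep_entire_bounded[of F] assms unfolding sep_entire_def by blast
  have eq: "foldr (circle_taylor R N) index_list F z = sum ?t (PiE UNIV (\<lambda>_. {..<N}))" for N
    using assms R(1) multi_taylor_eq_sum[of F "index_list :: 'i list" R N z]
    by (simp add: taylor_coeff_eq sep_entire_def index_list mult.commute)
  have "norm (sum ?t (PiE UNIV (\<lambda>_. {..<N})) - F z) \<le> (2 ^ length (index_list :: 'i list) - 1) * (2 * M / 2 ^ N)" for N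
    unfolding eq[symmetric] by (rule norm_multi_taylor_error[OF assms R(1) index_list(2)]) (use M R in auto)
  moreover have "(\<lambda>N. (2 ^ length (index_list :: 'i list) - 1) * (2 * M / 2 ^ N)) \<longlonglongrightarrow> 0"
    by (intro tendsto_mult_right_zero LIMSEQ_divide_realpow_zero) simp
  ultimately have "(\<lambda>N. sum ?t (PiE UNIV (\<lambda>_. {..<N})) - F z) \<longlonglongrightarrow> 0"
    by - (rule Lim_null_comparison[OF always_eventually], auto)
  then have "(\<lambda>N. sum ?t (PiE UNIV (\<lambda>_. {..<N}))) \<longlonglongrightarrow> F z" by (rule LIM_zero_cancel)
  then have "infsum ?t UNIV = F z" by (rule LIMSEQ_unique[OF 1])
  then show ?thesis using sm by simp
qed

lemma multi_coeff_sum: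
  assumes "\<And>a. a \<in> A \<Longrightarrow> continuous_on UNIV (F a)"
  shows "multi_coeff R is x (\<lambda>z. \<Sum>a\<in>A. F a z) = (\<lambda>z. \<Sum>a\<in>A. multi_coeff R is x (F a) z)"
proof (induction "is")
  case (Cons i js)
  show ?case
    unfolding multi_coeff_simps Cons
    by (rule ext, rule circle_coeff_sum) (intro continuous_on_multi_coeff assms)
qed simp

lemma taylor_coeff_sum:
  assumes "\<And>a. a \<in> A \<Longrightarrow> continuous_on UNIV (F a)"
  shows "taylor_coeff x (\<lambda>z. \<Sum>a\<in>A. F a z) = (\<Sum>a\<in>A. taylor_coeff x (F a))"
  unfolding taylor_coeff_def by (simp add: multi_coeff_sum[OF assms])

lemma taylor_coeff_cmult:
  "taylor_coeff x (\<lambda>z. c * F z) = c * taylor_coeff x F"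
proof -
  have "multi_coeff R is x (\<lambda>z. c * F z) = (\<lambda>z. c * multi_coeff R is x F z)" for R "is"
    by (induction "is") (auto simp: circle_coeff_mult_indep)
  then show ?thesis by (simp add: taylor_coeff_def)
qed

lemma taylor_coeff_add:
  assumes "continuous_on UNIV F" "continuous_on UNIV G"
  shows "taylor_coeff x (\<lambda>z. F z + G z) = taylor_coeff x F + taylor_coeff x G"
proof -
  have "taylor_coeff x (\<lambda>z. \<Sum>b\<in>{True,False}. (if b then F else G) z) = (\<Sum>b\<in>{True,False}. taylor_coeff x (if b then F else G))"
    by (rule taylor_coeff_sum) (use assms in auto)
  then show ?thesis by simp
qed

lemma taylor_coeff_diff:
  assumes "continuous_on UNIV F" "continuous_on UNIV G"
  shows "taylor_coeff x (\<lambda>z. F z - G z) = taylor_coeff x F - taylor_coeff x G"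
  using taylor_coeff_add[OF assms(1), of "\<lambda>z. (-1) * G z" x] assms(2) taylor_coeff_cmult[of x "-1" G]
  by (auto intro: continuous_intros)

lemma taylor_coeff_monomial:
  fixes x y :: "'i::finite \<Rightarrow> nat"
  shows "taylor_coeff x (\<lambda>z. \<Prod>i\<in>UNIV. z i ^ y i) = (if x = y then 1 else 0)"
proof -
  \<comment> \<open>Treating the variables in \<open>is\<close> strips them from the monomial if the
    exponents agree on \<open>is\<close>, and gives 0 otherwise.\<close>
  have *: "multi_coeff 1 is x (\<lambda>z. \<Prod>i\<in>UNIV. z i ^ y i) =
     (\<lambda>z. if \<forall>i\<in>set is. x i = y i then \<Prod>i\<in>- set is. z i ^ y i else 0)" if "distinct is" for "is"
    using that
  proof (induction "is")
    case (Cons i js)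
    show ?case
    proof
      fix z :: "'i \<Rightarrow> complex"
      have i: "i \<notin> set js" and IH: "multi_coeff 1 js x (\<lambda>z. \<Prod>i\<in>UNIV. z i ^ y i) =
     (\<lambda>z. if \<forall>i\<in>set js. x i = y i then \<Prod>i\<in>- set js. z i ^ y i else 0)" using Cons by auto
      define C where "C = (if \<forall>i\<in>set js. x i = y i then \<Prod>i\<in>- set (i # js). z i ^ y i else 0)"
      have eq: "(if \<forall>i\<in>set js. x i = y i then \<Prod>l\<in>- set js. (z(i := u)) l ^ y l else 0) = C * u ^ y i" for u
      proof -
        have "- set js = insert i (- set (i # js))" using i by auto
        then have "(\<Prod>l\<in>- set js. (z(i := u)) l ^ y l) = u ^ y i * (\<Prod>l\<in>- set (i # js). (z(i := u)) l ^ y l)"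
          by simp
        also have "(\<Prod>l\<in>- set (i # js). (z(i := u)) l ^ y l) = (\<Prod>l\<in>- set (i # js). z l ^ y l)"
          by (intro prod.cong) auto
        finally show ?thesis by (simp add: C_def)
      qed
      have "multi_coeff 1 (i # js) x (\<lambda>z. \<Prod>i\<in>UNIV. z i ^ y i) z = (deriv ^^ x i) (\<lambda>u. C * u ^ y i) 0 / fact (x i)"
        unfolding multi_coeff_simps IH
        by (subst circle_coeff_eq_deriv) (auto simp: eq simp del: fun_upd_apply intro!: holomorphic_intros)
      also have "(deriv ^^ x i) (\<lambda>u. C * u ^ y i) 0 = C * (deriv ^^ x i) (\<lambda>u. (u - 0) ^ y i) 0"
        by (subst higher_deriv_cmult[of _ UNIV]) (auto intro!: holomorphic_intros)
      also have "(deriv ^^ x i) (\<lambda>u. (u - 0) ^ y i) 0 = (if x i = y i then fact (x i) else (0::complex))"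
        by (subst higher_deriv_power) (auto simp: pochhammer_fact[symmetric] pochhammer_eq_0_iff power_0_left)
      finally show "multi_coeff 1 (i # js) x (\<lambda>z. \<Prod>i\<in>UNIV. z i ^ y i) z =
        (if \<forall>i\<in>set (i # js). x i = y i then \<Prod>i\<in>- set (i # js). z i ^ y i else 0)"
        by (auto simp: C_def)
    qed
  qed simp
  show ?thesis unfolding taylor_coeff_def *[OF index_list(2)] by (auto simp: index_list fun_eq_iff)
qed

lemma summable_on_Times_nonneg:
  fixes f :: "'a \<Rightarrow> real" and g :: "'b \<Rightarrow> real"
  assumes "f summable_on A" "g summable_on B" "\<And>x. x \<in> A \<Longrightarrow> 0 \<le> f x" "\<And>x. x \<in> B \<Longrightarrow> 0 \<le> g x"
  shows "(\<lambda>(x, y). f x * g y) summable_on A \<times> B"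
  by (rule summable_on_SigmaI[where g="\<lambda>x. f x * infsum g B"])
     (use assms in \<open>auto intro: has_sum_cmult_right summable_on_cmult_left\<close>)

section \<open>Holomorphic functions on the complexified hyperboloid\<close>

lemma sum_UNIV_option: "(\<Sum>\<mu>\<in>(UNIV :: 'n::finite option set). f \<mu>) = f None + (\<Sum>i\<in>UNIV. f (Some i))"
  by (simp add: UNIV_option_conv sum.reindex)

lemma prod_UNIV_option: "(\<Prod>\<mu>\<in>(UNIV :: 'n::finite option set). f \<mu>) = f None * (\<Prod>i\<in>UNIV. f (Some i))"
  by (simp add: UNIV_option_conv prod.reindex)

definition cons0 :: "complex \<Rightarrow> ('n \<Rightarrow> complex) \<Rightarrow> ('n::finite) cvec" where
  "cons0 c u = (\<chi> \<mu>. case \<mu> of None \<Rightarrow> c | Some i \<Rightarrow> u i)"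

lemma cons0_nth [simp]: "cons0 c u $ None = c" "cons0 c u $ Some i = u i"
  by (simp_all add: cons0_def)

lemma cons0_eq: "cons0 (p $ None) (\<lambda>i. p $ Some i) = p"
  by (simp add: vec_eq_iff cons0_def split: option.split)

lemma smult_cons0: "z *s cons0 c u = cons0 (z * c) (\<lambda>i. z * u i)"
  by (auto simp: vec_eq_iff cons0_def split: option.split)

lemma cnjv_nth [simp]: "cnjv r $ i = cnj (r $ i)"
  by (simp add: cnjv_def)

lemma hatZ_iff: "(p, q) \<in> hatZ \<longleftrightarrow> p $ None * q $ None - (\<Sum>i\<in>UNIV. p $ Some i * q $ Some i) = 1"
proof -
  have "- a + b = - 1 \<longleftrightarrow> a - b = 1" for a b :: complex by (metis add.commute minus_diff_eq neg_equal_iff_equal uminus_add_conv_diff)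
  then show ?thesis unfolding hatZ_def by simp
qed

lemma ZZ_hatZ: "r \<in> ZZ \<longleftrightarrow> (r, cnjv r) \<in> hatZ"
proof -
  have "(r, cnjv r) \<in> hatZ \<longleftrightarrow> complex_of_real ((cmod (r $ None))\<^sup>2 - (\<Sum>i\<in>UNIV. (cmod (r $ Some i))\<^sup>2)) = of_real 1"
    unfolding hatZ_iff by (simp add: complex_norm_square[symmetric])
  also have "\<dots> \<longleftrightarrow> (cmod (r $ None))\<^sup>2 - (\<Sum>i\<in>UNIV. (cmod (r $ Some i))\<^sup>2) = 1"
    by (rule of_real_eq_iff)
  finally show ?thesis by (auto simp: ZZ_def)
qed

lemma bounded_linear_axis: "bounded_linear (axis i :: 'a::real_normed_vector \<Rightarrow> 'a ^ 'n::finite)"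
proof (rule bounded_linear_intro[where K=1])
  fix x y :: 'a and r :: real
  show "axis i (x + y) = (axis i x + axis i y :: 'a ^ 'n)" by (simp add: vec_eq_iff axis_def)
  show "axis i (r *\<^sub>R x) = (r *\<^sub>R axis i x :: 'a ^ 'n)" by (simp add: vec_eq_iff axis_def)
  have "norm (axis i x :: 'a ^ 'n) \<le> (\<Sum>j\<in>UNIV. norm ((axis i x :: 'a ^ 'n) $ j))"
    unfolding norm_vec_def by (rule L2_set_le_sum) simp
  also have "\<dots> = (\<Sum>j\<in>UNIV. if j = i then norm x else 0)"
    by (intro sum.cong) (auto simp: axis_def)
  finally show "norm (axis i x :: 'a ^ 'n) \<le> norm x * 1" by simp
qed

lemma has_derivative_vec_lambda:
  fixes f :: "'n::finite \<Rightarrow> 'a::real_normed_vector \<Rightarrow> 'b::real_normed_vector"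
  assumes "\<And>i. (f i has_derivative f' i) F"
  shows "((\<lambda>x. \<chi> i. f i x) has_derivative (\<lambda>h. \<chi> i. f' i h)) F"
proof -
  have "((\<lambda>x. \<Sum>i\<in>UNIV. axis i (f i x)) has_derivative (\<lambda>h. \<Sum>i\<in>UNIV. axis i (f' i h) :: 'b ^ 'n)) F"
    by (intro has_derivative_sum bounded_linear.has_derivative[OF bounded_linear_axis] assms)
  moreover have "(\<Sum>i\<in>UNIV. axis i (g i)) = (\<chi> i. g i)" for g :: "'n \<Rightarrow> 'b"
    by (simp add: vec_eq_iff axis_def if_distrib sum.delta' cong: if_cong)
  ultimately show ?thesis by simp
qed

lemma holo_hatZ_continuous:
  assumes "holo_hatZ h"
  shows "continuous_on hatZ h"
  unfolding continuous_on_eq_continuous_within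
proof
  fix z :: "'a hvec" assume z: "z \<in> hatZ"
  then obtain U g where U: "z \<in> U" "holo_on U g" "\<And>w. w \<in> U \<inter> hatZ \<Longrightarrow> h w = g w"
    using assms unfolding holo_hatZ_def by meson
  then have "isCont g z" unfolding holo_on_def using has_derivative_continuous by blast
  then have "continuous (at z within hatZ) g" by (rule continuous_at_imp_continuous_at_within)
  then have "(g \<longlongrightarrow> h z) (at z within hatZ)" using U z by (auto simp: continuous_within)
  moreover have "eventually (\<lambda>w. g w = h w) (at z within hatZ)"
    unfolding eventually_at_filter
    by (rule eventually_mono[OF eventually_nhds_in_open[of U z]]) (use U in \<open>auto simp: holo_on_def\<close>)
  ultimately have "(h \<longlongrightarrow> h z) (at z within hatZ)" by (rule Lim_transform_eventually)
  then show "continuous (at z within hatZ) h" by (simp add: continuous_within)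
qed

text \<open>Chain rule with a local extension \<open>g\<close>: its real derivative commutes with
  multiplication by \<i> and is therefore complex linear. This reduces the identity theorem and the
  Taylor coefficients to functions of one complex variable.\<close>

lemma holo_hatZ_curve:
  fixes h :: "('n::finite) hvec \<Rightarrow> complex" and \<gamma> :: "complex \<Rightarrow> 'n hvec"
  assumes h: "holo_hatZ h" and S: "open S" and im: "\<And>s. s \<in> S \<Longrightarrow> \<gamma> s \<in> hatZ"
    and hol1: "\<And>i. (\<lambda>s. fst (\<gamma> s) $ i) holomorphic_on S"
    and hol2: "\<And>i. (\<lambda>s. snd (\<gamma> s) $ i) holomorphic_on S"
  shows "(\<lambda>s. h (\<gamma> s)) holomorphic_on S"
  unfolding holomorphic_on_open[OF S]
proof
  fix s assume s: "s \<in> S"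
  define a where "a i = deriv (\<lambda>s. fst (\<gamma> s) $ i) s" for i
  define b where "b i = deriv (\<lambda>s. snd (\<gamma> s) $ i) s" for i
  have "((\<lambda>s. fst (\<gamma> s) $ i) has_derivative (*) (a i)) (at s)" for i
    using holomorphic_derivI[OF hol1 S s] unfolding a_def has_field_derivative_def .
  then have d1: "((\<lambda>s. \<chi> i. fst (\<gamma> s) $ i) has_derivative (\<lambda>t. \<chi> i. a i * t)) (at s)"
    by (intro has_derivative_vec_lambda)
  have "((\<lambda>s. snd (\<gamma> s) $ i) has_derivative (*) (b i)) (at s)" for i
    using holomorphic_derivI[OF hol2 S s] unfolding b_def has_field_derivative_def .
  then have d2: "((\<lambda>s. \<chi> i. snd (\<gamma> s) $ i) has_derivative (\<lambda>t. \<chi> i. b i * t)) (at s)"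
    by (intro has_derivative_vec_lambda)
  have dg: "(\<gamma> has_derivative (\<lambda>t. (\<chi> i. a i * t, \<chi> i. b i * t))) (at s)"
    using has_derivative_Pair[OF d1 d2] by simp
  obtain U g where U: "\<gamma> s \<in> U" "holo_on U g" "\<And>w. w \<in> U \<inter> hatZ \<Longrightarrow> h w = g w"
    using h im[OF s] unfolding holo_hatZ_def by meson
  then obtain L where L: "(g has_derivative L) (at (\<gamma> s))" "\<And>v. L (\<i> *s fst v, \<i> *s snd v) = \<i> * L v"
    unfolding holo_on_def by blast
  have lin: "linear L" using L(1) has_derivative_linear by blast
  define v where "v = ((\<chi> i. a i) :: 'n cvec, (\<chi> i. b i) :: 'n cvec)"
  have Lv: "L (\<chi> i. a i * t, \<chi> i. b i * t) = L v * t" for t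
  proof -
    have "(\<chi> i. a i * t, \<chi> i. b i * t) = Re t *\<^sub>R v + Im t *\<^sub>R (\<i> *s fst v, \<i> *s snd v)"
      by (auto simp: v_def vec_eq_iff complex_eq_iff)
    then have "L (\<chi> i. a i * t, \<chi> i. b i * t) = Re t *\<^sub>R L v + Im t *\<^sub>R (\<i> * L v)"
      using lin L(2)[of v] by (simp only: linear_add linear_scale)
    also have "\<dots> = L v * t" by (auto simp: complex_eq_iff)
    finally show ?thesis .
  qed
  have "((\<lambda>s. g (\<gamma> s)) has_derivative (\<lambda>t. L v * t)) (at s)"
    using has_derivative_compose[OF dg L(1)] unfolding Lv .
  then have "((\<lambda>s. g (\<gamma> s)) has_field_derivative L v) (at s)"
    by (simp add: has_field_derivative_def)
  moreover have "eventually (\<lambda>t. g (\<gamma> t) = h (\<gamma> t)) (nhds s)"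
  proof -
    have "isCont \<gamma> s" by (rule has_derivative_continuous[OF dg])
    then have "(\<gamma> \<longlongrightarrow> \<gamma> s) (nhds s)" unfolding tendsto_at_iff_tendsto_nhds[symmetric] isCont_def .
    moreover have "open U" using U(2) by (simp add: holo_on_def)
    ultimately have "eventually (\<lambda>t. \<gamma> t \<in> U) (nhds s)"
      using U(1) by (intro topological_tendstoD)
    moreover have "eventually (\<lambda>t. t \<in> S) (nhds s)" using S s by (rule eventually_nhds_in_open)
    ultimately show ?thesis
      by eventually_elim (use U(3) im in auto)
  qed
  ultimately show "\<exists>f'. ((\<lambda>s. h (\<gamma> s)) has_field_derivative f') (at s)"
    using DERIV_cong_ev[OF refl _ refl, of "\<lambda>s. g (\<gamma> s)" "\<lambda>s. h (\<gamma> s)" s "L v"] by blast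
qed

section \<open>Identity theorem: functions on \<open>hatD\<close> are determined by the
  diagonal\<close>

text \<open>Adding \<open>t\<close> to both components at \<open>None\<close> changes the value of
  the defining form from 1 to \<open>c t\<close>; dividing \<open>p\<close> by \<open>c t\<close>
  repairs this. For small \<open>t \<noteq> 0\<close> both components are nonzero, and continuity
  carries the vanishing to \<open>t = 0\<close>.\<close>

lemma hatZ_dense_vanish:
  assumes cont: "continuous_on hatZ h"
    and van: "\<And>p q. (p, q) \<in> hatZ \<Longrightarrow> p $ None \<noteq> 0 \<Longrightarrow> q $ None \<noteq> 0 \<Longrightarrow> h (p, q) = (0::complex)"
    and w: "w \<in> hatZ"
  shows "h w = 0"
proof -
  obtain p q where pq: "w = (p, q)" by (cases w)
  define c where "c t = 1 + t * (p $ None + q $ None) + t\<^sup>2" for t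
  define \<gamma> where "\<gamma> t = (cons0 ((p $ None + t) / c t) (\<lambda>i. p $ Some i / c t), cons0 (q $ None + t) (\<lambda>i. q $ Some i))" for t
  have c0: "c 0 = 1" by (simp add: c_def)
  have "isCont c 0" unfolding c_def by (intro continuous_intros)
  then have "(c \<longlongrightarrow> 1) (at 0)" using c0 by (simp add: isCont_def)
  then have ev: "eventually (\<lambda>t. c t \<noteq> 0) (at 0)" by (rule tendsto_imp_eventually_ne) simp
  have ne: "eventually (\<lambda>t::complex. t \<noteq> b) (at 0)" for b
    using t1_space_nhds[of 0 b] by (cases "b = 0") (auto simp: eventually_at_filter elim: eventually_mono)
  have \<gamma>Z: "\<gamma> t \<in> hatZ" if "c t \<noteq> 0" for t
  proof -
    have "p $ None * q $ None - (\<Sum>i\<in>UNIV. p $ Some i * q $ Some i) = 1" using w pq hatZ_iff by blast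
    then have "(p $ None + t) * (q $ None + t) - (\<Sum>i\<in>UNIV. p $ Some i * q $ Some i) = c t"
      by (simp add: c_def algebra_simps power2_eq_square)
    then have "(p $ None + t) * (q $ None + t) / c t - (\<Sum>i\<in>UNIV. p $ Some i * q $ Some i) / c t = 1"
      using that by (simp add: diff_divide_distrib[symmetric])
    then show ?thesis unfolding \<gamma>_def hatZ_iff by (simp add: sum_divide_distrib)
  qed
  have \<gamma>0: "\<gamma> 0 = w" using c0 by (simp add: \<gamma>_def pq cons0_eq)
  have "(\<gamma> \<longlongrightarrow> \<gamma> 0) (at 0)"
  proof -
    have "((\<lambda>t. case \<mu> of None \<Rightarrow> (p $ None + t) / c t | Some i \<Rightarrow> p $ Some i / c t) \<longlongrightarrow>
        (case \<mu> of None \<Rightarrow> (p $ None + 0) / c 0 | Some i \<Rightarrow> p $ Some i / c 0)) (at 0)" for \<mu>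
      using c0 \<open>(c \<longlongrightarrow> 1) (at 0)\<close> by (cases \<mu>) (auto intro!: tendsto_eq_intros)
    moreover have "((\<lambda>t. case \<mu> of None \<Rightarrow> q $ None + t | Some i \<Rightarrow> q $ Some i) \<longlongrightarrow>
        (case \<mu> of None \<Rightarrow> q $ None + 0 | Some i \<Rightarrow> q $ Some i)) (at 0)" for \<mu>
      by (cases \<mu>) (auto intro!: tendsto_eq_intros)
    ultimately show ?thesis
      unfolding \<gamma>_def cons0_def by (intro tendsto_Pair tendsto_vec_lambda)
  qed
  moreover have "eventually (\<lambda>t. \<gamma> t \<in> hatZ) (at 0)" using ev by eventually_elim (rule \<gamma>Z)
  ultimately have "((\<lambda>t. h (\<gamma> t)) \<longlongrightarrow> h w) (at 0)"
    using continuous_on_tendsto_compose[OF cont, of \<gamma> "\<gamma> 0" "at 0"] w by (simp add: \<gamma>0)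
  moreover have "eventually (\<lambda>t. h (\<gamma> t) = 0) (at 0)"
    using ev ne[of "- p $ None"] ne[of "- q $ None"]
  proof eventually_elim
    case (elim t)
    then have "p $ None + t \<noteq> 0" "q $ None + t \<noteq> 0" by (auto simp: add_eq_0_iff)
    then show ?case using \<gamma>Z[of t] elim unfolding \<gamma>_def by (intro van) auto
  qed
  then have "((\<lambda>t. h (\<gamma> t)) \<longlongrightarrow> 0) (at 0)" by (rule tendsto_eventually)
  ultimately show ?thesis by (rule LIM_unique)
qed

text \<open>The point with p'/p_0 = \<open>u\<close> and q'/q_0 = \<open>v\<close> in the gauge q_0
  = 1, where the equation of \<open>hatZ\<close> forces p_0 = 1/(1 - u.v).\<close>

definition aff_pt :: "('n \<Rightarrow> complex) \<Rightarrow> ('n \<Rightarrow> complex) \<Rightarrow> ('n::finite) hvec" where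
  "aff_pt u v = (let D = 1 - (\<Sum>i\<in>UNIV. u i * v i) in (cons0 (1 / D) (\<lambda>i. u i / D), cons0 1 v))"

lemma aff_pt_in_hatZ:
  assumes "(\<Sum>i\<in>UNIV. u i * v i) \<noteq> 1"
  shows "aff_pt u v \<in> hatZ"
proof -
  define D where "D = 1 - (\<Sum>i\<in>UNIV. u i * v i)"
  have "D \<noteq> 0" using assms by (auto simp: D_def)
  moreover have "(\<Sum>i\<in>UNIV. u i * v i / D) = (1 - D) / D"
    by (simp add: D_def sum_divide_distrib)
  ultimately show ?thesis
    unfolding aff_pt_def Let_def D_def[symmetric] hatZ_iff by (simp add: field_simps)
qed

lemma aff_pt_holomorphic:
  assumes h: "holo_hatZ h" and S: "open S"
    and u: "\<And>i. (\<lambda>t. u t i) holomorphic_on S" and v: "\<And>i. (\<lambda>t. v t i) holomorphic_on S"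
    and ne: "\<And>t. t \<in> S \<Longrightarrow> (\<Sum>i\<in>UNIV. u t i * v t i) \<noteq> 1"
  shows "(\<lambda>t. h (aff_pt (u t) (v t))) holomorphic_on S"
proof (rule holo_hatZ_curve[OF h S])
  show "aff_pt (u t) (v t) \<in> hatZ" if "t \<in> S" for t by (intro aff_pt_in_hatZ ne that)
  have "1 - (\<Sum>i\<in>UNIV. u t i * v t i) \<noteq> 0" if "t \<in> S" for t using ne[OF that] by auto
  then show "(\<lambda>t. fst (aff_pt (u t) (v t)) $ i) holomorphic_on S" for i
    by (cases i) (auto simp: aff_pt_def Let_def intro!: holomorphic_intros u v)
  show "(\<lambda>t. snd (aff_pt (u t) (v t)) $ i) holomorphic_on S" for i
    by (cases i) (auto simp: aff_pt_def Let_def intro!: holomorphic_intros v)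
qed

text \<open>For \<open>v\<close> conjugate to \<open>u\<close> the affine point is the
  representative \<open>(r, cnjv r)\<close> with r_0 = \<open>s\<close> > 0, rescaled by
  \<open>s\<close>; invariance under scaling does the rest.\<close>

lemma aff_pt_diag_vanish:
  assumes h: "holo_hatD h" and van: "\<And>r. r \<in> ZZ \<Longrightarrow> h (r, cnjv r) = 0"
    and lt: "(\<Sum>i\<in>UNIV. (cmod (u i))\<^sup>2) < 1"
  shows "h (aff_pt u (\<lambda>i. cnj (u i))) = 0"
proof -
  define s where "s = 1 / sqrt (1 - (\<Sum>i\<in>UNIV. (cmod (u i))\<^sup>2))"
  have s: "s > 0" "s\<^sup>2 = 1 / (1 - (\<Sum>i\<in>UNIV. (cmod (u i))\<^sup>2))"
    using lt by (auto simp: s_def power_divide)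
  let ?r = "cons0 (of_real s) (\<lambda>i. of_real s * u i)"
  have "(\<Sum>i\<in>UNIV. (cmod (of_real s * u i))\<^sup>2) = s\<^sup>2 * (\<Sum>i\<in>UNIV. (cmod (u i))\<^sup>2)"
    by (simp add: norm_mult power_mult_distrib sum_distrib_left)
  then have r: "?r \<in> ZZ" 
  proof -
    have "s\<^sup>2 * (1 - (\<Sum>i\<in>UNIV. (cmod (u i))\<^sup>2)) = 1" using s lt by simp
    then show ?thesis unfolding ZZ_def using \<open>(\<Sum>i\<in>UNIV. (cmod (of_real s * u i))\<^sup>2) = _\<close>
      by (simp add: right_diff_distrib)
  qed
  then have rZ: "(?r, cnjv ?r) \<in> hatZ" by (simp add: ZZ_hatZ)
  have "(\<Sum>i\<in>UNIV. u i * cnj (u i)) = of_real (\<Sum>i\<in>UNIV. (cmod (u i))\<^sup>2)"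
    unfolding of_real_sum by (intro sum.cong refl) (rule complex_norm_square[symmetric])
  then have D: "1 / (1 - (\<Sum>i\<in>UNIV. u i * cnj (u i))) = of_real (s\<^sup>2)"
    using s(2) by simp
  have "aff_pt u (\<lambda>i. cnj (u i)) = (of_real s *s ?r, (1 / of_real s) *s cnjv ?r)"
  proof -
    have "u i / (1 - (\<Sum>i\<in>UNIV. u i * cnj (u i))) = of_real (s\<^sup>2) * u i" for i
      using D by (metis divide_inverse_commute inverse_eq_divide)
    moreover have "cnjv ?r = cons0 (of_real s) (\<lambda>i. of_real s * cnj (u i))"
      by (auto simp: vec_eq_iff cons0_def split: option.split)
    ultimately show ?thesis using s(1) D
      by (simp add: aff_pt_def Let_def smult_cons0 power2_eq_square mult_ac)
  qed
  then show ?thesis using h rZ s(1) van[OF r] unfolding holo_hatD_def by simp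
qed

text \<open>In the coordinates \<open>s = (u + v)/2\<close> and \<open>t = (u - v)/(2i)\<close> the diagonal \<open>v = cnj u\<close> is the real
  subspace, and \<open>(s, t)\<close> lies on the complex line through real vectors \<open>Re + \<xi> Im\<close> at \<open>\<xi> = i\<close>.\<close>

lemma aff_pt_small_vanish:
  fixes u v :: "'n::finite \<Rightarrow> complex"
  assumes h: "holo_hatD h" and van: "\<And>r. r \<in> ZZ \<Longrightarrow> h (r, cnjv r) = 0"
    and e: "\<And>i. cmod (u i) \<le> 1 / (6 * (real CARD('n) + 1))" "\<And>i. cmod (v i) \<le> 1 / (6 * (real CARD('n) + 1))"
  shows "h (aff_pt u v) = 0"
proof -
  \<comment> \<open>For \<open>cmod \<xi> < 2\<close> the bound \<epsilon> for \<open>s\<close> and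
    \<open>t\<close> grows to 3\<epsilon> for \<open>S\<close> and \<open>T\<close> and to
    6\<epsilon> = 1/(n+1) for \<open>U\<close> and \<open>V\<close>. The sum of n products then
    stays below 1, so the affine points lie in \<open>hatZ\<close>. The radius 2 makes room for the
    target value \<xi> = \<i>.\<close>
  define \<epsilon> where "\<epsilon> = 1 / (6 * (real CARD('n) + 1))"
  have \<epsilon>: "\<epsilon> > 0" "real CARD('n) * (6 * \<epsilon>)\<^sup>2 < 1"
    by (auto simp: \<epsilon>_def power2_eq_square divide_simps) (simp add: algebra_simps add_pos_nonneg)
  define s where "s i = (u i + v i) / 2" for i
  define t where "t i = (u i - v i) / (2 * \<i>)" for i
  have st: "u i = s i + \<i> * t i" "v i = s i - \<i> * t i" for i by (auto simp: s_def t_def field_simps)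
  have ns: "cmod (s i) \<le> \<epsilon>" "cmod (t i) \<le> \<epsilon>" for i
    using e[of i] norm_triangle_ineq[of "u i" "v i"] norm_triangle_ineq4[of "u i" "v i"]
    by (auto simp: s_def t_def norm_divide norm_mult \<epsilon>_def)
  define S where "S \<xi> i = of_real (Re (s i)) + \<xi> * of_real (Im (s i))" for \<xi> :: complex and i
  define T where "T \<xi> i = of_real (Re (t i)) + \<xi> * of_real (Im (t i))" for \<xi> :: complex and i
  define U where "U \<xi> i = S \<xi> i + \<i> * T \<xi> i" for \<xi> i
  define V where "V \<xi> i = S \<xi> i - \<i> * T \<xi> i" for \<xi> i
  have bd: "cmod (of_real (Re z) + \<xi> * of_real (Im z)) \<le> 3 * \<epsilon>" if "cmod \<xi> < 2" "cmod z \<le> \<epsilon>" for \<xi> z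
  proof -
    have "cmod (of_real (Re z) + \<xi> * of_real (Im z)) \<le> \<bar>Re z\<bar> + cmod \<xi> * \<bar>Im z\<bar>"
      by (rule order_trans[OF norm_triangle_ineq]) (simp add: norm_mult)
    also have "\<dots> \<le> \<epsilon> + 2 * \<epsilon>"
      using that abs_Re_le_cmod[of z] abs_Im_le_cmod[of z] by (intro add_mono mult_mono) auto
    finally show ?thesis by simp
  qed
  have UV: "cmod (U \<xi> i) \<le> 6 * \<epsilon>" "cmod (V \<xi> i) \<le> 6 * \<epsilon>" if "cmod \<xi> < 2" for \<xi> i
    using bd[OF that ns(1)[of i]] bd[OF that ns(2)[of i]]
      norm_triangle_ineq[of "S \<xi> i" "\<i> * T \<xi> i"] norm_triangle_ineq4[of "S \<xi> i" "\<i> * T \<xi> i"]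
    by (auto simp: U_def V_def S_def T_def norm_mult)
  have lt: "cmod (\<Sum>i\<in>UNIV. f i * g i) < 1" if "\<And>i. cmod (f i) \<le> 6 * \<epsilon>" "\<And>i. cmod (g i) \<le> 6 * \<epsilon>" for f g :: "'n \<Rightarrow> complex"
  proof -
    have "cmod (\<Sum>i\<in>UNIV. f i * g i) \<le> (\<Sum>i\<in>(UNIV::'n set). (6 * \<epsilon>) * (6 * \<epsilon>))"
      using that \<epsilon>(1) by (intro order_trans[OF norm_sum] sum_mono, unfold norm_mult) (intro mult_mono, auto)
    also have "\<dots> < 1" using \<epsilon>(2) by (simp add: power2_eq_square)
    finally show ?thesis .
  qed
  have hol: "(\<lambda>\<xi>. h (aff_pt (U \<xi>) (V \<xi>))) holomorphic_on ball 0 2"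
  proof (rule aff_pt_holomorphic)
    show "(\<Sum>i\<in>UNIV. U \<xi> i * V \<xi> i) \<noteq> 1" if "\<xi> \<in> ball 0 2" for \<xi>
      using lt[of "U \<xi>" "V \<xi>"] UV[of \<xi>] that by force
  qed (use h in \<open>auto simp: holo_hatD_def U_def V_def S_def T_def intro!: holomorphic_intros\<close>)
  have real0: "h (aff_pt (U (of_real x)) (V (of_real x))) = 0" if "x \<in> {-1<..<1}" for x
  proof -
    have V: "V (of_real x) = (\<lambda>i. cnj (U (of_real x) i))"
      by (auto simp: U_def V_def S_def T_def)
    have "of_real (\<Sum>i\<in>UNIV. (cmod (U (of_real x) i))\<^sup>2) = (\<Sum>i\<in>UNIV. U (of_real x) i * V (of_real x) i)"
      unfolding V of_real_sum by (intro sum.cong refl) (rule complex_norm_square)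
    then have "\<bar>\<Sum>i\<in>UNIV. (cmod (U (of_real x) i))\<^sup>2\<bar> = cmod (\<Sum>i\<in>UNIV. U (of_real x) i * V (of_real x) i)"
      by (metis norm_of_real)
    then have "(\<Sum>i\<in>UNIV. (cmod (U (of_real x) i))\<^sup>2) < 1"
      using lt[of "U (of_real x)" "V (of_real x)"] UV[of "of_real x"] that by force
    from aff_pt_diag_vanish[OF h van this] show ?thesis unfolding V by simp
  qed
  have "h (aff_pt (U \<i>) (V \<i>)) = 0"
  proof (rule analytic_continuation[OF hol, where U="of_real ` {-1<..<1}" and \<xi>=0])
    show "(0::complex) islimpt of_real ` {-1<..<1::real}"
    proof (rule islimptI)
      fix W :: "complex set" assume "0 \<in> W" "open W"
      then obtain d where d: "d > 0" "ball 0 d \<subseteq> W" using openE by blast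
      define x where "x = min (d/2) (1/2)"
      have "complex_of_real x \<in> W" using d by (intro subsetD[OF d(2)]) (auto simp: x_def)
      moreover have "x \<in> {-1<..<1}" "x \<noteq> 0" using d by (auto simp: x_def)
      ultimately show "\<exists>y\<in>of_real ` {-1<..<1}. y \<in> W \<and> y \<noteq> 0"
        by (intro bexI[of _ "complex_of_real x"]) auto
    qed
  qed (use real0 in \<open>auto simp: norm_of_real\<close>)
  moreover have "U \<i> = u" "V \<i> = v"
    using complex_eq by (auto simp: U_def V_def S_def T_def st complex_eq_iff)
  ultimately show ?thesis by simp
qed

text \<open>Along \<open>t \<mapsto> (t * u, t * v)\<close> the function vanishes near 0 by the
  local result. The excluded parameters, where \<open>t\<^sup>2 * k = 1\<close>, are finitely many,
  so their complement is connected, and it contains \<open>t = 1\<close>. Up to scaling every point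
  with p_0 and q_0 nonzero is affine, and density covers the others.\<close>

lemma holo_hatD_vanish:
  fixes h :: "('n::finite) hvec \<Rightarrow> complex"
  assumes h: "holo_hatD h" and van: "\<And>r. r \<in> ZZ \<Longrightarrow> h (r, cnjv r) = 0" and w: "w \<in> hatZ"
  shows "h w = 0"
proof (rule hatZ_dense_vanish[OF holo_hatZ_continuous _ w])
  show "holo_hatZ h" using h by (simp add: holo_hatD_def)
  have main: "h (aff_pt u v) = 0" if ne: "(\<Sum>i\<in>UNIV. u i * v i) \<noteq> 1" for u v :: "'n \<Rightarrow> complex"
  proof -
    define k where "k = (\<Sum>i\<in>UNIV. u i * v i)"
    define S where "S = - {t. t\<^sup>2 * k = 1}"
    have sm: "(\<Sum>i\<in>UNIV. t * u i * (t * v i)) = t\<^sup>2 * k" for t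
      by (simp add: k_def sum_distrib_left power2_eq_square mult_ac)
    have cl: "closed {t::complex. t\<^sup>2 * k = 1}"
      by (intro closed_Collect_eq continuous_intros)
    have fin: "finite {t::complex. t\<^sup>2 * k = 1}"
    proof (cases "k = 0")
      case False
      then have "{t::complex. t\<^sup>2 * k = 1} = {t. t\<^sup>2 = 1 / k}" by (auto simp: field_simps)
      moreover have "finite {t::complex. t^2 = 1 / k}" by (rule finite_nth_roots) simp
      ultimately show ?thesis by simp
    qed auto
    have S: "open S" unfolding S_def using cl by auto
    have conn: "connected S" unfolding S_def
      using path_connected_complement_countable[of "{t::complex. t\<^sup>2 * k = 1}"] fin
      by (simp add: path_connected_imp_connected countable_finite)
    define \<epsilon> where "\<epsilon> = 1 / (6 * (real CARD('n) + 1))"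
    have \<epsilon>: "\<epsilon> > 0" by (simp add: \<epsilon>_def)
    define M where "M = 1 + (\<Sum>i\<in>UNIV. cmod (u i)) + (\<Sum>i\<in>UNIV. cmod (v i))"
    have nn: "(\<Sum>i\<in>UNIV. cmod (u i)) \<ge> 0" "(\<Sum>i\<in>UNIV. cmod (v i)) \<ge> 0" by (auto intro: sum_nonneg)
    have M: "M > 0" "cmod (u i) \<le> M" "cmod (v i) \<le> M" for i
      using nn member_le_sum[of i UNIV "\<lambda>i. cmod (u i)"] member_le_sum[of i UNIV "\<lambda>i. cmod (v i)"]
      by (auto simp: M_def)
    have hol: "(\<lambda>t. h (aff_pt (\<lambda>i. t * u i) (\<lambda>i. t * v i))) holomorphic_on S"
      by (rule aff_pt_holomorphic) (use h S in \<open>auto simp: holo_hatD_def sm S_def intro!: holomorphic_intros\<close>)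
    have "h (aff_pt (\<lambda>i. 1 * u i) (\<lambda>i. 1 * v i)) = 0"
    proof (rule analytic_continuation[OF hol S conn, where U="S \<inter> ball 0 (\<epsilon> / M)" and \<xi>=0])
      show "0 islimpt S \<inter> ball 0 (\<epsilon> / M)"
        by (rule interior_limit_point) (use S \<epsilon> M in \<open>auto simp: interior_open open_Int S_def\<close>)
      fix t assume t: "t \<in> S \<inter> ball 0 (\<epsilon> / M)"
      have "cmod (t * z) \<le> \<epsilon>" if "cmod z \<le> M" for z
      proof -
        have "cmod (t * z) \<le> (\<epsilon> / M) * M" unfolding norm_mult
          using t that M(1) \<epsilon> by (intro mult_mono) auto
        then show ?thesis using M(1) by simp
      qed
      then show "h (aff_pt (\<lambda>i. t * u i) (\<lambda>i. t * v i)) = 0"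
        using M unfolding \<epsilon>_def by (intro aff_pt_small_vanish[OF h van]) auto
    qed (use ne in \<open>auto simp: S_def k_def\<close>)
    then show ?thesis by simp
  qed
  fix p q :: "'n cvec" assume pq: "(p, q) \<in> hatZ" and p0: "p $ None \<noteq> 0" and q0: "q $ None \<noteq> 0"
  let ?u = "\<lambda>i. p $ Some i / p $ None" and ?v = "\<lambda>i. q $ Some i / q $ None"
  have "(\<Sum>i\<in>UNIV. ?u i * ?v i) = (\<Sum>i\<in>UNIV. p $ Some i * q $ Some i) / (p $ None * q $ None)"
    by (simp add: sum_divide_distrib)
  also have "\<dots> = (p $ None * q $ None - 1) / (p $ None * q $ None)"
    using pq by (simp add: hatZ_iff algebra_simps)
  finally have D: "1 - (\<Sum>i\<in>UNIV. ?u i * ?v i) = 1 / (p $ None * q $ None)"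
    using p0 q0 by (simp add: field_simps)
  then have "(\<Sum>i\<in>UNIV. ?u i * ?v i) \<noteq> 1" using p0 q0 by auto
  from main[OF this] have 0: "h (aff_pt ?u ?v) = 0" .
  have "aff_pt ?u ?v = (q $ None *s p, (1 / q $ None) *s q)"
    unfolding aff_pt_def Let_def D using p0 q0
    by (auto simp: vec_eq_iff cons0_def split: option.split)
  moreover have "h (q $ None *s p, (1 / q $ None) *s q) = h (p, q)"
    using h pq q0 unfolding holo_hatD_def by blast
  ultimately show "h (p, q) = 0" using 0 by simp
qed

section \<open>Series of monomials\<close>

text \<open>The monomial f_{P,Q} with conjugates replaced by independent variables; at
  \<open>(r, cnjv r)\<close> it agrees with \<open>mono\<close>.\<close>

definition hmono :: "('n::finite) hidx \<Rightarrow> 'n hvec \<Rightarrow> complex" where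
  "hmono x w = (\<Prod>i\<in>UNIV. (fst w $ i) ^ fst x i * (snd w $ i) ^ snd x i)"

text \<open>Quantitative holomorphy of degree \<open>d\<close>. For \<open>R \<ge> 1\<close> the
  product rule preserves this form with degrees adding up, so derivatives of monomials are bounded
  without being computed.\<close>

definition clinear_diff :: "real \<Rightarrow> nat \<Rightarrow> (('n::finite) hvec \<Rightarrow> complex) \<Rightarrow> bool" where
  "clinear_diff R d f \<longleftrightarrow> (\<forall>w. norm w \<le> R \<longrightarrow> norm (f w) \<le> R ^ d \<and>
     (\<exists>L. (f has_derivative L) (at w) \<and> (\<forall>v. L (\<i> *s fst v, \<i> *s snd v) = \<i> * L v) \<and>
        (\<forall>v. norm (L v) \<le> real d * R ^ d * norm v)))"

lemma clinear_diff_one: "R \<ge> 1 \<Longrightarrow> clinear_diff R 0 (\<lambda>w. 1)"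
  unfolding clinear_diff_def by (auto intro!: exI[of _ "\<lambda>_. 0"])

lemma clinear_diff_mult:
  assumes "R \<ge> 1" "clinear_diff R d f" "clinear_diff R e g"
  shows "clinear_diff R (d + e) (\<lambda>w. f w * g w)"
  unfolding clinear_diff_def
proof (intro allI impI conjI)
  fix w :: "'a hvec" assume w: "norm w \<le> R"
  obtain L where f: "norm (f w) \<le> R ^ d" and L: "(f has_derivative L) (at w)" 
    "\<And>v. L (\<i> *s fst v, \<i> *s snd v) = \<i> * L v" "\<And>v. norm (L v) \<le> real d * R ^ d * norm v"
    using assms(2) w unfolding clinear_diff_def by blast
  obtain M where g: "norm (g w) \<le> R ^ e" and M: "(g has_derivative M) (at w)" 
    "\<And>v. M (\<i> *s fst v, \<i> *s snd v) = \<i> * M v" "\<And>v. norm (M v) \<le> real e * R ^ e * norm v"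
    using assms(3) w unfolding clinear_diff_def by blast
  have R: "R \<ge> 0" using assms(1) by simp
  show "norm (f w * g w) \<le> R ^ (d + e)" 
    unfolding norm_mult power_add using f g R by (intro mult_mono) auto
  let ?L = "\<lambda>v. f w * M v + L v * g w"
  have "norm (?L v) \<le> real (d + e) * R ^ (d + e) * norm v" for v
  proof -
    have "norm (?L v) \<le> norm (f w) * norm (M v) + norm (L v) * norm (g w)"
      by (rule order_trans[OF norm_triangle_ineq]) (simp add: norm_mult)
    also have "\<dots> \<le> R ^ d * (real e * R ^ e * norm v) + (real d * R ^ d * norm v) * R ^ e"
      using f g L(3)[of v] M(3)[of v] R by (intro add_mono mult_mono) auto
    finally show ?thesis by (simp add: power_add algebra_simps)
  qed
  then show "\<exists>L. ((\<lambda>w. f w * g w) has_derivative L) (at w) \<and> (\<forall>v. L (\<i> *s fst v, \<i> *s snd v) = \<i> * L v) \<and>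
        (\<forall>v. norm (L v) \<le> real (d + e) * R ^ (d + e) * norm v)"
    using has_derivative_mult[OF L(1) M(1)] L(2) M(2)
    by (intro exI[of _ ?L]) (auto simp: algebra_simps)
qed

lemma norm_fst_nth_le: "norm (fst w $ i) \<le> norm (w :: ('n::finite) hvec)"
  using Finite_Cartesian_Product.norm_nth_le[of "fst w" i] norm_fst_le[of "fst w" "snd w"] by simp

lemma norm_snd_nth_le: "norm (snd w $ i) \<le> norm (w :: ('n::finite) hvec)"
  using Finite_Cartesian_Product.norm_nth_le[of "snd w" i] norm_snd_le[of "snd w" "fst w"] by simp

lemma clinear_diff_coord:
  fixes i :: "'n::finite option"
  assumes "R \<ge> 1"
  shows "clinear_diff R 1 (\<lambda>w. fst w $ i)" "clinear_diff R 1 (\<lambda>w. snd w $ i)"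
proof -
  have "bounded_linear (\<lambda>w::'n hvec. fst w $ i)" "bounded_linear (\<lambda>w::'n hvec. snd w $ i)" for i
    by (intro bounded_linear_compose[OF bounded_linear_vec_nth] bounded_linear_fst bounded_linear_snd)+
  then have d: "((\<lambda>w::'n hvec. fst w $ i) has_derivative (\<lambda>w. fst w $ i)) (at w)"
     "((\<lambda>w::'n hvec. snd w $ i) has_derivative (\<lambda>w. snd w $ i)) (at w)" for i w
    by (auto intro: bounded_linear_imp_has_derivative)
  have le: "x \<le> R * norm w" if "x \<le> norm w" for x and w :: "'n hvec"
    using mult_right_mono[OF assms, of "norm w"] that by simp
  show "clinear_diff R 1 (\<lambda>w::'n hvec. fst w $ i)"
    unfolding clinear_diff_def 
    by (intro allI impI conjI exI[of _ "\<lambda>w. fst w $ i"] d)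
       (use order_trans[OF norm_fst_nth_le] le[OF norm_fst_nth_le] in \<open>simp_all del: split_paired_All\<close>)
  show "clinear_diff R 1 (\<lambda>w::'n hvec. snd w $ i)"
    unfolding clinear_diff_def 
    by (intro allI impI conjI exI[of _ "\<lambda>w. snd w $ i"] d)
       (use order_trans[OF norm_snd_nth_le] le[OF norm_snd_nth_le] in \<open>simp_all del: split_paired_All\<close>)
qed

lemma clinear_diff_power:
  assumes "R \<ge> 1" "clinear_diff R 1 f"
  shows "clinear_diff R k (\<lambda>w. f w ^ k)"
proof (induction k)
  case (Suc k)
  then show ?case using clinear_diff_mult[OF assms(1,2) Suc] by simp
qed (use clinear_diff_one[OF assms(1)] in simp)

lemma clinear_diff_hmono:
  assumes "R \<ge> 1"
  shows "clinear_diff R (msum (fst x) + msum (snd x)) (hmono x)"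
proof -
  have "clinear_diff R (\<Sum>i\<in>A. fst x i + snd x i) (\<lambda>w. \<Prod>i\<in>A. (fst w $ i) ^ fst x i * (snd w $ i) ^ snd x i)" if "finite A" for A
    using that
    by (induction A rule: finite_induct) 
       (auto intro!: clinear_diff_one clinear_diff_mult clinear_diff_power clinear_diff_coord assms)
  from this[of UNIV] show ?thesis by (simp add: hmono_def[abs_def] msum_def sum.distrib)
qed

lemma norm_hmono_le:
  assumes "R \<ge> 1" "norm w \<le> R" "msum (fst x) = msum (snd x)"
  shows "norm (hmono x w) \<le> (R\<^sup>2) ^ msum (fst x)"
proof -
  have "norm (hmono x w) \<le> R ^ (msum (fst x) + msum (snd x))"
    using clinear_diff_hmono[OF assms(1), of x] assms(2) unfolding clinear_diff_def by blast
  also have "msum (fst x) + msum (snd x) = 2 * msum (fst x)" using assms(3) by simp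
  finally show ?thesis unfolding power_mult .
qed

text \<open>Termwise differentiation: \<open>B\<close> bounds the derivatives on the whole ball, so
  their partial sums converge uniformly, and commuting with \<i> passes to the sum.\<close>

lemma clinear_series_differentiable:
  fixes f :: "nat \<Rightarrow> ('n::finite) hvec \<Rightarrow> complex"
  assumes L: "\<And>n w. norm w < R \<Longrightarrow> (f n has_derivative L n w) (at w)"
      "\<And>n w v. norm w < R \<Longrightarrow> L n w (\<i> *s fst v, \<i> *s snd v) = \<i> * L n w v"
      "\<And>n w v. norm w < R \<Longrightarrow> norm (L n w v) \<le> B n * norm v"
    and B: "summable B" and sm: "\<And>w. norm w < R \<Longrightarrow> (\<lambda>n. f n w) sums F w" and w0: "norm w0 < R"
  shows "\<exists>L. (F has_derivative L) (at w0) \<and> (\<forall>v. L (\<i> *s fst v, \<i> *s snd v) = \<i> * L v)"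
proof -
  let ?S = "ball (0 :: 'n hvec) R"
  define G where "G w v = (\<Sum>n. L n w v)" for w v
  have Bv: "summable (\<lambda>n. B n * norm (v :: 'n hvec))" for v using B by (rule summable_mult2)
  have sL: "summable (\<lambda>n. L n w v)" if "norm w < R" for w v
    by (rule summable_comparison_test'[OF Bv[of v], of 0]) (use L(3)[OF that] in blast)
  have "\<exists>g. \<forall>x\<in>?S. (\<lambda>n. f n x) sums (g x) \<and> (g has_derivative G x) (at x within ?S)"
  proof (rule has_derivative_series)
    fix e :: real assume e: "e > 0"
    obtain N where N: "\<And>n. n \<ge> N \<Longrightarrow> norm (\<Sum>i. B (i + n)) < e"
      using suminf_exist_split[OF e B] by blast
    show "\<forall>\<^sub>F n in sequentially. \<forall>x\<in>?S. \<forall>h. norm (sum (\<lambda>i. L i x h) {..<n} - G x h) \<le> e * norm h"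
      unfolding eventually_sequentially
    proof (intro exI[of _ N] allI impI ballI)
      fix n x and h :: "'n hvec" assume n: "N \<le> n" and "x \<in> ?S"
      then have x: "norm x < R" by simp
      have "G x h - sum (\<lambda>i. L i x h) {..<n} = (\<Sum>i. L (i + n) x h)"
        unfolding G_def using suminf_split_initial_segment[OF sL[OF x], of h n] by simp
      then have "norm (sum (\<lambda>i. L i x h) {..<n} - G x h) = norm (\<Sum>i. L (i + n) x h)"
        by (simp add: norm_minus_commute)
      also have "\<dots> \<le> (\<Sum>i. B (i + n) * norm h)"
        by (rule norm_suminf_le) (use L(3)[OF x] Bv[of h] in \<open>auto simp: summable_iff_shift[of "\<lambda>n. B n * norm h"]\<close>)
      also have "\<dots> = (\<Sum>i. B (i + n)) * norm h"
        using B by (intro suminf_mult2[symmetric]) (simp add: summable_iff_shift)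
      also have "\<dots> \<le> e * norm h" using N[OF n] by (intro mult_right_mono) auto
      finally show "norm (sum (\<lambda>i. L i x h) {..<n} - G x h) \<le> e * norm h" .
    qed
  next
    show "(f n has_derivative L n x) (at x within ?S)" if "x \<in> ?S" for n x
      using L(1)[of x n] that by (auto intro: has_derivative_at_withinI)
    show "w0 \<in> ?S" "(\<lambda>n. f n w0) sums F w0" using w0 sm by auto
  qed simp
  then obtain g where g: "\<And>x. x \<in> ?S \<Longrightarrow> (\<lambda>n. f n x) sums (g x)" "\<And>x. x \<in> ?S \<Longrightarrow> (g has_derivative G x) (at x within ?S)"
    by blast
  have gF: "g x = F x" if "x \<in> ?S" for x using g(1)[OF that] sm[of x] that sums_unique2 by auto
  have "(g has_derivative G w0) (at w0)"
    using g(2)[of w0] w0 at_within_open[of w0 ?S] by simp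
  then have "(F has_derivative G w0) (at w0)"
    by (rule has_derivative_transform_within_open[of _ _ _ _ ?S]) (use w0 gF in auto)
  moreover have "G w0 (\<i> *s fst v, \<i> *s snd v) = \<i> * G w0 v" for v
    unfolding G_def L(2)[OF w0] by (rule suminf_mult[OF sL[OF w0]])
  ultimately show ?thesis by blast
qed

text \<open>The index \<open>j\<close> is kept apart from the monomial \<open>X j\<close> because
  the product series runs over triples, several of which may share a monomial.\<close>

definition mseries :: "('j \<Rightarrow> complex) \<Rightarrow> ('j \<Rightarrow> ('n::finite) hidx) \<Rightarrow> 'n hvec \<Rightarrow> complex" where
  "mseries \<gamma> X w = (\<Sum>\<^sub>\<infinity>j. \<gamma> j * hmono (X j) w)"

text \<open>Summability against every geometric rate in the degree, that is, normal convergence on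
  every ball. A monomial with |P| = |Q| has total degree 2|P|, which is why \<open>R\<^sup>2\<close>
  appears as the rate in the estimates.\<close>

definition mbounded :: "('j \<Rightarrow> real) \<Rightarrow> ('j \<Rightarrow> ('n::finite) hidx) \<Rightarrow> bool" where
  "mbounded B X \<longleftrightarrow> (\<forall>j. B j \<ge> 0) \<and> (\<forall>j. msum (fst (X j)) = msum (snd (X j))) \<and>
     (\<forall>R\<ge>1. (\<lambda>j. B j * R ^ msum (fst (X j))) summable_on UNIV)"

lemma mbounded_mono:
  assumes "mbounded B X" "\<And>j. 0 \<le> C j" "\<And>j. C j \<le> k * B j"
  shows "mbounded C X"
  unfolding mbounded_def
proof (intro conjI allI impI)
  fix R :: real assume R: "R \<ge> 1"
  then have "(\<lambda>j. k * (B j * R ^ msum (fst (X j)))) summable_on UNIV"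
    using assms(1) unfolding mbounded_def by (intro summable_on_cmult_right) auto
  then show "(\<lambda>j. C j * R ^ msum (fst (X j))) summable_on UNIV"
  proof (rule summable_on_comparison_test)
    fix j
    show "C j * R ^ msum (fst (X j)) \<le> k * (B j * R ^ msum (fst (X j)))"
      using mult_right_mono[OF assms(3)[of j], of "R ^ msum (fst (X j))"] R by simp
  qed (use assms(2) R in auto)
qed (use assms in \<open>auto simp: mbounded_def\<close>)

lemma mseries_term_le:
  assumes "mbounded B X" "\<And>j. norm (\<gamma> j) \<le> B j" "R \<ge> 1" "norm w \<le> R"
  shows "norm (\<gamma> j * hmono (X j) w) \<le> B j * (R\<^sup>2) ^ msum (fst (X j))"
  unfolding norm_mult using assms by (intro mult_mono norm_hmono_le) (auto simp: mbounded_def)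

lemma mbounded_summable_sq:
  assumes "mbounded B X" "R \<ge> 1"
  shows "(\<lambda>j. B j * (R\<^sup>2) ^ msum (fst (X j))) summable_on UNIV"
  using assms one_le_power[OF assms(2), of 2] unfolding mbounded_def by blast

lemma mseries_summable:
  assumes "mbounded B X" "\<And>j. norm (\<gamma> j) \<le> B j"
  shows "(\<lambda>j. \<gamma> j * hmono (X j) w) summable_on UNIV"
proof -
  have "(\<lambda>j. norm (\<gamma> j * hmono (X j) w)) summable_on UNIV"
    by (rule summable_on_comparison_test[OF mbounded_summable_sq[OF assms(1), of "max 1 (norm w)"]])
       (auto intro!: mseries_term_le[OF assms])
  then show ?thesis by (rule abs_summable_summable)
qed

lemma norm_mseries_le:
  assumes "mbounded B X" "\<And>j. norm (\<gamma> j) \<le> B j" "R \<ge> 1" "norm w \<le> R"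
  shows "norm (mseries \<gamma> X w) \<le> (\<Sum>\<^sub>\<infinity>j. B j * (R\<^sup>2) ^ msum (fst (X j)))"
  unfolding mseries_def
  by (rule norm_infsum_le[OF has_sum_infsum has_sum_infsum])
     (auto intro: mseries_summable[OF assms(1,2)] mbounded_summable_sq[OF assms(1,3)] mseries_term_le[OF assms])

lemma hmono_scale:
  assumes "msum (fst x) = msum (snd x)" "z \<noteq> 0"
  shows "hmono x (z *s p, (1 / z) *s q) = hmono x (p, q)"
proof -
  have "hmono x (z *s p, (1 / z) *s q) = (\<Prod>i\<in>UNIV. (z ^ fst x i * (1/z) ^ snd x i) * (p $ i ^ fst x i * q $ i ^ snd x i))"
    by (simp add: hmono_def power_mult_distrib power_divide mult_ac)
  also have "\<dots> = (z ^ msum (fst x) * (1/z) ^ msum (snd x)) * hmono x (p, q)"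
    by (simp add: prod.distrib msum_def power_sum hmono_def)
  also have "z ^ msum (fst x) * (1/z) ^ msum (snd x) = 1"
    using assms by (simp add: power_mult_distrib[symmetric])
  finally show ?thesis by simp
qed

lemma mseries_holo_hatD:
  fixes \<gamma> :: "'j::countable \<Rightarrow> complex"
  assumes bd: "mbounded B X" "\<And>j. norm (\<gamma> j) \<le> B j"
  shows "holo_hatD (mseries \<gamma> X)"
proof -
  have adm: "msum (fst (X j)) = msum (snd (X j))" and B0: "B j \<ge> 0" for j using bd(1) by (auto simp: mbounded_def)
  have "\<exists>L. (mseries \<gamma> X has_derivative L) (at w0) \<and> (\<forall>v. L (\<i> *s fst v, \<i> *s snd v) = \<i> * L v)" for w0
  proof -
    define R where "R = norm w0 + 1"
    have R: "R \<ge> 1" by (simp add: R_def)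
    define d where "d j = msum (fst (X j)) + msum (snd (X j))" for j
    have d2: "d j = 2 * msum (fst (X j))" for j using adm by (simp add: d_def)
    have "\<forall>j w. \<exists>L. norm w \<le> R \<longrightarrow> (hmono (X j) has_derivative L) (at w) \<and> (\<forall>v. L (\<i> *s fst v, \<i> *s snd v) = \<i> * L v) \<and>
        (\<forall>v. norm (L v) \<le> real (d j) * R ^ (d j) * norm v)"
      using clinear_diff_hmono[OF R] unfolding clinear_diff_def d_def by blast
    then obtain L where L: "\<And>j w. norm w \<le> R \<Longrightarrow> (hmono (X j) has_derivative L j w) (at w)"
        "\<And>j w v. norm w \<le> R \<Longrightarrow> L j w (\<i> *s fst v, \<i> *s snd v) = \<i> * L j w v"
        "\<And>j w v. norm w \<le> R \<Longrightarrow> norm (L j w v) \<le> real (d j) * R ^ (d j) * norm v"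
      by metis
    \<comment> \<open>The countable index is transported to the natural numbers, with zero terms off
      the range of \<open>to_nat\<close>.\<close>
    let ?T = "range (to_nat :: 'j \<Rightarrow> nat)"
    define f where "f n w = (if n \<in> ?T then \<gamma> (from_nat n) * hmono (X (from_nat n)) w else 0)" for n w
    define M where "M n w v = (if n \<in> ?T then \<gamma> (from_nat n) * L (from_nat n) w v else 0)" for n w v
    \<comment> \<open>Doubling the radius absorbs the degree in the derivative bound: d * R^d \<le>
      (2 * R)^d.\<close>
    define C where "C j = B j * ((2 * R)\<^sup>2) ^ msum (fst (X j))" for j
    define D where "D n = (if n \<in> ?T then C (from_nat n) else 0)" for n
    have reindex: "((\<lambda>n. if n \<in> ?T then g (from_nat n) else 0) has_sum s) UNIV" if "(g has_sum s) (UNIV :: 'j set)"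
      for g :: "'j \<Rightarrow> 'x::{comm_monoid_add,t2_space}" and s
    proof -
      have "((\<lambda>n. g (from_nat n)) has_sum s) ?T"
        using that by (subst has_sum_reindex) (auto simp: o_def)
      then show ?thesis by (rule has_sum_cong_neutral[THEN iffD1, rotated -1]) auto
    qed
    have "C summable_on UNIV" unfolding C_def using mbounded_summable_sq[OF bd(1), of "2 * R"] R by auto
    then have "D summable_on UNIV" unfolding D_def[abs_def] using reindex summable_on_def by metis
    then have sD: "summable D" by (rule summable_on_imp_summable)
    show ?thesis
    proof (rule clinear_series_differentiable[where f=f and L=M and B=D and R=R])
      fix n w assume w: "norm (w :: 'a hvec) < R"
      show "(f n has_derivative M n w) (at w)"
        unfolding f_def M_def using w by (cases "n \<in> ?T") (auto intro!: has_derivative_mult_right L)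
      show "M n w (\<i> *s fst v, \<i> *s snd v) = \<i> * M n w v" for v
        unfolding M_def using L(2)[of w] w by simp
      show "norm (M n w v) \<le> D n * norm v" for v
      proof (cases "n \<in> ?T")
        case True
        let ?j = "from_nat n :: 'j"
        have "real (d ?j) * R ^ d ?j \<le> 2 ^ d ?j * R ^ d ?j"
          using R of_nat_less_two_power[of "d ?j", where 'a=real] by (intro mult_right_mono) auto
        also have "\<dots> = ((2 * R)\<^sup>2) ^ msum (fst (X ?j))"
          unfolding d2 by (simp add: power_mult power_mult_distrib)
        finally have *: "norm (L ?j w v) \<le> ((2 * R)\<^sup>2) ^ msum (fst (X ?j)) * norm v"
          using L(3)[of w ?j v] w by (meson less_imp_le mult_right_mono norm_ge_zero order_trans)
        have "norm (\<gamma> ?j) * norm (L ?j w v) \<le> B ?j * (((2 * R)\<^sup>2) ^ msum (fst (X ?j)) * norm v)"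
          using * bd(2)[of ?j] B0[of ?j] by (intro mult_mono) auto
        then show ?thesis using True by (simp add: M_def D_def C_def norm_mult mult_ac)
      qed (simp add: M_def D_def)
      have "((\<lambda>j. \<gamma> j * hmono (X j) w) has_sum mseries \<gamma> X w) UNIV"
        unfolding mseries_def by (rule has_sum_infsum[OF mseries_summable[OF bd]])
      from reindex[OF this] show "(\<lambda>n. f n w) sums mseries \<gamma> X w"
        unfolding f_def by (rule has_sum_imp_sums)
    qed (use sD in \<open>auto simp: R_def\<close>)
  qed
  then have "holo_on UNIV (mseries \<gamma> X)" unfolding holo_on_def by auto
  then have "holo_hatZ (mseries \<gamma> X)" unfolding holo_hatZ_def by (intro ballI exI[of _ UNIV]) auto
  moreover have "mseries \<gamma> X (z *s p, (1 / z) *s q) = mseries \<gamma> X (p, q)" if "z \<noteq> 0" for z p q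
    unfolding mseries_def hmono_scale[OF adm that] ..
  ultimately show ?thesis by (simp add: holo_hatD_def)
qed

lemma holo_hatD_cong:
  assumes "holo_hatD g" "\<And>w. w \<in> hatZ \<Longrightarrow> h w = g w"
  shows "holo_hatD h"
proof -
  have inv: "(z *s p, (1 / z) *s q) \<in> hatZ" if "(p, q) \<in> hatZ" "z \<noteq> 0" for z p and q :: "'a cvec"
    using that by (simp add: hatZ_iff)
  have "holo_hatZ h"
    unfolding holo_hatZ_def
  proof
    fix z :: "'a hvec" assume "z \<in> hatZ"
    then obtain U k where "z \<in> U" "holo_on U k" "\<forall>w\<in>U \<inter> hatZ. g w = k w"
      using assms(1) unfolding holo_hatD_def holo_hatZ_def by blast
    then show "\<exists>U k. z \<in> U \<and> holo_on U k \<and> (\<forall>w\<in>U \<inter> hatZ. h w = k w)"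
      using assms(2) by (intro exI[of _ U] exI[of _ k]) auto
  qed
  moreover have "h (z *s p, (1 / z) *s q) = h (p, q)" if "z \<noteq> 0" "(p, q) \<in> hatZ" for z p q
    using assms that inv[OF that(2,1)] unfolding holo_hatD_def by simp
  ultimately show ?thesis by (simp add: holo_hatD_def)
qed

lemma holo_hatD_diff:
  assumes "holo_hatD g" "holo_hatD h"
  shows "holo_hatD (\<lambda>w. g w - h w)"
proof -
  have "holo_hatZ (\<lambda>w. g w - h w)"
    unfolding holo_hatZ_def
  proof
    fix z :: "'a hvec" assume z: "z \<in> hatZ"
    then obtain U k where U: "z \<in> U" "holo_on U k" "\<forall>w\<in>U \<inter> hatZ. g w = k w"
      using assms(1) unfolding holo_hatD_def holo_hatZ_def by blast
    obtain V l where V: "z \<in> V" "holo_on V l" "\<forall>w\<in>V \<inter> hatZ. h w = l w"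
      using assms(2) z unfolding holo_hatD_def holo_hatZ_def by blast
    have "holo_on (U \<inter> V) (\<lambda>w. k w - l w)"
      unfolding holo_on_def
    proof (intro conjI ballI)
      show "open (U \<inter> V)" using U V by (auto simp: holo_on_def)
      fix x assume x: "x \<in> U \<inter> V"
      obtain K where K: "(k has_derivative K) (at x)" "\<And>v. K (\<i> *s fst v, \<i> *s snd v) = \<i> * K v"
        using U x unfolding holo_on_def by blast
      obtain L where L: "(l has_derivative L) (at x)" "\<And>v. L (\<i> *s fst v, \<i> *s snd v) = \<i> * L v"
        using V x unfolding holo_on_def by blast
      show "\<exists>L. ((\<lambda>w. k w - l w) has_derivative L) (at x) \<and> (\<forall>v. L (\<i> *s fst v, \<i> *s snd v) = \<i> * L v)"
        by (intro exI[of _ "\<lambda>v. K v - L v"] conjI has_derivative_diff K L) (auto simp: K L algebra_simps)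
    qed
    then show "\<exists>U k. z \<in> U \<and> holo_on U k \<and> (\<forall>w\<in>U \<inter> hatZ. g w - h w = k w)"
      using U V by (intro exI[of _ "U \<inter> V"] exI[of _ "\<lambda>w. k w - l w"]) auto
  qed
  then show ?thesis using assms by (simp add: holo_hatD_def)
qed

definition resZ :: "(('n::finite) hvec \<Rightarrow> complex) \<Rightarrow> 'n cvec \<Rightarrow> complex" where
  "resZ h r = (if r \<in> ZZ then h (r, cnjv r) else 0)"

text \<open>The difference of two candidates vanishes on the diagonal, hence on \<open>hatZ\<close>
  by the identity theorem.\<close>

lemma hatA_unique:
  assumes "holo_hatD h" "\<And>w. w \<notin> hatZ \<Longrightarrow> h w = 0" "\<And>r. r \<in> ZZ \<Longrightarrow> a r = h (r, cnjv r)"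
  shows "hatA a = h"
  unfolding hatA_def
proof (rule the_equality)
  show "holo_hatD h \<and> (\<forall>w. w \<notin> hatZ \<longrightarrow> h w = 0) \<and> (\<forall>r\<in>ZZ. a r = h (r, cnjv r))" using assms by auto
  fix g assume g: "holo_hatD g \<and> (\<forall>w. w \<notin> hatZ \<longrightarrow> g w = 0) \<and> (\<forall>r\<in>ZZ. a r = g (r, cnjv r))"
  have "g w - h w = 0" if "w \<in> hatZ" for w
    by (rule holo_hatD_vanish[OF holo_hatD_diff _ that]) (use g assms in auto)
  then show "g = h" using g assms(2) by (metis eq_iff_diff_eq_0 ext)
qed

lemma resZ_in_AD:
  assumes "holo_hatD h"
  shows "resZ h \<in> AD"
  using assms unfolding AD_def resZ_def by auto

lemma hatA_resZ:
  assumes "holo_hatD h"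
  shows "hatA (resZ h) = (\<lambda>w. if w \<in> hatZ then h w else 0)"
  by (rule hatA_unique) (use assms in \<open>auto simp: resZ_def ZZ_hatZ[symmetric] intro: holo_hatD_cong\<close>)

lemma AD_eq_resZ:
  assumes "a \<in> AD"
  obtains h where "holo_hatD h" "a = resZ h"
proof -
  obtain h where "holo_hatD h" "\<forall>r\<in>ZZ. a r = h (r, cnjv r)" "\<forall>r. r \<notin> ZZ \<longrightarrow> a r = 0"
    using assms unfolding AD_def by blast
  then show ?thesis by (intro that[of h]) (auto simp: resZ_def)
qed

lemma holo_hatD_hatA:
  assumes "a \<in> AD"
  shows "holo_hatD (hatA a)" "resZ (hatA a) = a"
proof -
  obtain h where h: "holo_hatD h" "a = resZ h" using AD_eq_resZ[OF assms] .
  show "holo_hatD (hatA a)" unfolding h(2) hatA_resZ[OF h(1)] by (rule holo_hatD_cong[OF h(1)]) auto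
  show "resZ (hatA a) = a" unfolding h(2) hatA_resZ[OF h(1)] by (auto simp: resZ_def ZZ_hatZ)
qed

section \<open>Series depending holomorphically on a parameter\<close>

text \<open>Taylor's formula of second order, with Cauchy's bound for the second derivative on
  circles of radius r/4; 32 is 2! * 4^2. Linearity in \<open>B\<close> allows the estimate to be
  summed over all terms of a series.\<close>

lemma holomorphic_quotient_error:
  assumes g: "g holomorphic_on ball t0 r" and b: "\<And>s. s \<in> ball t0 r \<Longrightarrow> norm (g s) \<le> B"
    and t: "t \<in> ball t0 (r / 2)" "t \<noteq> t0"
  shows "norm ((g t - g t0) / (t - t0) - deriv g t0) \<le> 32 * B / r\<^sup>2 * norm (t - t0)"
proof -
  have r: "r > 0" using t by (metis dist_not_less_zero half_gt_zero_iff less_le_trans mem_ball not_less order_le_less_trans zero_le_dist)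
  let ?S = "ball t0 (r / 2)"
  have d2: "norm ((deriv ^^ 2) g s) \<le> 32 * B / r\<^sup>2" if s: "s \<in> ?S" for s
  proof -
    have sub: "cball s (r / 4) \<subseteq> ball t0 r"
    proof
      fix x assume "x \<in> cball s (r / 4)"
      then show "x \<in> ball t0 r" using s dist_triangle[of t0 x s] r by auto
    qed
    have "norm ((deriv ^^ 2) g s) \<le> fact 2 * B / (r / 4) ^ 2"
    proof (rule Cauchy_inequality)
      show "g holomorphic_on ball s (r / 4)" using sub by (intro holomorphic_on_subset[OF g]) auto
      show "continuous_on (cball s (r / 4)) g"
        using sub by (intro holomorphic_on_imp_continuous_on holomorphic_on_subset[OF g]) auto
      show "norm (g x) \<le> B" if "norm (s - x) = r / 4" for x
        using sub that by (intro b subsetD[OF sub]) (auto simp: dist_norm)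
    qed (use r in auto)
    also have "\<dots> = 32 * B / r\<^sup>2" by (simp add: power_divide)
    finally show ?thesis .
  qed
  have hol: "(deriv ^^ i) g holomorphic_on ball t0 r" for i by (rule holomorphic_higher_deriv[OF g]) simp
  have "norm ((deriv ^^ 0) g t - (\<Sum>i\<le>1. (deriv ^^ i) g t0 * (t - t0) ^ i / fact i))
      \<le> 32 * B / r\<^sup>2 * norm (t - t0) ^ (Suc 1) / fact 1"
  proof (rule complex_Taylor[of ?S])
    show "((deriv ^^ i) g has_field_derivative (deriv ^^ Suc i) g x) (at x within ?S)" if "x \<in> ?S" for i x
    proof -
      have "x \<in> ball t0 r" using that r by auto
      then show ?thesis using holomorphic_derivI[OF hol[of i], of x] by (auto intro: has_field_derivative_at_within)
    qed
    show "norm ((deriv ^^ Suc 1) g x) \<le> 32 * B / r\<^sup>2" if "x \<in> ?S" for x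
      using d2[OF that] by (simp add: numeral_2_eq_2)
  qed (use t r in auto)
  then have "norm (g t - g t0 - deriv g t0 * (t - t0)) \<le> 32 * B / r\<^sup>2 * norm (t - t0) * norm (t - t0)"
    by (simp add: diff_diff_add power2_eq_square mult.assoc)
  moreover have "(g t - g t0) / (t - t0) - deriv g t0 = (g t - g t0 - deriv g t0 * (t - t0)) / (t - t0)"
    using t by (simp add: field_simps)
  ultimately show ?thesis using t by (simp add: norm_divide pos_divide_le_eq)
qed

lemma holomorphic_deriv_bound:
  assumes g: "g holomorphic_on ball t0 r" and b: "\<And>s. s \<in> ball t0 r \<Longrightarrow> norm (g s) \<le> B" and r: "r > 0"
  shows "norm (deriv g t0) \<le> 2 / r * B"
proof -
  have "norm ((deriv ^^ 1) g t0) \<le> fact 1 * B / (r / 2) ^ 1"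
  proof (rule Cauchy_inequality)
    show "g holomorphic_on ball t0 (r / 2)" using r by (intro holomorphic_on_subset[OF g]) auto
    show "continuous_on (cball t0 (r / 2)) g"
      using r by (intro holomorphic_on_imp_continuous_on holomorphic_on_subset[OF g]) auto
    show "norm (g x) \<le> B" if "norm (t0 - x) = r / 2" for x
      using that r by (intro b) (auto simp: dist_norm)
  qed (use r in auto)
  then show ?thesis by (simp add: mult.commute)
qed

lemma compact_norm_bound:
  fixes K :: "'a::real_normed_vector set"
  assumes "compact K"
  obtains R where "R \<ge> 1" "\<And>w. w \<in> K \<Longrightarrow> norm w \<le> R"
proof -
  obtain b where "\<forall>x\<in>K. norm x \<le> b" using compact_imp_bounded[OF assms] bounded_iff by blast
  then show ?thesis by (intro that[of "max 1 b"]) auto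
qed

text \<open>The derivative is the series of the derivatives of the coefficients. The errors of the
  difference quotients are themselves coefficients of such a series, dominated by a multiple of
  \<open>norm (t - t0) * B j\<close>, so the norm bound for series gives uniform convergence on
  compact sets.\<close>

lemma holoA_mseries:
  fixes \<gamma> :: "'j::countable \<Rightarrow> complex \<Rightarrow> complex" and X :: "'j \<Rightarrow> ('n::finite) hidx"
  assumes U: "open U" and hol: "\<And>j. \<gamma> j holomorphic_on U"
    and loc: "\<And>t. t \<in> U \<Longrightarrow> \<exists>r>0. ball t r \<subseteq> U \<and> (\<exists>B. mbounded B X \<and> (\<forall>j. \<forall>s\<in>ball t r. norm (\<gamma> j s) \<le> B j))"
  shows "holoA U (\<lambda>t. resZ (mseries (\<lambda>j. \<gamma> j t) X))"
  unfolding holoA_def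
proof (intro conjI ballI)
  let ?H = "\<lambda>t. hatA (resZ (mseries (\<lambda>j. \<gamma> j t) X))"
  have holo: "holo_hatD (mseries (\<lambda>j. \<gamma> j t) X)" if t: "t \<in> U" for t
  proof -
    obtain r B where "r > 0" "mbounded B X" "\<forall>j. \<forall>s\<in>ball t r. norm (\<gamma> j s) \<le> B j" using loc[OF t] by blast
    then show ?thesis by (intro mseries_holo_hatD[of B]) auto
  qed
  show "resZ (mseries (\<lambda>j. \<gamma> j t) X) \<in> AD" if "t \<in> U" for t
    by (rule resZ_in_AD[OF holo[OF that]])
  fix t0 assume t0: "t0 \<in> U"
  obtain r B where r: "r > 0" "ball t0 r \<subseteq> U" and B: "mbounded B X" "\<And>j s. s \<in> ball t0 r \<Longrightarrow> norm (\<gamma> j s) \<le> B j"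
    using loc[OF t0] by blast
  have holb: "\<gamma> j holomorphic_on ball t0 r" for j by (rule holomorphic_on_subset[OF hol r(2)])
  let ?d = "\<lambda>j. deriv (\<gamma> j) t0"
  have db: "norm (?d j) \<le> 2 / r * B j" for j by (rule holomorphic_deriv_bound[OF holb B(2) r(1)])
  have B0: "B j \<ge> 0" for j using B(1) by (simp add: mbounded_def)
  have mb2: "mbounded (\<lambda>j. 2 / r * B j) X" by (rule mbounded_mono[OF B(1), of _ "2/r"]) (use B0 r in auto)
  have holod: "holo_hatD (mseries ?d X)" by (rule mseries_holo_hatD[OF mb2 db])
  show "\<exists>D\<in>AD. \<forall>K. compact K \<and> K \<subseteq> hatZ \<longrightarrow>
        uniform_limit K (\<lambda>t w. (?H t w - ?H t0 w) / (t - t0)) (hatA D) (at t0)"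
  proof (intro bexI[of _ "resZ (mseries ?d X)"] resZ_in_AD holod allI impI, elim conjE)
    fix K :: "'n hvec set" assume K: "compact K" "K \<subseteq> hatZ"
    obtain R where R: "R \<ge> 1" "\<And>w. w \<in> K \<Longrightarrow> norm w \<le> R" using compact_norm_bound[OF K(1)] by blast
    define M where "M = (\<Sum>\<^sub>\<infinity>j. (32 / r\<^sup>2 * B j) * (R\<^sup>2) ^ msum (fst (X j)))"
    have mb: "mbounded (\<lambda>j. k * B j) X" if "k \<ge> 0" for k
      by (rule mbounded_mono[OF B(1), of _ k]) (use that B0 in auto)
    have est: "norm ((?H t w - ?H t0 w) / (t - t0)
         - hatA (resZ (mseries ?d X)) w) \<le> M * norm (t - t0)"
      if t: "t \<in> ball t0 (r / 2)" "t \<noteq> t0" and w: "w \<in> K" for t w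
    proof -
      have tr: "t \<in> ball t0 r" "t0 \<in> ball t0 r" "t \<in> U" using t r by auto
      have wZ: "w \<in> hatZ" using w K by auto
      let ?e = "\<lambda>j. (\<gamma> j t - \<gamma> j t0) / (t - t0) - ?d j"
      have eb: "norm (?e j) \<le> (32 / r\<^sup>2 * norm (t - t0)) * B j" for j
        using holomorphic_quotient_error[OF holb B(2) t, of j] by (simp add: mult_ac)
      have s1: "((\<lambda>j. \<gamma> j s * hmono (X j) w) has_sum mseries (\<lambda>j. \<gamma> j s) X w) UNIV" if "s \<in> ball t0 r" for s
        unfolding mseries_def by (rule has_sum_infsum[OF mseries_summable[OF B(1) B(2)[OF that]]])
      have s2: "((\<lambda>j. ?d j * hmono (X j) w) has_sum mseries ?d X w) UNIV"
        unfolding mseries_def by (rule has_sum_infsum[OF mseries_summable[OF mb2 db]])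
      have "((\<lambda>j. (\<gamma> j t * hmono (X j) w + - (\<gamma> j t0 * hmono (X j) w)) * (1 / (t - t0)) + - (?d j * hmono (X j) w)) has_sum
          ((mseries (\<lambda>j. \<gamma> j t) X w + - mseries (\<lambda>j. \<gamma> j t0) X w) * (1 / (t - t0)) + - mseries ?d X w)) UNIV"
        by (intro has_sum_add has_sum_cmult_left has_sum_uminusI s1 s2 tr)
      then have "mseries ?e X w = (mseries (\<lambda>j. \<gamma> j t) X w + - mseries (\<lambda>j. \<gamma> j t0) X w) * (1 / (t - t0)) + - mseries ?d X w"
        unfolding mseries_def[of ?e] by (intro infsumI) (simp add: algebra_simps diff_divide_distrib)
      then have "(?H t w - ?H t0 w) / (t - t0)
         - hatA (resZ (mseries ?d X)) w = mseries ?e X w"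
        using wZ by (simp add: hatA_resZ holo tr t0 holod)
      also have "norm \<dots> \<le> (\<Sum>\<^sub>\<infinity>j. ((32 / r\<^sup>2 * norm (t - t0)) * B j) * (R\<^sup>2) ^ msum (fst (X j)))"
        by (rule norm_mseries_le[OF mb eb R(1) R(2)[OF w]]) simp
      also have "\<dots> = (\<Sum>\<^sub>\<infinity>j. norm (t - t0) * ((32 / r\<^sup>2 * B j) * (R\<^sup>2) ^ msum (fst (X j))))"
        by (simp add: mult_ac)
      also have "\<dots> = M * norm (t - t0)"
        unfolding M_def by (subst infsum_cmult_right') (simp add: mult.commute)
      finally show ?thesis .
    qed
    show "uniform_limit K (\<lambda>t w. (?H t w - ?H t0 w) / (t - t0))
        (hatA (resZ (mseries ?d X))) (at t0)"
      unfolding uniform_limit_iff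
    proof (intro allI impI)
      fix e :: real assume e: "e > 0"
      have "eventually (\<lambda>t. t \<in> ball t0 (min (r / 2) (e / (\<bar>M\<bar> + 1))) \<and> t \<noteq> t0) (at t0)"
        using r e by (intro eventually_conj eventually_at_in_open' eventually_neq_at_within) auto
      then show "\<forall>\<^sub>F t in at t0. \<forall>w\<in>K. dist ((?H t w - ?H t0 w) / (t - t0))
          (hatA (resZ (mseries ?d X)) w) < e"
      proof eventually_elim
        case (elim t)
        have "M * norm (t - t0) \<le> \<bar>M\<bar> * norm (t - t0)" by (intro mult_right_mono) auto
        also have "\<dots> \<le> (\<bar>M\<bar> + 1) * norm (t - t0)" by (intro mult_right_mono) auto
        also have "\<dots> < e" using elim by (auto simp: dist_norm norm_minus_commute pos_less_divide_eq mult.commute)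
        finally show ?case using est[of t] elim unfolding dist_norm by (auto intro: le_less_trans)
      qed
    qed
  qed
qed (rule U)

section \<open>The monomial basis\<close>

definition wA :: "('n::finite) bix \<Rightarrow> nat" where "wA x = (\<Sum>i\<in>UNIV. x (Inl i))"
definition wB :: "('n::finite) bix \<Rightarrow> nat" where "wB x = (\<Sum>i\<in>UNIV. x (Inr i))"

text \<open>By truncated subtraction one of the two components at \<open>None\<close> is zero, and the other one makes the
  degrees agree.\<close>

definition bidx :: "('n::finite) bix \<Rightarrow> 'n hidx" where
  "bidx x = (case_option (wB x - wA x) (\<lambda>i. x (Inl i)), case_option (wA x - wB x) (\<lambda>i. x (Inr i)))"

definition dotp :: "('n::finite + 'n \<Rightarrow> complex) \<Rightarrow> complex" where
  "dotp z = (\<Sum>i\<in>UNIV. z (Inl i) * z (Inr i))"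

text \<open>With one component at \<open>None\<close> normalised to 1, the equation of
  \<open>hatZ\<close> makes the other 1 + p'.q'. Unlike \<open>aff_pt\<close> this is polynomial and
  defined everywhere. \<open>True\<close> stands for the gauge q_0 = 1.\<close>

definition gauge_pt :: "bool \<Rightarrow> ('n::finite + 'n \<Rightarrow> complex) \<Rightarrow> 'n hvec" where
  "gauge_pt s z = (cons0 (if s then 1 + dotp z else 1) (\<lambda>i. z (Inl i)), cons0 (if s then 1 else 1 + dotp z) (\<lambda>i. z (Inr i)))"

text \<open>The gauge is chosen so that the component at \<open>None\<close> which may occur in
  \<open>hmono (bidx x)\<close> equals 1; this basis monomial then becomes the plain monomial with
  exponent \<open>x\<close>.\<close>

definition bcoeff :: "(('n::finite) hvec \<Rightarrow> complex) \<Rightarrow> 'n bix \<Rightarrow> complex" where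
  "bcoeff h x = taylor_coeff x (\<lambda>z. h (gauge_pt (wB x \<le> wA x) z))"

lemma sum_UNIV_Plus: "(\<Sum>j\<in>(UNIV :: ('a::finite + 'b::finite) set). f j) = (\<Sum>i\<in>UNIV. f (Inl i)) + (\<Sum>i\<in>UNIV. f (Inr i))"
  unfolding UNIV_Plus_UNIV[symmetric] by (subst sum.Plus) (auto simp: o_def)

lemma prod_UNIV_Plus: "(\<Prod>j\<in>(UNIV :: ('a::finite + 'b::finite) set). f j) = (\<Prod>i\<in>UNIV. f (Inl i)) * (\<Prod>i\<in>UNIV. f (Inr i))"
  unfolding UNIV_Plus_UNIV[symmetric] by (subst prod.Plus) (auto simp: o_def)

lemma sum_eq_wA_wB: "sum x UNIV = wA x + wB x"
  by (simp add: wA_def wB_def sum_UNIV_Plus)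

lemma msum_bidx: "msum (fst (bidx x)) = max (wA x) (wB x)" "msum (snd (bidx x)) = max (wA x) (wB x)"
  by (auto simp: bidx_def msum_def sum_UNIV_option wA_def[symmetric] wB_def[symmetric])

lemma inj_bidx: "inj bidx"
proof (rule injI)
  fix x y :: "'a bix" assume e: "bidx x = bidx y"
  have "x (Inl i) = y (Inl i)" for i using fun_cong[OF arg_cong[OF e, of fst], of "Some i"] by (simp add: bidx_def)
  moreover have "x (Inr i) = y (Inr i)" for i using fun_cong[OF arg_cong[OF e, of snd], of "Some i"] by (simp add: bidx_def)
  ultimately show "x = y" by (metis ext sumE)
qed

lemma gauge_pt_in_hatZ: "gauge_pt s z \<in> hatZ"
  by (simp add: gauge_pt_def hatZ_iff dotp_def)

lemma continuous_on_gauge_pt: "continuous_on S (gauge_pt s)"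
proof -
  have d: "continuous_on S dotp" unfolding dotp_def by (intro continuous_intros)
  have c: "continuous_on S (\<lambda>z. cons0 (f z) (g z))" if "continuous_on S f" "\<And>i. continuous_on S (\<lambda>z. g z i)" 
    for f and g :: "_ \<Rightarrow> 'a \<Rightarrow> complex"
    unfolding cons0_def
  proof (rule continuous_on_vec_lambda)
    show "continuous_on S (\<lambda>x. case \<mu> of None \<Rightarrow> f x | Some i \<Rightarrow> g x i)" for \<mu>
      using that by (cases \<mu>) auto
  qed
  show ?thesis unfolding gauge_pt_def[abs_def]
    by (cases s; simp; intro continuous_on_Pair c continuous_intros d)
qed

lemma sep_entire_gauge:
  assumes "holo_hatZ h"
  shows "sep_entire (\<lambda>z. h (gauge_pt s z))"
  unfolding sep_entire_def
proof (intro conjI allI)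
  show "continuous_on UNIV (\<lambda>z. h (gauge_pt s z))"
    by (rule continuous_on_compose2[OF holo_hatZ_continuous[OF assms] continuous_on_gauge_pt]) (auto simp: gauge_pt_in_hatZ)
  fix j and z :: "'a + 'a \<Rightarrow> complex"
  have c: "(\<lambda>u. (z(j := u)) k) holomorphic_on UNIV" for k by (cases "k = j") (auto intro: holomorphic_intros)
  have d: "(\<lambda>u. dotp (z(j := u))) holomorphic_on UNIV" unfolding dotp_def by (intro holomorphic_intros c)
  show "(\<lambda>u. h (gauge_pt s (z(j := u)))) holomorphic_on UNIV"
  proof (rule holo_hatZ_curve[OF assms])
    show "(\<lambda>u. fst (gauge_pt s (z(j := u))) $ i) holomorphic_on UNIV" for i
      using d c by (cases i; cases s) (auto simp: gauge_pt_def simp del: fun_upd_apply intro!: holomorphic_intros)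
    show "(\<lambda>u. snd (gauge_pt s (z(j := u))) $ i) holomorphic_on UNIV" for i
      using d c by (cases i; cases s) (auto simp: gauge_pt_def simp del: fun_upd_apply intro!: holomorphic_intros)
  qed (auto simp: gauge_pt_in_hatZ)
qed

lemma continuous_gauge:
  assumes "holo_hatD h"
  shows "continuous_on UNIV (\<lambda>z. h (gauge_pt s z))"
  using sep_entire_gauge[of h s] assms by (simp add: sep_entire_def holo_hatD_def)

text \<open>The link between seminorms and coordinates: a bound for a function on this compact set
  gives Cauchy estimates of rate \<rho> for all its coordinates, in both gauges.\<close>

definition gauge_compact :: "real \<Rightarrow> (('n::finite) hvec) set" where
  "gauge_compact \<rho> = (\<Union>s. gauge_pt s ` {z. \<forall>i. norm (z i) \<le> \<rho>})"

lemma gauge_compact: "compact (gauge_compact \<rho>)" "gauge_compact \<rho> \<subseteq> hatZ"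
  unfolding gauge_compact_def
  by (auto simp: gauge_pt_in_hatZ intro!: compact_UN compact_continuous_image continuous_on_gauge_pt compact_polydisc)

lemma norm_bcoeff_le:
  assumes "holo_hatD h" "\<rho> > 0" "\<And>w. w \<in> gauge_compact \<rho> \<Longrightarrow> norm (h w) \<le> M"
  shows "norm (bcoeff h x) \<le> M / \<rho> ^ sum x UNIV"
  unfolding bcoeff_def
proof (rule norm_taylor_coeff_le[OF sep_entire_gauge assms(2)])
  show "holo_hatZ h" using assms(1) by (simp add: holo_hatD_def)
  fix z :: "'a + 'a \<Rightarrow> complex" assume "\<And>i. norm (z i) = \<rho>"
  then show "norm (h (gauge_pt (wB x \<le> wA x) z)) \<le> M"
    by (intro assms(3)) (auto simp: gauge_compact_def simp del: split_paired_All intro!: exI[of _ "wB x \<le> wA x"] imageI)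
qed

lemma bcoeff_cong:
  assumes "\<And>w. w \<in> hatZ \<Longrightarrow> g w = h w"
  shows "bcoeff g = bcoeff h"
  unfolding bcoeff_def fun_eq_iff using assms[OF gauge_pt_in_hatZ] by simp

lemma bcoeff_diff:
  assumes "holo_hatD g" "holo_hatD h"
  shows "bcoeff (\<lambda>w. g w - h w) x = bcoeff g x - bcoeff h x"
  unfolding bcoeff_def by (intro taylor_coeff_diff continuous_gauge assms)

lemma bcoeff_sum:
  assumes "\<And>a. a \<in> A \<Longrightarrow> holo_hatD (g a)"
  shows "bcoeff (\<lambda>w. \<Sum>a\<in>A. c a * g a w) x = (\<Sum>a\<in>A. c a * bcoeff (g a) x)"
  unfolding bcoeff_def
  by (subst taylor_coeff_sum, intro continuous_on_mult continuous_on_const continuous_gauge[OF assms])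
     (simp_all add: taylor_coeff_cmult)

lemma prod_upd_Suc:
  fixes z :: "'i::finite \<Rightarrow> complex"
  shows "(\<Prod>j\<in>UNIV. z j ^ (y(i := Suc (y i))) j) = z i * (\<Prod>j\<in>UNIV. z j ^ y j)"
proof -
  have "(\<Prod>j\<in>UNIV. z j ^ (y(i := Suc (y i))) j) = (\<Prod>j\<in>UNIV. (if j = i then z i else 1) * z j ^ y j)"
    by (intro prod.cong) auto
  then show ?thesis by (simp add: prod.distrib)
qed

text \<open>Every summand of \<open>dotp\<close> raises \<open>wA\<close> and \<open>wB\<close> by
  one, so multiplication by \<open>1 + dotp z\<close> preserves the weight wA - wB. The hypothesis
  compares weights additively because natural subtraction truncates.\<close>

lemma taylor_coeff_weight:
  fixes x y :: "('n::finite) bix"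
  assumes "wA x + wB y \<noteq> wA y + wB x"
  shows "taylor_coeff x (\<lambda>z. (\<Prod>j\<in>UNIV. z j ^ y j) * (1 + dotp z) ^ k) = 0"
  using assms
proof (induction k arbitrary: y)
  case 0
  then show ?case by (auto simp: taylor_coeff_monomial)
next
  case (Suc k)
  define y' where "y' i = (y(Inl i := Suc (y (Inl i))))(Inr i := Suc (y (Inr i)))" for i
  have d: "continuous_on UNIV (dotp :: ('n + 'n \<Rightarrow> complex) \<Rightarrow> complex)" unfolding dotp_def by (intro continuous_intros)
  have c: "continuous_on UNIV (\<lambda>z::'n + 'n \<Rightarrow> complex. (\<Prod>j\<in>UNIV. z j ^ y j) * (1 + dotp z) ^ k)" for y
    by (intro continuous_intros d)
  have p: "(\<Prod>j\<in>UNIV. z j ^ y' i j) = z (Inl i) * z (Inr i) * (\<Prod>j\<in>UNIV. z j ^ y j)" for z :: "'n + 'n \<Rightarrow> complex" and i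
    using prod_upd_Suc[of z "y(Inl i := Suc (y (Inl i)))" "Inr i"] prod_upd_Suc[of z y "Inl i"]
    by (simp add: y'_def mult_ac)
  have w: "wA (y' i) = Suc (wA y)" "wB (y' i) = Suc (wB y)" for i
  proof -
    have "wA (y' i) = (\<Sum>j\<in>UNIV. y (Inl j) + (if j = i then 1 else 0))" "wB (y' i) = (\<Sum>j\<in>UNIV. y (Inr j) + (if j = i then 1 else 0))"
      unfolding wA_def wB_def y'_def by (intro sum.cong; auto)+
    then show "wA (y' i) = Suc (wA y)" "wB (y' i) = Suc (wB y)" by (simp_all add: sum.distrib wA_def wB_def)
  qed
  have "(\<lambda>z. (\<Prod>j\<in>UNIV. z j ^ y j) * (1 + dotp z) ^ Suc k) =
      (\<lambda>z. (\<Prod>j\<in>UNIV. z j ^ y j) * (1 + dotp z) ^ k + (\<Sum>i\<in>UNIV. (\<Prod>j\<in>UNIV. z j ^ y' i j) * (1 + dotp z) ^ k))"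
    by (auto simp: p fun_eq_iff algebra_simps dotp_def sum_distrib_left sum_distrib_right)
  then have "taylor_coeff x (\<lambda>z. (\<Prod>j\<in>UNIV. z j ^ y j) * (1 + dotp z) ^ Suc k) =
     taylor_coeff x (\<lambda>z. (\<Prod>j\<in>UNIV. z j ^ y j) * (1 + dotp z) ^ k) + (\<Sum>i\<in>UNIV. taylor_coeff x (\<lambda>z. (\<Prod>j\<in>UNIV. z j ^ y' i j) * (1 + dotp z) ^ k))"
    by (simp only: taylor_coeff_add[OF c continuous_on_sum[OF c]] taylor_coeff_sum[OF c])
  also have "\<dots> = 0" using Suc by (simp add: w)
  finally show ?case .
qed

lemma hmono_bidx_gauge:
  "hmono (bidx y) (gauge_pt s z) = (\<Prod>j\<in>UNIV. z j ^ y j) * (1 + dotp z) ^ (if s then wB y - wA y else wA y - wB y)"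
  by (simp add: hmono_def gauge_pt_def bidx_def prod_UNIV_option prod_UNIV_Plus prod.distrib)

text \<open>If \<open>x\<close> and \<open>y\<close> select the same gauge,
  \<open>hmono (bidx y)\<close> is a plain monomial there. Otherwise one weight is nonnegative and
  the other negative, and the coefficient vanishes by comparison of weights.\<close>

lemma bcoeff_hmono_bidx: "bcoeff (hmono (bidx y)) x = (if x = y then 1 else 0)"
proof -
  have *: "taylor_coeff x (\<lambda>z. hmono (bidx y) (gauge_pt (wB x \<le> wA x) z)) = (if x = y then 1 else 0)"
  proof (cases "(wB x \<le> wA x) = (wB y \<le> wA y)")
    case True
    then have "(if wB x \<le> wA x then wB y - wA y else wA y - wB y) = 0" by auto
    then show ?thesis by (simp add: hmono_bidx_gauge taylor_coeff_monomial del: if_split)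
  next
    case False
    then show ?thesis by (auto simp: hmono_bidx_gauge taylor_coeff_weight)
  qed
  then show ?thesis by (simp add: bcoeff_def)
qed

lemma hmono_holo_hatD:
  assumes "msum (fst x) = msum (snd x)"
  shows "holo_hatD (hmono x)"
proof -
  have "holo_hatD (mseries (\<lambda>_::unit. 1) (\<lambda>_. x))"
    by (rule mseries_holo_hatD[of "\<lambda>_. 1"]) (use assms in \<open>auto simp: mbounded_def\<close>)
  then show ?thesis by (simp add: mseries_def[abs_def])
qed

lemma holo_hatD_sum_hmono:
  fixes X :: "'j::countable \<Rightarrow> ('n::finite) hidx"
  assumes "finite F" "\<And>j. j \<in> F \<Longrightarrow> msum (fst (X j)) = msum (snd (X j))"
  shows "holo_hatD (\<lambda>w. \<Sum>j\<in>F. u j * hmono (X j) w)"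
proof -
  \<comment> \<open>Indices outside \<open>F\<close> receive the constant monomial, because
    \<open>mbounded\<close> demands equal degrees at every index.\<close>
  define Y where "Y j = (if j \<in> F then X j else (\<lambda>_. 0, \<lambda>_. 0))" for j
  define v where "v j = (if j \<in> F then u j else 0)" for j
  have "mbounded (\<lambda>j. norm (v j)) Y"
    unfolding mbounded_def
  proof (intro conjI allI impI)
    show "(\<lambda>j. norm (v j) * R ^ msum (fst (Y j))) summable_on UNIV" for R
      by (rule finite_nonzero_values_imp_summable_on, rule finite_subset[OF _ assms(1)]) (auto simp: v_def)
  qed (use assms(2) in \<open>auto simp: Y_def msum_def\<close>)
  from mseries_holo_hatD[OF this order_refl] have "holo_hatD (mseries v Y)" .
  moreover have "mseries v Y w = (\<Sum>j\<in>F. u j * hmono (X j) w)" for w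
    unfolding mseries_def
    by (subst infsum_cong_neutral[where T=F and g="\<lambda>j. u j * hmono (X j) w"]) (use assms(1) in \<open>auto simp: v_def Y_def\<close>)
  then have "mseries v Y = (\<lambda>w. \<Sum>j\<in>F. u j * hmono (X j) w)" by (rule ext)
  ultimately show ?thesis by simp
qed

text \<open>The degree of \<open>bidx x\<close> is at most \<open>sum x UNIV\<close>. Decay at rate
  \<open>2 * R\<close> thus outweighs the growth \<open>R ^ degree\<close> and leaves a geometric
  series of ratio 1/2.\<close>

lemma mbounded_bidx:
  fixes u :: "('n::finite) bix \<Rightarrow> real"
  assumes "\<And>\<rho>. \<rho> \<ge> 1 \<Longrightarrow> \<exists>M. \<forall>x. u x \<le> M / \<rho> ^ sum x UNIV" "\<And>x. u x \<ge> 0"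
  shows "mbounded u bidx"
  unfolding mbounded_def
proof (intro conjI allI impI)
  fix R :: real assume R: "R \<ge> 1"
  obtain M where M: "\<And>x. u x \<le> M / (2 * R) ^ sum x UNIV" using assms(1)[of "2 * R"] R by auto
  have "(\<lambda>x::'n + 'n \<Rightarrow> nat. M * (1/2) ^ sum x UNIV) summable_on UNIV"
    by (intro summable_on_cmult_right multi_geometric_summable) auto
  then show "(\<lambda>x. u x * R ^ msum (fst (bidx x))) summable_on UNIV"
  proof (rule summable_on_comparison_test)
    fix x :: "'n bix"
    have "u x * R ^ msum (fst (bidx x)) \<le> u x * R ^ sum x UNIV"
      using R assms(2) by (intro mult_left_mono power_increasing) (auto simp: msum_bidx sum_eq_wA_wB)
    also have "\<dots> \<le> M / (2 * R) ^ sum x UNIV * R ^ sum x UNIV" using M[of x] R by (intro mult_right_mono) auto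
    also have "\<dots> = M * (1/2) ^ sum x UNIV" using R by (simp add: power_mult_distrib power_divide)
    finally show "u x * R ^ msum (fst (bidx x)) \<le> M * (1/2) ^ sum x UNIV" .
  qed (use R assms(2) in auto)
qed (use assms(2) in \<open>auto simp: msum_bidx\<close>)

lemma bcoeff_decay:
  assumes "holo_hatD h" "\<rho> > 0"
  shows "\<exists>M\<ge>0. \<forall>x. norm (bcoeff h x) \<le> M / \<rho> ^ sum x UNIV"
proof -
  have "continuous_on (gauge_compact \<rho>) h"
    using assms holo_hatZ_continuous continuous_on_subset gauge_compact(2) unfolding holo_hatD_def by blast
  then have "compact (h ` gauge_compact \<rho>)" by (intro compact_continuous_image gauge_compact(1))
  then obtain M where M: "\<And>w. w \<in> gauge_compact \<rho> \<Longrightarrow> norm (h w) \<le> M"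
    using compact_imp_bounded bounded_iff by (metis imageI)
  have "norm (h (gauge_pt True (\<lambda>_. 0))) \<le> M" using assms by (intro M) (auto simp: gauge_compact_def intro!: exI[of _ True])
  then have "M \<ge> 0" using norm_ge_zero order_trans by metis
  then show ?thesis using norm_bcoeff_le[OF assms M] by blast
qed

lemma mbounded_bcoeff:
  assumes "holo_hatD h"
  shows "mbounded (\<lambda>x. norm (bcoeff h x)) bidx"
proof (rule mbounded_bidx)
  fix \<rho> :: real assume "\<rho> \<ge> 1"
  then show "\<exists>M. \<forall>x. norm (bcoeff h x) \<le> M / \<rho> ^ sum x UNIV"
    using bcoeff_decay[OF assms, of \<rho>] by auto
qed simp

lemma mseries_tail:
  assumes "mbounded B X" "\<And>j. norm (\<gamma> j) \<le> B j" "R \<ge> 1" "e > 0"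
  shows "\<forall>\<^sub>F F in finite_subsets_at_top UNIV. \<forall>w. norm w \<le> R \<longrightarrow>
      norm (mseries \<gamma> X w - (\<Sum>j\<in>F. \<gamma> j * hmono (X j) w)) < e"
proof -
  let ?b = "\<lambda>j. B j * (R\<^sup>2) ^ msum (fst (X j))"
  have sm: "?b summable_on UNIV" by (rule mbounded_summable_sq[OF assms(1,3)])
  have "(sum ?b \<longlongrightarrow> infsum ?b UNIV) (finite_subsets_at_top UNIV)" by (rule infsum_tendsto[OF sm])
  then have "\<forall>\<^sub>F F in finite_subsets_at_top UNIV. dist (sum ?b F) (infsum ?b UNIV) < e" using assms(4) tendstoD by blast
  moreover have "\<forall>\<^sub>F F in finite_subsets_at_top UNIV. finite F" by (auto simp: eventually_finite_subsets_at_top)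
  ultimately show ?thesis
  proof eventually_elim
    case (elim F)
    have smF: "?b summable_on (UNIV - F)" using sm by (rule summable_on_subset_banach) auto
    have eqb: "infsum ?b (UNIV - F) = infsum ?b UNIV - sum ?b F"
      using infsum_Diff[OF sm, of F] elim(2) by simp
    show ?case
    proof (intro allI impI)
      fix w :: "'b cvec \<times> 'b cvec" assume w: "norm w \<le> R"
      have s: "(\<lambda>j. \<gamma> j * hmono (X j) w) summable_on UNIV" by (rule mseries_summable[OF assms(1,2)])
      have sF: "(\<lambda>j. \<gamma> j * hmono (X j) w) summable_on (UNIV - F)" using s by (rule summable_on_subset_banach) auto
      have "mseries \<gamma> X w - (\<Sum>j\<in>F. \<gamma> j * hmono (X j) w) = infsum (\<lambda>j. \<gamma> j * hmono (X j) w) (UNIV - F)"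
        unfolding mseries_def using infsum_Diff[OF s, of F] elim(2) by simp
      also have "norm \<dots> \<le> infsum ?b (UNIV - F)"
        by (rule norm_infsum_le[OF has_sum_infsum[OF sF] has_sum_infsum[OF smF]])
           (rule mseries_term_le[OF assms(1,2,3) w])
      also have "\<dots> < e" unfolding eqb using elim(1) by (auto simp: dist_real_def)
      finally show "norm (mseries \<gamma> X w - (\<Sum>j\<in>F. \<gamma> j * hmono (X j) w)) < e" .
    qed
  qed
qed

text \<open>Finite partial sums have the right coordinates by duality, and coordinates are
  continuous for uniform convergence on \<open>gauge_compact 1\<close>.\<close>

lemma bcoeff_mseries_bidx:
  fixes u :: "('n::finite) bix \<Rightarrow> complex"
  assumes u: "mbounded B bidx" "\<And>j. norm (u j) \<le> B j"
  shows "bcoeff (mseries u bidx) x = u x"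
proof (rule ccontr)
  assume "bcoeff (mseries u bidx) x \<noteq> u x"
  then have e: "norm (bcoeff (mseries u bidx) x - u x) > 0" (is "?e > 0") by simp
  obtain R where R: "R \<ge> 1" "\<And>w :: 'n hvec. w \<in> gauge_compact 1 \<Longrightarrow> norm w \<le> R"
    using compact_norm_bound[OF gauge_compact(1)] by blast
  have "\<forall>\<^sub>F F in finite_subsets_at_top UNIV. finite F \<and> x \<in> F"
    by (auto simp: eventually_finite_subsets_at_top intro: exI[of _ "{x}"])
  from eventually_happens'[OF _ eventually_conj[OF this mseries_tail[OF u R(1) e]]]
  obtain F where F: "finite F" "x \<in> F" 
    "\<And>w. norm w \<le> R \<Longrightarrow> norm (mseries u bidx w - (\<Sum>j\<in>F. u j * hmono (bidx j) w)) < ?e"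
    by (auto simp: finite_subsets_at_top_neq_bot)
  have adm: "holo_hatD (hmono (bidx j))" for j :: "'n bix" by (rule hmono_holo_hatD) (simp add: msum_bidx)
  let ?S = "\<lambda>w. \<Sum>j\<in>F. u j * hmono (bidx j) w"
  have holS: "holo_hatD ?S" by (rule holo_hatD_sum_hmono[OF F(1)]) (simp add: msum_bidx)
  have holm: "holo_hatD (mseries u bidx)" by (rule mseries_holo_hatD[OF u])
  have bS: "bcoeff ?S x = u x"
    using F(1,2) by (subst bcoeff_sum[OF adm]) (simp add: bcoeff_hmono_bidx if_distrib sum.delta cong: if_cong)
  \<comment> \<open>The maximum over the compact set is attained, so the strict pointwise bound by
    \<open>?e\<close> stays strict for the coordinate.\<close>
  have "compact ((\<lambda>w. norm (mseries u bidx w - ?S w)) ` gauge_compact 1)"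
    using holo_hatD_diff[OF holm holS] gauge_compact
    by (intro compact_continuous_image continuous_on_norm gauge_compact(1))
       (auto simp: holo_hatD_def intro: continuous_on_subset[OF holo_hatZ_continuous])
  moreover have "gauge_pt True (\<lambda>_. 0) \<in> (gauge_compact 1 :: 'n hvec set)" by (auto simp: gauge_compact_def intro!: exI[of _ True])
  ultimately obtain w0 where w0: "w0 \<in> gauge_compact 1" "\<And>w. w \<in> gauge_compact 1 \<Longrightarrow> norm (mseries u bidx w - ?S w) \<le> norm (mseries u bidx w0 - ?S w0)"
    using compact_attains_sup[of "(\<lambda>w. norm (mseries u bidx w - ?S w)) ` gauge_compact 1"] by blast
  have "norm (bcoeff (\<lambda>w. mseries u bidx w - ?S w) x) \<le> norm (mseries u bidx w0 - ?S w0) / 1 ^ sum x UNIV"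
    by (rule norm_bcoeff_le[OF holo_hatD_diff[OF holm holS]]) (use w0 in auto)
  also have "\<dots> < ?e" using F(3)[of w0] R(2)[OF w0(1)] by simp
  finally show False unfolding bcoeff_diff[OF holm holS] bS by simp
qed

section \<open>Functions with vanishing coordinates, and the monomial expansion\<close>

text \<open>This is not the action divided out in \<open>hatD\<close>: it moves p' and q' inside a
  fixed gauge. The monomial with exponent \<open>x\<close> is an eigenvector with eigenvalue
  \<zeta>^(wA x - wB x).\<close>

definition torus_act :: "complex \<Rightarrow> ('n + 'n \<Rightarrow> complex) \<Rightarrow> 'n + 'n \<Rightarrow> complex" where
  "torus_act \<zeta> z = case_sum (\<lambda>i. \<zeta> * z (Inl i)) (\<lambda>i. z (Inr i) / \<zeta>)"

lemma dotp_torus_act: "\<zeta> \<noteq> 0 \<Longrightarrow> dotp (torus_act \<zeta> z) = dotp z"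
  by (simp add: dotp_def torus_act_def)

lemma monomial_torus_act:
  fixes z :: "'n::finite + 'n \<Rightarrow> complex"
  shows "(\<Prod>j\<in>UNIV. torus_act \<zeta> z j ^ x j) = \<zeta> ^ wA x / \<zeta> ^ wB x * (\<Prod>j\<in>UNIV. z j ^ x j)"
  by (simp add: prod_UNIV_Plus torus_act_def power_mult_distrib prod.distrib power_divide prod_dividef
      power_sum wA_def wB_def)

text \<open>A bound for the eigenvalues of the monomials that occur bounds \<open>F\<close> along
  the orbit by the series of absolute values, which does not depend on \<zeta>.\<close>

lemma norm_monomial_series_le:
  fixes z :: "'n::finite + 'n \<Rightarrow> complex"
  assumes F: "sep_entire F" and "\<And>x. taylor_coeff x F \<noteq> 0 \<Longrightarrow> norm (\<zeta> ^ wA x / \<zeta> ^ wB x) \<le> k" and r: "\<And>j. norm (z j) \<le> r" and k: "k \<ge> 0"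
  shows "norm (F (torus_act \<zeta> z)) \<le> k * (\<Sum>\<^sub>\<infinity>x. norm (taylor_coeff x F) * r ^ sum x UNIV)"
proof -
  have s: "(\<lambda>x. k * (norm (taylor_coeff x F) * r ^ sum x UNIV)) summable_on UNIV"
    by (intro summable_on_cmult_right taylor_coeff_abs_summable F)
  have r0: "r \<ge> 0" by (rule order_trans[OF norm_ge_zero r])
  have "norm (F (torus_act \<zeta> z)) \<le> (\<Sum>\<^sub>\<infinity>x. k * (norm (taylor_coeff x F) * r ^ sum x UNIV))"
  proof (rule norm_infsum_le[OF taylor_coeff_has_sum[OF F] has_sum_infsum[OF s]])
    fix x :: "'n bix"
    have m: "norm (\<Prod>j\<in>UNIV. z j ^ x j) \<le> r ^ sum x UNIV"
      unfolding prod_norm[symmetric] norm_power power_sum using r by (intro prod_mono conjI power_mono) auto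
    show "norm (taylor_coeff x F * (\<Prod>i\<in>UNIV. torus_act \<zeta> z i ^ x i)) \<le> k * (norm (taylor_coeff x F) * r ^ sum x UNIV)"
    proof (cases "taylor_coeff x F = 0")
      case False
      have "norm (\<zeta> ^ wA x / \<zeta> ^ wB x) * norm (\<Prod>j\<in>UNIV. z j ^ x j) \<le> k * r ^ sum x UNIV"
        using assms(2)[OF False] m k by (intro mult_mono) auto
      from mult_left_mono[OF this norm_ge_zero[of "taylor_coeff x F"]]
      show ?thesis unfolding monomial_torus_act norm_mult by (simp add: mult_ac)
    qed simp
  qed
  then show ?thesis by (simp add: infsum_cmult_right')
qed

text \<open>Along \<open>\<zeta> \<mapsto> (\<zeta> p', q'/\<zeta>)\<close> only negative powers of \<open>\<zeta>\<close> survive in the first gauge and only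
  nonnegative ones in the second, and the gauges differ by rescaling \<open>\<zeta>\<close>.  So the function extends
  over \<open>0\<close> and tends to \<open>0\<close> at infinity.\<close>

lemma bcoeff_zero_imp_zero:
  fixes g :: "('n::finite) hvec \<Rightarrow> complex"
  assumes g: "holo_hatD g" and b: "\<And>x. bcoeff g x = 0" and w: "w \<in> hatZ"
  shows "g w = 0"
proof (rule hatZ_dense_vanish[OF holo_hatZ_continuous _ w])
  show gZ: "holo_hatZ g" using g by (simp add: holo_hatD_def)
  fix p q :: "'n cvec" assume pq: "(p, q) \<in> hatZ" and p0: "p $ None \<noteq> 0" and q0: "q $ None \<noteq> 0"
  \<comment> \<open>These are the coordinates of \<open>(p, q)\<close> in the gauge q_0 = 1, reached
    by scaling with \<open>q $ None\<close>; the number \<open>c\<close> is p_0 q_0.\<close>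
  define z where "z = case_sum (\<lambda>i. q $ None * p $ Some i) (\<lambda>i. q $ Some i / q $ None)"
  define c where "c = 1 + dotp z"
  have "dotp z = (\<Sum>i\<in>UNIV. p $ Some i * q $ Some i)" using q0 by (simp add: dotp_def z_def)
  then have c: "c = p $ None * q $ None" using pq by (simp add: c_def hatZ_iff algebra_simps)
  then have c0: "c \<noteq> 0" using p0 q0 by simp
  have "(q $ None *s p, (1 / q $ None) *s q) = gauge_pt True z"
    unfolding gauge_pt_def c_def[symmetric] c using q0
    by (auto simp: vec_eq_iff cons0_def z_def split: option.split)
  then have gz: "g (p, q) = g (gauge_pt True z)" using g pq q0 unfolding holo_hatD_def by metis
  define \<phi> where "\<phi> \<zeta> = g (gauge_pt True (torus_act \<zeta> z))" for \<zeta>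
  define r where "r = Max (range (\<lambda>j. norm (z j)))"
  have r: "norm (z j) \<le> r" for j unfolding r_def by (intro Max_ge) auto
  have hol: "\<phi> holomorphic_on UNIV - {0}"
    unfolding \<phi>_def
  proof (rule holo_hatZ_curve[OF gZ])
    have t: "(\<lambda>\<zeta>. torus_act \<zeta> z j) holomorphic_on UNIV - {0}" for j
      by (cases j) (auto simp: torus_act_def intro!: holomorphic_intros)
    then show "(\<lambda>\<zeta>. fst (gauge_pt True (torus_act \<zeta> z)) $ i) holomorphic_on UNIV - {0}"
        "(\<lambda>\<zeta>. snd (gauge_pt True (torus_act \<zeta> z)) $ i) holomorphic_on UNIV - {0}" for i
      by (cases i; auto simp: gauge_pt_def dotp_def intro!: holomorphic_intros)+
  qed (auto simp: gauge_pt_in_hatZ)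
  have se: "sep_entire (\<lambda>z. g (gauge_pt s z))" for s by (rule sep_entire_gauge[OF gZ])
  have z1: "wA x < wB x" if "taylor_coeff x (\<lambda>z. g (gauge_pt True z)) \<noteq> 0" for x
    using b[of x] that unfolding bcoeff_def by (cases "wB x \<le> wA x") auto
  have z2: "wB x \<le> wA x" if "taylor_coeff x (\<lambda>z. g (gauge_pt False z)) \<noteq> 0" for x
    using b[of x] that unfolding bcoeff_def by (cases "wB x \<le> wA x") auto
  define M1 where "M1 = (\<Sum>\<^sub>\<infinity>x. norm (taylor_coeff x (\<lambda>z. g (gauge_pt True z))) * r ^ sum x UNIV)"
  define M2 where "M2 = (\<Sum>\<^sub>\<infinity>x. norm (taylor_coeff x (\<lambda>z. g (gauge_pt False z))) * r ^ sum x UNIV)"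
  have inf: "norm (\<phi> \<zeta>) \<le> (1 / norm \<zeta>) * M1" if "norm \<zeta> \<ge> 1" for \<zeta>
    unfolding \<phi>_def M1_def
  proof (rule norm_monomial_series_le[OF se _ r])
    fix x assume "taylor_coeff x (\<lambda>z. g (gauge_pt True z)) \<noteq> 0"
    from z1[OF this] have "norm \<zeta> ^ Suc (wA x) \<le> norm \<zeta> ^ wB x" using that by (intro power_increasing) auto
    then show "norm (\<zeta> ^ wA x / \<zeta> ^ wB x) \<le> 1 / norm \<zeta>"
      using that order_less_le_trans[OF zero_less_one that]
      by (simp add: norm_divide norm_power divide_le_eq le_divide_eq mult.commute)
  qed auto
  \<comment> \<open>The scaling by \<open>c\<close> that leads from one gauge to the other turns the
    parameter \<open>c * \<zeta>\<close> into \<zeta>. In the second gauge only weights wA - wB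
    \<ge> 0 occur, so the function stays bounded near 0.\<close>
  have near0: "norm (\<phi> (c * \<zeta>)) \<le> M2" if \<zeta>: "norm \<zeta> \<le> 1" "\<zeta> \<noteq> 0" for \<zeta>
  proof -
    have "gauge_pt True (torus_act (c * \<zeta>) z) =
        (c *s fst (gauge_pt False (torus_act \<zeta> z)), (1 / c) *s snd (gauge_pt False (torus_act \<zeta> z)))"
      using \<zeta> c0 by (simp add: gauge_pt_def smult_cons0 dotp_torus_act c_def[symmetric]) (simp add: torus_act_def mult_ac)
    moreover have "(fst (gauge_pt False (torus_act \<zeta> z)), snd (gauge_pt False (torus_act \<zeta> z))) \<in> hatZ"
      using gauge_pt_in_hatZ by simp
    ultimately have "\<phi> (c * \<zeta>) = g (gauge_pt False (torus_act \<zeta> z))"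
      unfolding \<phi>_def using g c0 unfolding holo_hatD_def by (metis prod.collapse)
    also have "norm \<dots> \<le> 1 * M2"
      unfolding M2_def
    proof (rule norm_monomial_series_le[OF se _ r])
      fix x assume "taylor_coeff x (\<lambda>z. g (gauge_pt False z)) \<noteq> 0"
      from z2[OF this] have "norm \<zeta> ^ wA x \<le> norm \<zeta> ^ wB x" using \<zeta> by (intro power_decreasing) auto
      then show "norm (\<zeta> ^ wA x / \<zeta> ^ wB x) \<le> 1"
        using \<zeta> by (simp add: norm_divide norm_power)
    qed auto
    finally show ?thesis by simp
  qed
  have "eventually (\<lambda>\<zeta>. norm (\<phi> \<zeta>) \<le> M2) (at 0)"
  proof -
    have "eventually (\<lambda>\<zeta>. \<zeta> \<in> ball 0 (norm c) - {0}) (at 0)"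
      using c0 by (intro eventually_at_in_open) auto
    then show ?thesis
    proof eventually_elim
      case (elim \<zeta>)
      then show ?case using near0[of "\<zeta> / c"] c0 by (auto simp: norm_divide)
    qed
  qed
  then obtain \<psi> where \<psi>: "\<psi> holomorphic_on UNIV" "\<And>\<zeta>. \<zeta> \<noteq> 0 \<Longrightarrow> \<psi> \<zeta> = \<phi> \<zeta>"
    using holomorphic_on_extend_bounded[OF hol] by auto
  have "(\<psi> \<longlongrightarrow> 0) at_infinity"
  proof (rule Lim_null_comparison)
    show "eventually (\<lambda>\<zeta>. norm (\<psi> \<zeta>) \<le> norm (of_real M1 / \<zeta>)) at_infinity"
      unfolding eventually_at_infinity
    proof (intro exI[of _ 1] allI impI)
      fix \<zeta> :: complex assume z: "1 \<le> norm \<zeta>"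
      then have "norm (\<psi> \<zeta>) \<le> (1 / norm \<zeta>) * M1" using inf[OF z] \<psi>(2)[of \<zeta>] by (cases "\<zeta> = 0") auto
      also have "\<dots> \<le> (1 / norm \<zeta>) * \<bar>M1\<bar>" by (intro mult_left_mono) auto
      finally show "norm (\<psi> \<zeta>) \<le> norm (of_real M1 / \<zeta>)" by (simp add: norm_divide)
    qed
    show "((\<lambda>\<zeta>. norm (complex_of_real M1 / \<zeta>)) \<longlongrightarrow> 0) at_infinity"
      by (intro tendsto_norm_zero tendsto_divide_0[OF tendsto_const]) (rule filterlim_ident)
  qed
  then have "\<psi> 1 = 0" using Liouville_weak_0[OF \<psi>(1)] by blast
  then have "\<phi> 1 = 0" using \<psi>(2)[of 1] by simp
  moreover have "torus_act 1 z = z" by (auto simp: torus_act_def fun_eq_iff split: sum.split)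
  ultimately show "g (p, q) = 0" unfolding gz \<phi>_def by simp
qed

text \<open>Both sides have the same coordinates by duality, and coordinates separate functions on
  \<open>hatZ\<close>.\<close>

lemma holo_hatD_expansion:
  assumes h: "holo_hatD h" and w: "w \<in> hatZ"
  shows "h w = mseries (bcoeff h) bidx w"
proof -
  have S: "holo_hatD (mseries (bcoeff h) bidx)" by (rule mseries_holo_hatD[OF mbounded_bcoeff[OF h] order_refl])
  have "h w - mseries (bcoeff h) bidx w = 0"
    by (rule bcoeff_zero_imp_zero[OF holo_hatD_diff[OF h S] _ w])
       (simp add: bcoeff_diff[OF h S] bcoeff_mseries_bidx[OF mbounded_bcoeff[OF h] order_refl])
  then show ?thesis by simp
qed

section \<open>The star product of monomials\<close>

definition kap :: "complex \<Rightarrow> ('n::finite) midx \<Rightarrow> 'n midx \<Rightarrow> 'n midx \<Rightarrow> complex" where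
  "kap hb P S T = (-1) ^ (T None) * pochhammer (1 / (2 * hb)) (msum (\<lambda>i. P i + S i - T i)) * of_nat (mfact T)
        / (pochhammer (1 / (2 * hb)) (msum P) * pochhammer (1 / (2 * hb)) (msum S))
        * of_nat (mbinom P T * mbinom S T)"

definition sidx :: "('n::finite) hidx \<Rightarrow> 'n hidx \<Rightarrow> 'n midx \<Rightarrow> 'n hidx" where
  "sidx x y T = (\<lambda>i. fst x i + fst y i - T i, \<lambda>i. snd x i + snd y i - T i)"

definition shat :: "complex \<Rightarrow> ('n::finite) hidx \<Rightarrow> 'n hidx \<Rightarrow> 'n hvec \<Rightarrow> complex" where
  "shat hb x y w = (\<Sum>T\<in>{T. \<forall>i. T i \<le> fst x i \<and> T i \<le> snd y i}. kap hb (fst x) (snd y) T * hmono (sidx x y T) w)"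

definition inc :: "('n::finite) hidx \<Rightarrow> 'n option \<Rightarrow> 'n hidx" where
  "inc x \<mu> = ((fst x)(\<mu> := Suc (fst x \<mu>)), (snd x)(\<mu> := Suc (snd x \<mu>)))"

text \<open>Signs of the form defining \<open>hatZ\<close>, arranged so that the sum of sgn0 \<mu> *
  p_\<mu> * q_\<mu> equals 1 there.\<close>

definition sgn0 :: "'n option \<Rightarrow> complex" where
  "sgn0 \<mu> = (case \<mu> of None \<Rightarrow> 1 | Some _ \<Rightarrow> -1)"

lemma star_mono_eq_shat: "star_mono hb x y r = shat hb x y (r, cnjv r)"
  by (cases x; cases y) (simp add: star_mono_def shat_def kap_def sidx_def hmono_def mono_def)

lemma finite_midx_box: "finite {T :: 'n::finite midx. \<forall>i. T i \<le> S i}"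
proof -
  have "{T :: 'n midx. \<forall>i. T i \<le> S i} = PiE UNIV (\<lambda>i. {..S i})" by (auto simp: PiE_def)
  then show ?thesis by (simp add: finite_PiE)
qed

lemma mbinom_eq_0: "\<not> T i \<le> P i \<Longrightarrow> mbinom P T = 0"
  unfolding mbinom_def by (subst prod_zero_iff) (auto simp: not_le)

text \<open>The additional terms vanish through \<open>mbinom (fst x) T\<close>. The range now
  depends on \<open>y\<close> alone and stays the same when \<open>x\<close> is replaced by
  \<open>inc x \<mu>\<close>.\<close>

lemma shat_eq_box: "shat hb x y w = (\<Sum>T\<in>{T. \<forall>i. T i \<le> snd y i}. kap hb (fst x) (snd y) T * hmono (sidx x y T) w)"
  unfolding shat_def
proof (rule sum.mono_neutral_left)
  show "\<forall>T\<in>{T. \<forall>i. T i \<le> snd y i} - {T. \<forall>i. T i \<le> fst x i \<and> T i \<le> snd y i}.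
       kap hb (fst x) (snd y) T * hmono (sidx x y T) w = 0"
  proof
    fix T assume "T \<in> {T. \<forall>i. T i \<le> snd y i} - {T. \<forall>i. T i \<le> fst x i \<and> T i \<le> snd y i}"
    then obtain i where "\<not> T i \<le> fst x i" by auto
    from mbinom_eq_0[of T i "fst x", OF this] show "kap hb (fst x) (snd y) T * hmono (sidx x y T) w = 0" by (simp add: kap_def)
  qed
qed (auto simp: finite_midx_box)

lemma msum_upd_Suc: "msum (P(\<mu> := Suc (P \<mu>))) = Suc (msum P)"
proof -
  have "msum (P(\<mu> := Suc (P \<mu>))) = (\<Sum>i\<in>UNIV. P i + (if i = \<mu> then 1 else 0))"
    unfolding msum_def by (intro sum.cong) auto
  then show ?thesis by (simp add: sum.distrib msum_def)
qed

lemma prod_split_one: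
  fixes f :: "'a::finite \<Rightarrow> 'b::comm_monoid_mult"
  shows "(\<Prod>i\<in>UNIV. f i) = f \<mu> * (\<Prod>i\<in>UNIV - {\<mu>}. f i)"
  by (rule prod.remove) auto

lemma mfact_upd_Suc: "mfact (T(\<mu> := Suc (T \<mu>))) = Suc (T \<mu>) * mfact T"
  unfolding mfact_def prod_split_one[of _ \<mu>] by (simp add: algebra_simps)

lemma mbinom_upd_Suc:
  "mbinom (P(\<mu> := Suc (P \<mu>))) T = mbinom P T + (if T \<mu> = 0 then 0 else mbinom P (T(\<mu> := T \<mu> - 1)))"
proof (cases "T \<mu>")
  case 0
  have "(\<Prod>i\<in>UNIV - {\<mu>}. (P(\<mu> := Suc (P \<mu>))) i choose T i) = (\<Prod>i\<in>UNIV - {\<mu>}. P i choose T i)"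
    by (intro prod.cong) auto
  then show ?thesis unfolding mbinom_def prod_split_one[of _ \<mu>] using 0 by simp
next
  case (Suc k)
  have "(\<Prod>i\<in>UNIV - {\<mu>}. (P(\<mu> := Suc (P \<mu>))) i choose T i) = (\<Prod>i\<in>UNIV - {\<mu>}. P i choose T i)"
     "(\<Prod>i\<in>UNIV - {\<mu>}. P i choose (T(\<mu> := T \<mu> - 1)) i) = (\<Prod>i\<in>UNIV - {\<mu>}. P i choose T i)"
    by (intro prod.cong; auto)+
  then show ?thesis unfolding mbinom_def prod_split_one[of _ \<mu>] using Suc by (simp add: algebra_simps)
qed

lemma mbinom_lower_upd_Suc:
  "Suc (T \<mu>) * mbinom S (T(\<mu> := Suc (T \<mu>))) = (S \<mu> - T \<mu>) * mbinom S T"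
proof -
  have "(\<Prod>i\<in>UNIV - {\<mu>}. S i choose (T(\<mu> := Suc (T \<mu>))) i) = (\<Prod>i\<in>UNIV - {\<mu>}. S i choose T i)"
    by (intro prod.cong) auto
  moreover have "Suc (T \<mu>) * (S \<mu> choose Suc (T \<mu>)) = (S \<mu> - T \<mu>) * (S \<mu> choose T \<mu>)"
    using binomial_absorb_comp[of "S \<mu>" "T \<mu>"] binomial_absorption[of "T \<mu>" "S \<mu>"] by simp
  ultimately show ?thesis unfolding mbinom_def prod_split_one[of _ \<mu>]
    by (metis (no_types, lifting) fun_upd_same mult.assoc)
qed

lemma hmono_inc: "hmono (inc v \<mu>) w = fst w $ \<mu> * snd w $ \<mu> * hmono v w"
proof -
  have "(\<Prod>i\<in>UNIV - {\<mu>}. (fst w $ i) ^ fst (inc v \<mu>) i * (snd w $ i) ^ snd (inc v \<mu>) i) =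
     (\<Prod>i\<in>UNIV - {\<mu>}. (fst w $ i) ^ fst v i * (snd w $ i) ^ snd v i)"
    by (intro prod.cong) (auto simp: inc_def)
  then show ?thesis unfolding hmono_def prod_split_one[of _ \<mu>] by (simp add: inc_def mult_ac)
qed

lemma hmono_relation:
  assumes "w \<in> hatZ"
  shows "(\<Sum>\<mu>\<in>UNIV. sgn0 \<mu> * hmono (inc v \<mu>) w) = hmono v w"
proof -
  have "(\<Sum>\<mu>\<in>UNIV. sgn0 \<mu> * hmono (inc v \<mu>) w) = (\<Sum>\<mu>\<in>UNIV. sgn0 \<mu> * (fst w $ \<mu> * snd w $ \<mu>)) * hmono v w"
    unfolding hmono_inc sum_distrib_right by (simp add: mult_ac)
  also have "(\<Sum>\<mu>\<in>UNIV. sgn0 \<mu> * (fst w $ \<mu> * snd w $ \<mu>)) = 1"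
    using assms hatZ_iff[of "fst w" "snd w"] by (simp add: sum_UNIV_option sgn0_def sum_negf)
  finally show ?thesis by simp
qed

text \<open>The proof combines Pascal's rule for P + e_\<mu> over T, a shift of \<open>T\<close> in
  half of the resulting terms, and the identity (\<zeta> + N) - (s - |T|) = \<zeta> + p for N = p +
  s - |T|.\<close>

lemma shat_relation:
  fixes x y :: "('n::finite) hidx"
  assumes w: "w \<in> hatZ" and z: "\<And>k. 1 / (2 * hb) + of_nat k \<noteq> (0::complex)"
  shows "(\<Sum>\<mu>\<in>UNIV. sgn0 \<mu> * shat hb (inc x \<mu>) y w) = shat hb x y w"
proof -
  define \<zeta> where "\<zeta> = 1 / (2 * hb)"
  obtain P Q R S where x: "x = (P, Q)" and y: "y = (R, S)" by (cases x; cases y)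
  define p where "p = msum P" define s where "s = msum S"
  let ?q = "pochhammer \<zeta>"
  let ?B = "{T :: 'n midx. \<forall>i. T i \<le> S i}"
  \<comment> \<open>The part of the coefficient common to all \<mu>; \<open>Suc p\<close> is the
    degree of P + e_\<mu>.\<close>
  define A where "A T = (-1) ^ (T None) * of_nat (mfact T) * of_nat (mbinom S T) / (?q (Suc p) * ?q s)" for T :: "'n midx"
  define m where "m T = hmono (sidx x y T) w" for T
  have ms: "msum (\<lambda>i. P i + S i - T i) = msum P + (msum S - msum T)" "msum T \<le> msum S" if "T \<in> ?B" for P T
  proof -
    show le: "msum T \<le> msum S" unfolding msum_def using that by (intro sum_mono) auto
    have "(\<Sum>i\<in>UNIV. (P i + S i - T i)) + msum T = msum P + msum S"
      unfolding msum_def sum.distrib[symmetric] using that by (intro sum.cong) (auto simp: trans_le_add2)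
    then show "msum (\<lambda>i. P i + S i - T i) = msum P + (msum S - msum T)" using le by (simp add: msum_def)
  qed
  have pw: "?q (Suc p) = ?q p * (\<zeta> + of_nat p)" by (simp add: pochhammer_Suc)
  have zp: "\<zeta> + of_nat p \<noteq> 0" using z by (simp add: \<zeta>_def)
  define F where "F \<mu> T = A T * ?q (Suc p + (s - msum T)) * of_nat (mbinom P T) * hmono (sidx (inc x \<mu>) y T) w" for \<mu> T
  define G where "G \<mu> T = A T * ?q (Suc p + (s - msum T)) * of_nat (if T \<mu> = 0 then 0 else mbinom P (T(\<mu> := T \<mu> - 1)))
       * hmono (sidx (inc x \<mu>) y T) w" for \<mu> T
  \<comment> \<open>Pascal's rule in the coordinate \<mu>: \<open>F\<close> keeps \<open>T\<close>
    in the binomial of \<open>P\<close>, \<open>G\<close> lowers it.\<close>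
  have e1: "shat hb (inc x \<mu>) y w = (\<Sum>T\<in>?B. F \<mu> T) + (\<Sum>T\<in>?B. G \<mu> T)" for \<mu>
  proof -
    have "kap hb (fst (inc x \<mu>)) S T * hmono (sidx (inc x \<mu>) y T) w = F \<mu> T + G \<mu> T" if "T \<in> ?B" for T
    proof -
      have fi: "fst (inc x \<mu>) = P(\<mu> := Suc (P \<mu>))" by (simp add: x inc_def)
      have mp: "msum (fst (inc x \<mu>)) = Suc p" unfolding fi msum_upd_Suc p_def ..
      have N: "msum (\<lambda>i. fst (inc x \<mu>) i + S i - T i) = Suc p + (s - msum T)"
        unfolding ms(1)[OF that] mp s_def ..
      have mb: "mbinom (fst (inc x \<mu>)) T = mbinom P T + (if T \<mu> = 0 then 0 else mbinom P (T(\<mu> := T \<mu> - 1)))"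
        unfolding fi by (rule mbinom_upd_Suc)
      show ?thesis
        unfolding kap_def F_def G_def A_def \<zeta>_def[symmetric] mb N mp s_def[symmetric] of_nat_mult of_nat_add
        by (simp only: distrib_left distrib_right mult_ac times_divide_eq_left times_divide_eq_right add_divide_distrib)
    qed
    then show ?thesis unfolding shat_eq_box by (simp add: y sum.distrib[symmetric])
  qed
  \<comment> \<open>For \<open>T\<close> below \<open>P\<close> the exponents in \<open>F\<close>
    are those of \<open>x\<close>, raised by \<open>inc\<close>, so the relation on
    \<open>hatZ\<close> collapses the sum over \<mu>; all other \<open>T\<close> contribute
    0.\<close>
  have e2: "(\<Sum>\<mu>\<in>UNIV. sgn0 \<mu> * (\<Sum>T\<in>?B. F \<mu> T)) = (\<Sum>T\<in>?B. A T * ?q (Suc p + (s - msum T)) * of_nat (mbinom P T) * m T)"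
  proof -
    have "(\<Sum>\<mu>\<in>UNIV. sgn0 \<mu> * (\<Sum>T\<in>?B. F \<mu> T)) = (\<Sum>T\<in>?B. \<Sum>\<mu>\<in>UNIV. sgn0 \<mu> * F \<mu> T)"
      unfolding sum_distrib_left by (rule sum.swap)
    also have "\<dots> = (\<Sum>T\<in>?B. A T * ?q (Suc p + (s - msum T)) * of_nat (mbinom P T) * m T)"
    proof (rule sum.cong[OF refl])
      fix T assume T: "T \<in> ?B"
      show "(\<Sum>\<mu>\<in>UNIV. sgn0 \<mu> * F \<mu> T) = A T * ?q (Suc p + (s - msum T)) * of_nat (mbinom P T) * m T"
      proof (cases "\<forall>i. T i \<le> P i")
        case True
        then have si: "sidx (inc x \<mu>) y T = inc (sidx x y T) \<mu>" for \<mu>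
          using T by (auto simp: sidx_def inc_def x y fun_eq_iff Suc_diff_le trans_le_add1 trans_le_add2)
        have "(\<Sum>\<mu>\<in>UNIV. sgn0 \<mu> * F \<mu> T) = A T * ?q (Suc p + (s - msum T)) * of_nat (mbinom P T) *
            (\<Sum>\<mu>\<in>UNIV. sgn0 \<mu> * hmono (inc (sidx x y T) \<mu>) w)"
          unfolding F_def si sum_distrib_left by (intro sum.cong) (auto simp: mult_ac)
        then show ?thesis unfolding hmono_relation[OF w] m_def .
      next
        case False
        then obtain i where "\<not> T i \<le> P i" by blast
        then have "mbinom P T = 0" by (rule mbinom_eq_0[of T i P])
        then show ?thesis by (simp add: F_def)
      qed
    qed
    finally show ?thesis .
  qed
  \<comment> \<open>Raising \<open>T\<close> by one at \<mu> turns the exponents in \<open>G\<close>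
    into those of \<open>x\<close>, and absorption in the binomial of \<open>S\<close> yields the
    factor \<open>S \<mu> - T \<mu>\<close>. The sign is -1 for every \<mu>: at \<open>None\<close>
    it comes from the power of -1, elsewhere from \<open>sgn0\<close>.\<close>
  have e3: "sgn0 \<mu> * (\<Sum>T\<in>?B. G \<mu> T) = - (\<Sum>T\<in>?B. A T * of_nat (S \<mu> - T \<mu>) * ?q (p + (s - msum T)) * of_nat (mbinom P T) * m T)" for \<mu>
  proof -
    let ?C = "{T \<in> ?B. T \<mu> < S \<mu>}"
    let ?up = "\<lambda>T :: 'n midx. T(\<mu> := Suc (T \<mu>))"
    have "(\<Sum>T\<in>?B. G \<mu> T) = (\<Sum>T\<in>?up ` ?C. G \<mu> T)"
    proof (rule sum.mono_neutral_right)
      show "finite ?B" by (rule finite_midx_box)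
      show "?up ` ?C \<subseteq> ?B" by auto
      show "\<forall>T\<in>?B - ?up ` ?C. G \<mu> T = 0"
      proof
        fix T assume T: "T \<in> ?B - ?up ` ?C"
        have "T \<mu> = 0"
        proof (rule ccontr)
          assume n0: "T \<mu> \<noteq> 0"
          have "T = ?up (T(\<mu> := T \<mu> - 1))" using n0 by auto
          moreover have "T(\<mu> := T \<mu> - 1) \<in> ?C"
          proof -
            have "T i \<le> S i" for i using T by auto
            then show ?thesis using n0 by (auto simp: diff_le_self intro: le_trans[OF diff_le_self]) (metis diff_less less_le_trans less_one neq0_conv Suc_le_eq Suc_pred')
          qed
          ultimately have "T \<in> ?up ` ?C" by (rule image_eqI)
          then show False using T by auto
        qed
        then show "G \<mu> T = 0" by (simp add: G_def)
      qed
    qed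
    also have "\<dots> = (\<Sum>T\<in>?C. G \<mu> (?up T))"
    proof (rule sum.reindex_cong[OF _ refl refl])
      show "inj_on ?up ?C"
      proof (rule inj_onI)
        fix T U :: "'n midx" assume e: "?up T = ?up U"
        have "T i = U i" for i using fun_cong[OF e, of i] by (cases "i = \<mu>") auto
        then show "T = U" by auto
      qed
    qed
    finally have eq: "(\<Sum>T\<in>?B. G \<mu> T) = (\<Sum>T\<in>?C. G \<mu> (?up T))" .
    have "sgn0 \<mu> * (\<Sum>T\<in>?B. G \<mu> T) = (\<Sum>T\<in>?C. - (A T * of_nat (S \<mu> - T \<mu>) * ?q (p + (s - msum T)) * of_nat (mbinom P T) * m T))"
      unfolding eq sum_distrib_left
    proof (rule sum.cong[OF refl])
      fix T assume T: "T \<in> ?C"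
      then have TB: "?up T \<in> ?B" by auto
      have "msum (?up T) \<le> s" unfolding s_def by (rule ms(2)[OF TB])
      then have sm: "Suc p + (s - msum (?up T)) = p + (s - msum T)" by (simp add: msum_upd_Suc)
      have si: "sidx (inc x \<mu>) y (?up T) = sidx x y T" by (auto simp: sidx_def inc_def fun_eq_iff)
      have sg: "sgn0 \<mu> * (-1) ^ (?up T None) = - ((-1) ^ T None :: complex)"
        by (cases \<mu>) (auto simp: sgn0_def)
      have "of_nat (mfact (?up T)) * of_nat (mbinom S (?up T)) = (of_nat (mfact T * (Suc (T \<mu>) * mbinom S (?up T))) :: complex)"
        unfolding mfact_upd_Suc of_nat_mult by (simp only: mult_ac)
      also have "\<dots> = of_nat (mfact T) * (of_nat (S \<mu> - T \<mu>) * of_nat (mbinom S T))"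
        unfolding mbinom_lower_upd_Suc by simp
      finally have mf: "of_nat (mfact (?up T)) * of_nat (mbinom S (?up T)) = (of_nat (mfact T) * (of_nat (S \<mu> - T \<mu>) * of_nat (mbinom S T)) :: complex)" .
      have "sgn0 \<mu> * A (?up T) = (sgn0 \<mu> * (-1) ^ (?up T None)) * (of_nat (mfact (?up T)) * of_nat (mbinom S (?up T))) / (?q (Suc p) * ?q s)"
        by (simp add: A_def mult_ac)
      also have "\<dots> = - (A T * of_nat (S \<mu> - T \<mu>))"
        unfolding sg mf by (simp add: A_def mult_ac)
      finally have "sgn0 \<mu> * A (?up T) = - (A T * of_nat (S \<mu> - T \<mu>))" .
      moreover have "sgn0 \<mu> * G \<mu> (?up T) = (sgn0 \<mu> * A (?up T)) * (?q (p + (s - msum T)) * of_nat (mbinom P T) * m T)"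
        unfolding G_def sm si m_def by (simp add: mult_ac)
      ultimately show "sgn0 \<mu> * G \<mu> (?up T) = - (A T * of_nat (S \<mu> - T \<mu>) * ?q (p + (s - msum T)) * of_nat (mbinom P T) * m T)"
        by simp
    qed
    \<comment> \<open>The indices with \<open>T \<mu> = S \<mu>\<close> may return to the sum, since
      their factor is 0.\<close>
    also have "\<dots> = (\<Sum>T\<in>?B. - (A T * of_nat (S \<mu> - T \<mu>) * ?q (p + (s - msum T)) * of_nat (mbinom P T) * m T))"
    proof (rule sum.mono_neutral_left[OF finite_midx_box])
      show "?C \<subseteq> ?B" by blast
      show "\<forall>T\<in>?B - ?C. - (A T * of_nat (S \<mu> - T \<mu>) * ?q (p + (s - msum T)) * of_nat (mbinom P T) * m T) = 0"
      proof
        fix T assume "T \<in> ?B - ?C"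
        then have "S \<mu> - T \<mu> = 0" by force
        then show "- (A T * of_nat (S \<mu> - T \<mu>) * ?q (p + (s - msum T)) * of_nat (mbinom P T) * m T) = 0" by (simp only: of_nat_0 mult_zero_left mult_zero_right minus_zero)
      qed
    qed
    finally show ?thesis by (simp only: sum_negf)
  qed
  have "(\<Sum>\<mu>\<in>UNIV. sgn0 \<mu> * shat hb (inc x \<mu>) y w) =
      (\<Sum>T\<in>?B. A T * ?q (Suc p + (s - msum T)) * of_nat (mbinom P T) * m T)
      - (\<Sum>\<mu>\<in>UNIV. \<Sum>T\<in>?B. A T * of_nat (S \<mu> - T \<mu>) * ?q (p + (s - msum T)) * of_nat (mbinom P T) * m T)"
    unfolding e1 distrib_left sum.distrib e2 e3 by (simp add: sum_negf)
  also have "(\<Sum>\<mu>\<in>UNIV. \<Sum>T\<in>?B. A T * of_nat (S \<mu> - T \<mu>) * ?q (p + (s - msum T)) * of_nat (mbinom P T) * m T)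
      = (\<Sum>T\<in>?B. A T * of_nat (s - msum T) * ?q (p + (s - msum T)) * of_nat (mbinom P T) * m T)"
  proof (subst sum.swap, rule sum.cong[OF refl])
    fix T assume T: "T \<in> ?B"
    have "(\<Sum>\<mu>\<in>UNIV. S \<mu> - T \<mu>) = s - msum T"
      unfolding s_def msum_def using T by (intro sum_subtractf_nat) auto
    then have "(\<Sum>\<mu>\<in>UNIV. of_nat (S \<mu> - T \<mu>)) = (of_nat (s - msum T) :: complex)" by (metis of_nat_sum)
    then show "(\<Sum>\<mu>\<in>UNIV. A T * of_nat (S \<mu> - T \<mu>) * ?q (p + (s - msum T)) * of_nat (mbinom P T) * m T)
      = A T * of_nat (s - msum T) * ?q (p + (s - msum T)) * of_nat (mbinom P T) * m T"
      by (simp add: sum_distrib_left[symmetric] sum_distrib_right[symmetric])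
  qed
  also have "(\<Sum>T\<in>?B. A T * ?q (Suc p + (s - msum T)) * of_nat (mbinom P T) * m T)
      - (\<Sum>T\<in>?B. A T * of_nat (s - msum T) * ?q (p + (s - msum T)) * of_nat (mbinom P T) * m T)
      = (\<Sum>T\<in>?B. kap hb P S T * m T)"
    unfolding sum_subtractf[symmetric]
  proof (rule sum.cong[OF refl])
    fix T assume T: "T \<in> ?B"
    let ?N = "p + (s - msum T)"
    \<comment> \<open>Splitting off the last factor \<zeta> + N of the longer symbol and subtracting
      s - |T| leaves \<zeta> + p, which then cancels the last factor of
      \<open>?q (Suc p)\<close>.\<close>
    have "A T * ?q (Suc p + (s - msum T)) * of_nat (mbinom P T) * m T - A T * of_nat (s - msum T) * ?q ?N * of_nat (mbinom P T) * m T
      = A T * (\<zeta> + of_nat p) * ?q ?N * of_nat (mbinom P T) * m T"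
      by (simp add: pochhammer_Suc algebra_simps)
    also have "A T * (\<zeta> + of_nat p) = (-1) ^ (T None) * of_nat (mfact T) * of_nat (mbinom S T) / (?q p * ?q s)"
      unfolding A_def pw using zp by simp
    finally show "A T * ?q (Suc p + (s - msum T)) * of_nat (mbinom P T) * m T - A T * of_nat (s - msum T) * ?q ?N * of_nat (mbinom P T) * m T
      = kap hb P S T * m T"
      unfolding kap_def \<zeta>_def[symmetric] ms(1)[OF T] p_def[symmetric] s_def[symmetric] by (simp add: mult_ac)
  qed
  finally show ?thesis unfolding shat_eq_box by (simp add: x y m_def)
qed

text \<open>Exchanging \<open>p\<close> and \<open>q\<close> reverses the order of the factors,
  since \<open>kap\<close> is symmetric in its two exponents. This transfers the relation from the
  left factor to the right one.\<close>

lemma shat_swap: "shat hb x y w = shat hb (prod.swap y) (prod.swap x) (prod.swap w)"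
proof -
  have "kap hb (fst x) (snd y) T = kap hb (snd y) (fst x) T" for T
    by (simp add: kap_def add.commute mult_ac)
  moreover have "hmono (sidx x y T) w = hmono (sidx (prod.swap y) (prod.swap x) T) (prod.swap w)" for T
    by (simp add: hmono_def sidx_def add.commute mult_ac)
  moreover have "{T. \<forall>i. T i \<le> fst x i \<and> T i \<le> snd y i} = {T. \<forall>i. T i \<le> snd y i \<and> T i \<le> fst x i}" by auto
  ultimately show ?thesis by (simp add: shat_def)
qed

lemma shat_relation_right:
  assumes w: "w \<in> hatZ" and z: "\<And>k. 1 / (2 * hb) + of_nat k \<noteq> (0::complex)"
  shows "(\<Sum>\<mu>\<in>UNIV. sgn0 \<mu> * shat hb x (inc y \<mu>) w) = shat hb x y w"
proof -
  have "prod.swap (inc y \<mu>) = inc (prod.swap y) \<mu>" for \<mu> by (simp add: inc_def)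
  moreover have "prod.swap w \<in> hatZ"
    using w hatZ_iff[of "fst w" "snd w"] hatZ_iff[of "snd w" "fst w"] by (simp add: mult.commute prod.swap_def)
  ultimately show ?thesis
    unfolding shat_swap[of hb x] using shat_relation[OF _ z, of "prod.swap w" "prod.swap y" "prod.swap x"] by simp
qed

section \<open>Reduction of monomials to the basis\<close>

lemma msum_inc: "msum (fst (inc v \<mu>)) = Suc (msum (fst v))" "msum (snd (inc v \<mu>)) = Suc (msum (snd v))"
  by (simp_all add: inc_def msum_upd_Suc)

text \<open>The abstract form of \<open>hmono_relation\<close>, for functions of exponents with
  complex values.\<close>

definition respects_hatZ :: "(('n::finite) hidx \<Rightarrow> complex) \<Rightarrow> bool" where
  "respects_hatZ \<Phi> \<longleftrightarrow> (\<forall>v. \<Phi> v = (\<Sum>\<mu>\<in>UNIV. sgn0 \<mu> * \<Phi> (inc v \<mu>)))"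

text \<open>Quantifying over \<open>\<Phi>\<close> allows the same reduction for the monomials themselves and for their star
  products with a fixed factor.\<close>

lemma normal_form:
  fixes z :: "('n::finite) hidx"
  assumes "msum (fst z) = msum (snd z)"
  shows "\<exists>F. finite F \<and> (\<forall>x. x \<notin> F \<longrightarrow> bcoeff (hmono z) x = 0) \<and>
     (\<forall>\<Phi>. respects_hatZ \<Phi> \<longrightarrow> \<Phi> z = (\<Sum>x\<in>F. bcoeff (hmono z) x * \<Phi> (bidx x)))"
  using assms
\<comment> \<open>This minimum counts the factors p_0 q_0 in the monomial; it is 0 exactly for the
  basis monomials.\<close>
proof (induction "min (fst z None) (snd z None)" arbitrary: z)
  case 0
  define x where "x = case_sum (\<lambda>i. fst z (Some i)) (\<lambda>i. snd z (Some i))"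
  have "fst z None + wA x = snd z None + wB x"
    using 0(2) by (simp add: msum_def sum_UNIV_option wA_def wB_def x_def)
  then have "bidx x = z"
    using 0(1) by (cases z) (auto simp: bidx_def x_def fun_eq_iff min_def split: option.split if_splits)
  then show ?case
    by (intro exI[of _ "{x}"]) (use bcoeff_hmono_bidx[of x] in auto)
next
  case (Suc m)
  define v where "v = ((fst z)(None := fst z None - 1), (snd z)(None := snd z None - 1))"
  have z: "z = inc v None" using Suc(2) by (cases z) (auto simp: v_def inc_def fun_eq_iff min_def split: if_splits)
  have adm: "msum (fst v) = msum (snd v)" using Suc(3) unfolding z msum_inc by simp
  have m: "m = min (fst v None) (snd v None)" using Suc(2) by (auto simp: v_def min_def split: if_splits)
  \<comment> \<open>The relation at \<open>v\<close> solved for \<open>z = inc v None\<close>: a sum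
    with plus signs only, in which every monomial has one factor p_0 q_0 less.\<close>
  define V where "V \<mu> = (case \<mu> of None \<Rightarrow> v | Some i \<Rightarrow> inc v (Some i))" for \<mu> :: "'n option"
  have "m = min (fst (V \<mu>) None) (snd (V \<mu>) None)" "msum (fst (V \<mu>)) = msum (snd (V \<mu>))" for \<mu>
    using m adm by (auto simp: V_def inc_def msum_upd_Suc split: option.split)
  from Suc(1)[OF this] have "\<forall>\<mu>. \<exists>F. finite F \<and> (\<forall>x. x \<notin> F \<longrightarrow> bcoeff (hmono (V \<mu>)) x = 0) \<and>
     (\<forall>\<Phi>. respects_hatZ \<Phi> \<longrightarrow> \<Phi> (V \<mu>) = (\<Sum>x\<in>F. bcoeff (hmono (V \<mu>)) x * \<Phi> (bidx x)))"
    by blast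
  from choice[OF this] obtain F where F: "\<And>\<mu>. finite (F \<mu>)" "\<And>\<mu> x. x \<notin> F \<mu> \<Longrightarrow> bcoeff (hmono (V \<mu>)) x = 0"
     "\<And>\<mu> \<Phi>. respects_hatZ \<Phi> \<Longrightarrow> \<Phi> (V \<mu>) = (\<Sum>x\<in>F \<mu>. bcoeff (hmono (V \<mu>)) x * \<Phi> (bidx x))"
    by blast
  have rel: "\<Phi> z = (\<Sum>\<mu>\<in>UNIV. \<Phi> (V \<mu>))" if "\<Phi> v = (\<Sum>\<mu>\<in>UNIV. sgn0 \<mu> * \<Phi> (inc v \<mu>))" for \<Phi> :: "'n hidx \<Rightarrow> complex"
    using that by (simp add: sum_UNIV_option V_def z sgn0_def sum_negf)
  \<comment> \<open>The monomials themselves satisfy the relation on \<open>hatZ\<close>, so their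
    coordinates obey the same recursion.\<close>
  have bc: "bcoeff (hmono z) x = (\<Sum>\<mu>\<in>UNIV. bcoeff (hmono (V \<mu>)) x)" for x
  proof -
    have "bcoeff (hmono z) x = bcoeff (\<lambda>w. \<Sum>\<mu>\<in>UNIV. 1 * hmono (V \<mu>) w) x"
      by (rule fun_cong[OF bcoeff_cong]) (simp add: rel[of "\<lambda>v. hmono v w" for w, OF hmono_relation[symmetric]])
    also have "\<dots> = (\<Sum>\<mu>\<in>UNIV. 1 * bcoeff (hmono (V \<mu>)) x)"
      by (rule bcoeff_sum) (use \<open>\<And>\<mu>. msum (fst (V \<mu>)) = msum (snd (V \<mu>))\<close> in \<open>auto intro: hmono_holo_hatD\<close>)
    finally show ?thesis by simp
  qed
  let ?F = "\<Union>\<mu>. F \<mu>"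
  have fin: "finite ?F" using F(1) by auto
  show ?case
  proof (intro exI[of _ ?F] conjI allI impI fin)
    show "bcoeff (hmono z) x = 0" if "x \<notin> ?F" for x unfolding bc using that F(2) by (auto intro: sum.neutral)
    fix \<Phi> :: "'n hidx \<Rightarrow> complex" assume \<Phi>: "respects_hatZ \<Phi>"
    have "\<Phi> (V \<mu>) = (\<Sum>x\<in>?F. bcoeff (hmono (V \<mu>)) x * \<Phi> (bidx x))" for \<mu>
      unfolding F(3)[OF \<Phi>, of \<mu>]
    proof (rule sum.mono_neutral_left[OF fin])
      show "\<forall>x\<in>?F - F \<mu>. bcoeff (hmono (V \<mu>)) x * \<Phi> (bidx x) = 0"
        using F(2)[of _ \<mu>] by simp
    qed blast
    then have "\<Phi> z = (\<Sum>\<mu>\<in>UNIV. \<Sum>x\<in>?F. bcoeff (hmono (V \<mu>)) x * \<Phi> (bidx x))"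
      using rel[OF \<Phi>[unfolded respects_hatZ_def, rule_format]] by simp
    also have "\<dots> = (\<Sum>x\<in>?F. bcoeff (hmono z) x * \<Phi> (bidx x))"
      unfolding bc sum_distrib_right by (rule sum.swap)
    finally show "\<Phi> z = (\<Sum>x\<in>?F. bcoeff (hmono z) x * \<Phi> (bidx x))" .
  qed
qed

section \<open>Growth of the structure constants\<close>

lemma mfact_le: "mfact T \<le> fact (msum T)"
proof -
  have "(\<Prod>i\<in>A. fact (T i)) \<le> (fact (\<Sum>i\<in>A. T i) :: nat)" if "finite A" for A
    using that
  proof (induction A rule: finite_induct)
    case (insert a A)
    have "fact (T a) * (\<Prod>i\<in>A. fact (T i)) \<le> fact (T a) * (fact (\<Sum>i\<in>A. T i) :: nat)"
      using insert.IH by (intro mult_left_mono) auto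
    also have "\<dots> \<le> fact (T a + (\<Sum>i\<in>A. T i))" by (rule dvd_imp_le[OF fact_fact_dvd_fact]) simp
    finally show ?case using insert.hyps by simp
  qed simp
  then show ?thesis by (simp add: mfact_def msum_def)
qed

lemma binomial_le_two_power: "n choose k \<le> 2 ^ n"
proof (cases "k \<le> n")
  case True
  have "n choose k \<le> (\<Sum>k\<le>n. n choose k)" using True by (intro member_le_sum) auto
  then show ?thesis by (simp add: choose_row_sum)
qed (simp add: not_le binomial_eq_0)

lemma mbinom_le: "mbinom P T \<le> 2 ^ msum P"
  unfolding mbinom_def msum_def power_sum by (intro prod_mono) (auto simp: binomial_le_two_power)

text \<open>The quotient of Pochhammer symbols after cancelling \<open>(z)_s\<close>, with the factors in \<open>E\<close> removed
  from the denominator \<open>(z)_p\<close>.\<close>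

definition prat :: "nat set \<Rightarrow> complex \<Rightarrow> nat \<Rightarrow> nat \<Rightarrow> nat \<Rightarrow> complex" where
  "prat E z p s N = (\<Prod>k\<in>{s..<N}. z + of_nat k) / (\<Prod>k\<in>{..<p} - E. z + of_nat k)"

lemma pochhammer_ratio:
  assumes "\<And>k. z + of_nat k \<noteq> 0" "s \<le> N"
  shows "pochhammer z N / (pochhammer z p * pochhammer z s) = prat {} z p s N"
proof -
  have "pochhammer z N = pochhammer z s * (\<Prod>k\<in>{s..<N}. z + of_nat k)"
    unfolding pochhammer_prod using prod.atLeastLessThan_concat[of 0 s N "\<lambda>k. z + of_nat k"] assms(2) by simp
  moreover have "pochhammer z s \<noteq> 0" unfolding pochhammer_prod using assms(1) by simp
  ultimately show ?thesis by (simp add: prat_def pochhammer_prod[of z p] lessThan_atLeast0)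
qed

lemma fact_prod_interval: "s \<le> N \<Longrightarrow> fact s * (\<Prod>k\<in>{s..<N}. real k + 1) = fact N"
proof (induction rule: dec_induct)
  case (step n)
  have "fact s * (\<Prod>k\<in>{s..<Suc n}. real k + 1) = (fact s * (\<Prod>k\<in>{s..<n}. real k + 1)) * (real n + 1)"
    using step.hyps by (simp add: mult.assoc)
  then show ?case unfolding step.IH by (simp add: algebra_simps)
qed simp

text \<open>Numerator factors are at most M (k+1), denominator factors at least \<delta> (k+1), and
  the products of k+1 are factorials. The numerator has at most \<open>p\<close> factors because
  \<open>N \<le> s + p\<close>; removing the factor with index \<open>m\<close> from the denominator
  costs at most m + 1.\<close>

lemma norm_prat_le:
  assumes M: "norm z \<le> M" "M \<ge> 1" and \<delta>: "0 < \<delta>" "\<delta> \<le> 1" "\<And>k. k \<notin> E \<Longrightarrow> \<delta> * (real k + 1) \<le> norm (z + of_nat k)"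
    and E: "E \<subseteq> {m}" and N: "s \<le> N" "N \<le> s + p"
  shows "norm (prat E z p s N) \<le> (real m + 1) * (M / \<delta>) ^ p * fact N / (fact s * fact p)"
proof -
  have "norm (\<Prod>k\<in>{s..<N}. z + of_nat k) \<le> (\<Prod>k\<in>{s..<N}. M * (real k + 1))"
    unfolding prod_norm[symmetric]
  proof (intro prod_mono conjI norm_ge_zero)
    fix k
    have "norm (z + of_nat k) \<le> M + real k" using norm_triangle_ineq[of z "of_nat k"] M by simp
    also have "\<dots> \<le> M * (real k + 1)" using mult_right_mono[OF M(2), of "real k"] by (simp add: algebra_simps)
    finally show "norm (z + of_nat k) \<le> M * (real k + 1)" .
  qed
  also have "\<dots> = M ^ (N - s) * (\<Prod>k\<in>{s..<N}. real k + 1)" by (simp add: prod.distrib)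
  also have "\<dots> \<le> M ^ p * (\<Prod>k\<in>{s..<N}. real k + 1)"
    using M(2) N by (intro mult_right_mono power_increasing prod_nonneg) auto
  also have "\<dots> = M ^ p * (fact N / fact s)"
    using fact_prod_interval[OF N(1)] by (simp add: field_simps)
  finally have num: "norm (\<Prod>k\<in>{s..<N}. z + of_nat k) \<le> M ^ p * (fact N / fact s)" .
  have pr: "(\<Prod>k<p. \<delta> * (real k + 1)) = \<delta> ^ p * fact p"
    using fact_prod_interval[of 0 p] by (simp add: prod.distrib lessThan_atLeast0)
  have "\<delta> ^ p * fact p / (real m + 1) \<le> (\<Prod>k\<in>{..<p} - E. \<delta> * (real k + 1))"
  proof (cases "{..<p} \<inter> E = {}")
    case True
    then have "{..<p} - E = {..<p}" by auto
    moreover have "\<delta> ^ p * fact p / (real m + 1) \<le> \<delta> ^ p * fact p / 1" using \<delta>(1) by (intro divide_left_mono) auto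
    ultimately show ?thesis using pr by simp
  next
    case False
    then have e: "E = {m}" and m: "m < p" using E by auto
    have "\<delta> ^ p * fact p = \<delta> * (real m + 1) * (\<Prod>k\<in>{..<p} - E. \<delta> * (real k + 1))"
      unfolding pr[symmetric] e using m by (intro prod.remove) auto
    also have "\<dots> \<le> 1 * (real m + 1) * (\<Prod>k\<in>{..<p} - E. \<delta> * (real k + 1))"
      using \<delta> by (intro mult_right_mono prod_nonneg) auto
    finally show ?thesis by (simp add: divide_le_eq mult.commute)
  qed
  also have "\<dots> \<le> norm (\<Prod>k\<in>{..<p} - E. z + of_nat k)"
    unfolding prod_norm[symmetric] using \<delta> by (intro prod_mono) auto
  finally have den: "\<delta> ^ p * fact p / (real m + 1) \<le> norm (\<Prod>k\<in>{..<p} - E. z + of_nat k)" .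
  have "norm (prat E z p s N) \<le> (M ^ p * (fact N / fact s)) / (\<delta> ^ p * fact p / (real m + 1))"
    unfolding prat_def norm_divide using num den \<delta>(1) M(2) by (intro frac_le) auto
  also have "\<dots> = (real m + 1) * (M / \<delta>) ^ p * fact N / (fact s * fact p)"
    by (simp add: power_divide mult_ac)
  finally show ?thesis .
qed

definition krn :: "nat set \<Rightarrow> complex \<Rightarrow> ('n::finite) midx \<Rightarrow> 'n midx \<Rightarrow> 'n midx \<Rightarrow> complex" where
  "krn E t P S T = (-1) ^ (T None) * of_nat (mfact T) * of_nat (mbinom P T) * of_nat (mbinom S T)
      * prat E (1 / (2 * t)) (msum P) (msum S) (msum (\<lambda>i. P i + S i - T i))"

lemma msum_sub:
  fixes P S T :: "('n::finite) midx"
  assumes "\<And>i. T i \<le> P i \<and> T i \<le> S i"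
  shows "msum (\<lambda>i. P i + S i - T i) + msum T = msum P + msum S" "msum T \<le> msum P" "msum T \<le> msum S"
proof -
  show "msum T \<le> msum P" "msum T \<le> msum S" unfolding msum_def using assms by (auto intro: sum_mono)
  show "msum (\<lambda>i. P i + S i - T i) + msum T = msum P + msum S"
    unfolding msum_def sum.distrib[symmetric] using assms by (intro sum.cong) (auto simp: trans_le_add2)
qed

lemma kap_eq_krn:
  fixes P S T :: "('n::finite) midx"
  assumes "\<And>k. 1 / (2 * t) + of_nat k \<noteq> (0::complex)" "\<And>i. T i \<le> P i \<and> T i \<le> S i"
  shows "kap t P S T = krn {} t P S T"
proof -
  have "msum S \<le> msum (\<lambda>i. P i + S i - T i)" using msum_sub[of T P S] assms(2) by fastforce
  from pochhammer_ratio[OF assms(1) this, of "msum P", symmetric] show ?thesis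
    unfolding kap_def krn_def by (simp only: of_nat_mult times_divide_eq_left times_divide_eq_right mult_ac)
qed

text \<open>As N + |T| = p + s, the factorials contribute at most (p+s)!/(p! s!), a binomial
  coefficient bounded by 2^(p+s). A second factor 2^(p+s) comes from the two multi-index binomials,
  which explains the 4.\<close>

lemma norm_krn_le:
  fixes P S T :: "('n::finite) midx"
  assumes M: "norm (1 / (2 * t)) \<le> M" "M \<ge> 1" and \<delta>: "0 < \<delta>" "\<delta> \<le> 1" "\<And>k. k \<notin> E \<Longrightarrow> \<delta> * (real k + 1) \<le> norm (1 / (2 * t) + of_nat k)"
    and E: "E \<subseteq> {m}" and T: "\<And>i. T i \<le> P i \<and> T i \<le> S i"
  shows "norm (krn E t P S T) \<le> (real m + 1) * (4 * M / \<delta>) ^ (msum P + msum S)"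
proof -
  define p where "p = msum P"
  define s where "s = msum S"
  define N where "N = msum (\<lambda>i. P i + S i - T i)"
  have N: "N + msum T = p + s" "msum T \<le> p" "msum T \<le> s"
    using msum_sub[of T P S] T by (auto simp: N_def p_def s_def)
  have a: "norm (prat E (1 / (2 * t)) p s N) \<le> (real m + 1) * (M / \<delta>) ^ p * fact N / (fact s * fact p)"
    by (rule norm_prat_le[OF M \<delta> E]) (use N in auto)
  have "norm (krn E t P S T) = real (mfact T) * real (mbinom P T) * real (mbinom S T) * norm (prat E (1 / (2 * t)) p s N)"
    by (simp add: krn_def norm_mult norm_power p_def s_def N_def)
  also have "\<dots> \<le> fact (msum T) * 2 ^ p * 2 ^ s * ((real m + 1) * (M / \<delta>) ^ p * fact N / (fact s * fact p))"
  proof (intro mult_mono a)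
    show "real (mfact T) \<le> fact (msum T)" using mfact_le[of T] by (metis of_nat_fact of_nat_le_iff)
    show "real (mbinom P T) \<le> 2 ^ p" "real (mbinom S T) \<le> 2 ^ s"
      using mbinom_le[of P T] mbinom_le[of S T] unfolding p_def s_def by (metis of_nat_le_iff of_nat_numeral of_nat_power)+
  qed auto
  also have "\<dots> = (real m + 1) * (M / \<delta>) ^ p * 2 ^ (p + s) * (fact N * fact (msum T) / (fact p * fact s))"
    by (simp add: power_add mult_ac)
  also have "\<dots> \<le> (real m + 1) * (M / \<delta>) ^ (p + s) * 2 ^ (p + s) * 2 ^ (p + s)"
  proof (intro mult_mono)
    have M\<delta>: "1 \<le> M / \<delta>" using M(2) \<delta> by (simp add: le_divide_eq)
    then show "(M / \<delta>) ^ p \<le> (M / \<delta>) ^ (p + s)" by (intro power_increasing) auto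
    have "0 \<le> M / \<delta>" using M\<delta> by simp
    then show "0 \<le> (M / \<delta>) ^ p" by (rule zero_le_power)
    have "(fact N * fact (msum T) :: nat) \<le> fact (N + msum T)"
      by (rule dvd_imp_le[OF fact_fact_dvd_fact]) simp
    also have "\<dots> = fact p * fact s * ((p + s) choose p)"
      unfolding N(1) using binomial_fact_lemma[of p "p + s"] by simp
    also have "\<dots> \<le> fact p * fact s * 2 ^ (p + s)" by (intro mult_left_mono binomial_le_two_power) auto
    finally have "real (fact N * fact (msum T)) \<le> real (fact p * fact s * 2 ^ (p + s))"
      using of_nat_le_iff by blast
    then have "(fact N * fact (msum T) :: real) \<le> fact p * fact s * 2 ^ (p + s)" by simp
    then show "fact N * fact (msum T) / (fact p * fact s) \<le> (2::real) ^ (p + s)"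
      by (simp add: divide_le_eq mult.commute)
    show "0 \<le> (real m + 1) * (M / \<delta>) ^ (p + s) * 2 ^ (p + s)" "0 \<le> (real m + 1) * (M / \<delta>) ^ (p + s)"
      using M\<delta> by (auto intro!: mult_nonneg_nonneg)
  qed auto
  also have "\<dots> = (real m + 1) * (4 * M / \<delta>) ^ (p + s)"
  proof -
    have "(4 * M / \<delta>) = (M / \<delta>) * 2 * 2" by simp
    then show ?thesis by (simp only: power_mult_distrib mult.assoc)
  qed
  finally show ?thesis by (simp add: p_def s_def)
qed

text \<open>For k > K the triangle inequality gives |z + k| \<ge> k - |z0| - 1 \<ge> (k+1)/4. The
  finitely many other factors that do not vanish at \<open>z0\<close> have modulus at least
  \<open>d\<close> there and lose less than d/2 on the ball; dividing d/4 by K + 1 turns this into a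
  bound linear in k. Exempting vanishing factors prepares for the poles.\<close>

lemma pochhammer_factor_lower_bound:
  fixes z0 :: complex
  shows "\<exists>\<epsilon>>0. \<exists>\<delta>>0. \<exists>M\<ge>1. \<delta> \<le> 1 \<and> (\<forall>z\<in>ball z0 \<epsilon>. norm z \<le> M \<and>
     (\<forall>k. z0 + of_nat k \<noteq> 0 \<longrightarrow> \<delta> * (real k + 1) \<le> norm (z + of_nat k)))"
proof -
  define K where "K = nat \<lceil>2 * norm z0 + 3\<rceil>"
  define d where "d = Min (insert 1 ((\<lambda>k. norm (z0 + of_nat k)) ` {k. k \<le> K \<and> z0 + of_nat k \<noteq> 0}))"
  have d: "d > 0" "d \<le> 1" "\<And>k. k \<le> K \<Longrightarrow> z0 + of_nat k \<noteq> 0 \<Longrightarrow> d \<le> norm (z0 + of_nat k)"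
    unfolding d_def by (subst Min_gr_iff) (auto intro!: Min_le)
  define \<delta> where "\<delta> = d / 4 / (real K + 1)"
  have \<delta>: "\<delta> > 0" "\<delta> \<le> 1/4" using d by (auto simp: \<delta>_def divide_le_eq)
  have "norm z \<le> norm z0 + 1 \<and> (\<forall>k. z0 + of_nat k \<noteq> 0 \<longrightarrow> \<delta> * (real k + 1) \<le> norm (z + of_nat k))" if z: "z \<in> ball z0 (d / 2)" for z
  proof (intro conjI allI impI)
    have zz: "norm (z - z0) < d / 2" using z by (simp add: dist_norm norm_minus_commute)
    then show nz: "norm z \<le> norm z0 + 1" using norm_triangle_ineq2[of z z0] d by linarith
    fix k assume k: "z0 + of_nat k \<noteq> 0"
    show "\<delta> * (real k + 1) \<le> norm (z + of_nat k)"
    proof (cases "k \<le> K")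
      case True
      have "\<delta> * (real k + 1) \<le> \<delta> * (real K + 1)" using True \<delta> by (intro mult_left_mono) auto
      also have "\<dots> = d / 4" unfolding \<delta>_def using of_nat_0_le_iff[of K, where 'a=real] by (subst times_divide_eq_left, subst nonzero_mult_div_cancel_right) linarith+
      also have "\<dots> \<le> norm (z0 + of_nat k) - d / 2" using d(3)[OF True k] d(1) by simp
      also have "\<dots> \<le> norm (z + of_nat k)"
        using norm_triangle_ineq2[of "z0 + of_nat k" "z0 - z"] zz by (simp add: norm_minus_commute algebra_simps)
      finally show ?thesis .
    next
      case False
      then have kk: "real k \<ge> 2 * norm z0 + 3" unfolding K_def by linarith
      have "\<delta> * (real k + 1) \<le> 1/4 * (real k + 1)" using \<delta> by (intro mult_right_mono) auto
      also have "\<dots> \<le> real k - (norm z0 + 1)" using kk norm_ge_zero[of z0] by (simp add: field_simps)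
      also have "\<dots> \<le> norm (z + of_nat k)"
        using nz norm_triangle_ineq2[of "of_nat k" "- z"] by (simp add: add.commute)
      finally show ?thesis .
    qed
  qed
  then show ?thesis
    using d \<delta> by - (rule exI[of _ "d / 2"], rule conjI, simp, rule exI[of _ \<delta>], rule conjI, simp, rule exI[of _ "norm z0 + 1"], auto)
qed

lemma half_inverse_local:
  fixes t0 :: complex
  assumes "t0 \<noteq> 0"
  shows "\<exists>r>0. r \<le> 1 \<and> (\<exists>\<delta>>0. \<exists>M\<ge>1. \<delta> \<le> 1 \<and> (\<forall>t\<in>ball t0 r. t \<noteq> 0 \<and> norm (1 / (2 * t)) \<le> M \<and>
     (\<forall>k. 1 / (2 * t0) + of_nat k \<noteq> 0 \<longrightarrow> \<delta> * (real k + 1) \<le> norm (1 / (2 * t) + of_nat k))))"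
proof -
  obtain \<epsilon> \<delta> M where e: "\<epsilon> > 0" "\<delta> > 0" "M \<ge> 1" "\<delta> \<le> 1" and b: "\<And>z. z \<in> ball (1 / (2 * t0)) \<epsilon> \<Longrightarrow> norm z \<le> M \<and>
     (\<forall>k. 1 / (2 * t0) + of_nat k \<noteq> 0 \<longrightarrow> \<delta> * (real k + 1) \<le> norm (z + of_nat k))"
    using pochhammer_factor_lower_bound[of "1 / (2 * t0)"] by blast
  have "isCont (\<lambda>t. 1 / (2 * t)) t0" using assms by (intro continuous_intros) auto
  then obtain r where r: "r > 0" "\<And>t. dist t t0 < r \<Longrightarrow> dist (1 / (2 * t)) (1 / (2 * t0)) < \<epsilon>"
    using e(1) unfolding continuous_at_eps_delta by blast
  \<comment> \<open>\<open>norm t0\<close> keeps the ball away from 0; the cap 1 is used to bound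
    numerators near a pole.\<close>
  define r' where "r' = min 1 (min r (norm t0))"
  have r': "r' > 0" "r' \<le> 1" using r assms by (auto simp: r'_def)
  have "t \<noteq> 0 \<and> norm (1 / (2 * t)) \<le> M \<and>
     (\<forall>k. 1 / (2 * t0) + of_nat k \<noteq> 0 \<longrightarrow> \<delta> * (real k + 1) \<le> norm (1 / (2 * t) + of_nat k))" if t: "t \<in> ball t0 r'" for t
  proof -
    have "t \<noteq> 0" using t by (auto simp: r'_def)
    moreover have "1 / (2 * t) \<in> ball (1 / (2 * t0)) \<epsilon>" using r(2)[of t] t by (simp add: r'_def dist_commute)
    ultimately show ?thesis using b by blast
  qed
  then show ?thesis using r' e(2-4) by blast
qed

section \<open>The star product as a series in coordinates\<close>

definition below :: "('n::finite) bix \<Rightarrow> 'n bix \<Rightarrow> 'n midx \<Rightarrow> bool" where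
  "below x y T \<longleftrightarrow> (\<forall>i. T i \<le> fst (bidx x) i \<and> T i \<le> snd (bidx y) i)"

text \<open>Outside the range of summation the coefficients vanish; the index is set to \<open>0\<close> there because
  truncated differences need not have equal degrees.\<close>

definition jidx :: "('n::finite) jix \<Rightarrow> 'n hidx" where
  "jidx = (\<lambda>(x, y, T). if below x y T then sidx (bidx x) (bidx y) T else (\<lambda>_. 0, \<lambda>_. 0))"

definition starco :: "(('n::finite) midx \<Rightarrow> 'n midx \<Rightarrow> 'n midx \<Rightarrow> complex) \<Rightarrow> ('n bix \<Rightarrow> complex) \<Rightarrow> ('n bix \<Rightarrow> complex)
    \<Rightarrow> 'n jix \<Rightarrow> complex" where
  "starco \<kappa> u v = (\<lambda>(x, y, T). u x * v y * (if below x y T then \<kappa> (fst (bidx x)) (snd (bidx y)) T else 0))"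

definition starbd :: "real \<Rightarrow> real \<Rightarrow> (('n::finite) bix \<Rightarrow> complex) \<Rightarrow> ('n bix \<Rightarrow> complex)
    \<Rightarrow> 'n jix \<Rightarrow> real" where
  "starbd C D u v = (\<lambda>(x, y, T). norm (u x) * norm (v y) * (if below x y T then C * D ^ (msum (fst (bidx x)) + msum (snd (bidx y))) else 0))"

definition kernel_bound :: "(('n::finite) midx \<Rightarrow> 'n midx \<Rightarrow> 'n midx \<Rightarrow> complex) \<Rightarrow> real \<Rightarrow> real \<Rightarrow> bool" where
  "kernel_bound \<kappa> C D \<longleftrightarrow> (\<forall>P S T. (\<forall>i. T i \<le> P i \<and> T i \<le> S i) \<longrightarrow> norm (\<kappa> P S T) \<le> C * D ^ (msum P + msum S))"

definition decay :: "(('n::finite) bix \<Rightarrow> complex) \<Rightarrow> real \<Rightarrow> real \<Rightarrow> bool" where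
  "decay u \<rho> M \<longleftrightarrow> (\<forall>x. norm (u x) \<le> M / \<rho> ^ sum x UNIV)"

text \<open>A summable weight on triples that dominates all product terms, up to a constant bilinear
  in the decay constants of the factors.\<close>

definition half_geom :: "('n::finite) jix \<Rightarrow> real" where
  "half_geom = (\<lambda>(x, y, T). (1/2) ^ sum x UNIV * ((1/2) ^ sum y UNIV * (1/2) ^ sum T UNIV))"

lemma half_geom_summable: "half_geom summable_on UNIV"
proof -
  have g: "(\<lambda>x :: 'i::finite \<Rightarrow> nat. (1/2 :: real) ^ sum x UNIV) summable_on UNIV"
    by (rule multi_geometric_summable) auto
  have 1: "(\<lambda>(y, T). (1/2 :: real) ^ sum y UNIV * (1/2) ^ sum T UNIV) summable_on (UNIV :: ('a bix \<times> 'a midx) set)"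
    using summable_on_Times_nonneg[OF g g] by (simp add: UNIV_Times_UNIV[symmetric] del: UNIV_Times_UNIV)
  have "(\<lambda>(x, yT). (1/2 :: real) ^ sum x UNIV * (case yT of (y, T) \<Rightarrow> (1/2) ^ sum y UNIV * (1/2) ^ sum T UNIV)) summable_on
      ((UNIV :: 'a bix set) \<times> (UNIV :: ('a bix \<times> 'a midx) set))"
    by (rule summable_on_Times_nonneg[OF g 1]) auto
  then show ?thesis by (simp add: half_geom_def case_prod_unfold)
qed

lemma msum_jidx_aux:
  fixes x y :: "('a::finite) bix"
  shows "msum (fst (jidx (x, y, T))) = msum (snd (jidx (x, y, T)))"
    "msum (fst (jidx (x, y, T))) \<le> msum (fst (bidx x)) + msum (snd (bidx y))"
proof -
  have "msum (fst (jidx (x, y, T))) = msum (snd (jidx (x, y, T))) \<and> msum (fst (jidx (x, y, T))) \<le> msum (fst (bidx x)) + msum (snd (bidx y))"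
  proof (cases "below x y T")
    case True
    have s: "msum (\<lambda>i. P i + R i - T i) + msum T = msum P + msum R" if "\<And>i. T i \<le> P i \<or> T i \<le> R i" for P R :: "'a midx"
      unfolding msum_def sum.distrib[symmetric]
    proof (intro sum.cong refl)
      fix i show "P i + R i - T i + T i = P i + R i" using that[of i] by auto
    qed
    have "msum (fst (jidx (x, y, T))) + msum T = msum (fst (bidx x)) + msum (fst (bidx y))"
      using True s[of "fst (bidx x)" "fst (bidx y)"] by (auto simp: jidx_def sidx_def below_def)
    moreover have "msum (snd (jidx (x, y, T))) + msum T = msum (snd (bidx x)) + msum (snd (bidx y))"
      using True s[of "snd (bidx x)" "snd (bidx y)"] by (auto simp: jidx_def sidx_def below_def)
    ultimately show ?thesis by (simp add: msum_bidx)
  qed (simp add: jidx_def msum_def)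
  then show "msum (fst (jidx (x, y, T))) = msum (snd (jidx (x, y, T)))"
    "msum (fst (jidx (x, y, T))) \<le> msum (fst (bidx x)) + msum (snd (bidx y))" by auto
qed

lemma msum_jidx: "msum (fst (jidx j)) = msum (snd (jidx j))"
  using msum_jidx_aux(1) by (cases j) blast

lemmas msum_jidx_le = msum_jidx_aux(2)

text \<open>The rate 4 D R consists of \<open>D\<close> for the kernel, \<open>R\<close> for the
  monomial and two factors 2. One pays for the sum over \<open>T\<close>, since |T| \<le> |P| gives
  1 \<le> 2^|P| * (1/2)^|T|; the other leaves the geometric weights in \<open>x\<close> and
  \<open>y\<close>.\<close>

lemma starbd_term_le:
  assumes C: "C \<ge> 0" "D \<ge> 1" "R \<ge> 1" and u: "decay u (4 * D * R) M" and v: "decay v (4 * D * R) N"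
  shows "starbd C D u v j * R ^ msum (fst (jidx j)) \<le> C * M * N * half_geom j"
proof -
  obtain x y T where j: "j = (x, y, T)" by (cases j)
  let ?p = "msum (fst (bidx x))" and ?s = "msum (snd (bidx y))"
  let ?\<rho> = "4 * D * R"
  have \<rho>: "?\<rho> \<ge> 1" using C mult_mono[of 1 D 1 R] by simp
  have M: "M \<ge> 0" "N \<ge> 0" using u v \<rho> norm_ge_zero order_trans
    unfolding decay_def by (metis div_by_1 power_0 sum.neutral_const)+
  show ?thesis
  proof (cases "below x y T")
    case True
    have Tp: "msum T \<le> ?p" unfolding msum_def using True by (intro sum_mono) (auto simp: below_def)
    have DR: "D * R \<ge> 1" using C mult_mono[of 1 D 1 R] by simp
    have px: "?p \<le> sum x UNIV" "?s \<le> sum y UNIV" by (auto simp: msum_bidx sum_eq_wA_wB)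
    have "starbd C D u v j * R ^ msum (fst (jidx j)) \<le> norm (u x) * norm (v y) * (C * D ^ (?p + ?s)) * R ^ (?p + ?s)"
      unfolding j using True C msum_jidx_le[of x y T]
      by (auto simp: starbd_def intro!: mult_left_mono power_increasing mult_nonneg_nonneg)
    also have "\<dots> = C * (norm (u x) * (D * R) ^ ?p) * (norm (v y) * (D * R) ^ ?s)"
      by (simp add: power_add power_mult_distrib mult_ac)
    also have "\<dots> \<le> C * (norm (u x) * (D * R) ^ ?p) * (norm (v y) * (D * R) ^ ?s) * (2 ^ ?p * (1/2) ^ msum T)"
    proof -
      have "(2::real) ^ msum T \<le> 2 ^ ?p" using Tp by (intro power_increasing) auto
      then have "1 \<le> (2::real) ^ ?p * (1/2) ^ msum T" by (simp add: power_divide)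
      moreover have "0 \<le> C * (norm (u x) * (D * R) ^ ?p) * (norm (v y) * (D * R) ^ ?s)"
        using C DR by (intro mult_nonneg_nonneg) auto
      ultimately show ?thesis using mult_left_mono by fastforce
    qed
    also have "\<dots> \<le> C * (norm (u x) * (2 * D * R) ^ ?p) * (norm (v y) * (2 * D * R) ^ ?s) * (1/2) ^ msum T"
    proof -
      have "(D * R) ^ ?s \<le> (2 * D * R) ^ ?s" using C by (intro power_mono) auto
      then have "C * (norm (u x) * (2 * D * R) ^ ?p) * (norm (v y) * (D * R) ^ ?s) * (1/2) ^ msum T
        \<le> C * (norm (u x) * (2 * D * R) ^ ?p) * (norm (v y) * (2 * D * R) ^ ?s) * (1/2) ^ msum T"
        using C DR by (intro mult_right_mono mult_left_mono mult_nonneg_nonneg) auto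
      then show ?thesis by (simp add: power_mult_distrib mult_ac)
    qed
    also have "\<dots> \<le> C * (M * (1/2) ^ sum x UNIV) * (N * (1/2) ^ sum y UNIV) * (1/2) ^ msum T"
    proof -
      have *: "norm (u x) * (2 * D * R) ^ p \<le> M * (1/2) ^ sum x UNIV"
        if "decay u ?\<rho> M" "M \<ge> 0" "p \<le> sum x UNIV" for u :: "'a bix \<Rightarrow> complex" and x p M
      proof -
        have "norm (u x) * (2 * D * R) ^ p \<le> (M / ?\<rho> ^ sum x UNIV) * (2 * D * R) ^ sum x UNIV"
          using that C DR \<rho> unfolding decay_def by (intro mult_mono power_increasing) auto
        also have "\<dots> = M * (2 * D * R / ?\<rho>) ^ sum x UNIV" unfolding power_divide by (simp only: times_divide_eq_left times_divide_eq_right)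
        also have "2 * D * R / ?\<rho> = 1/2" using C by simp
        finally show ?thesis .
      qed
      have "C * (norm (u x) * (2 * D * R) ^ ?p) \<le> C * (M * (1/2) ^ sum x UNIV)"
        using *[OF u M(1) px(1)] C(1) by (rule mult_left_mono)
      from mult_mono[OF this *[OF v M(2) px(2)]]
      have "C * (norm (u x) * (2 * D * R) ^ ?p) * (norm (v y) * (2 * D * R) ^ ?s) \<le> C * (M * (1/2) ^ sum x UNIV) * (N * (1/2) ^ sum y UNIV)"
        using C M by simp
      then show ?thesis by (rule mult_right_mono) simp
    qed
    finally show ?thesis by (simp add: j half_geom_def msum_def mult_ac)
  qed (use M C in \<open>simp add: j starbd_def half_geom_def\<close>)
qed

lemma norm_starco_le:
  assumes "kernel_bound \<kappa> C D"
  shows "norm (starco \<kappa> u v j) \<le> starbd C D u v j"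
  using assms by (cases j) (auto simp: starco_def starbd_def kernel_bound_def below_def norm_mult intro!: mult_left_mono)

lemma mbounded_starbd:
  assumes C: "C \<ge> 0" "D \<ge> 1" and u: "\<And>\<rho>. \<rho> \<ge> 1 \<Longrightarrow> \<exists>M. decay u \<rho> M" and v: "\<And>\<rho>. \<rho> \<ge> 1 \<Longrightarrow> \<exists>M. decay v \<rho> M"
  shows "mbounded (starbd C D u v) jidx"
  unfolding mbounded_def
proof (intro conjI allI impI msum_jidx)
  show nn: "0 \<le> starbd C D u v j" for j using C by (cases j) (auto simp: starbd_def)
  fix R :: real assume R: "R \<ge> 1"
  have \<rho>: "4 * D * R \<ge> 1" using C R mult_mono[of 1 D 1 R] by simp
  obtain M N where MN: "decay u (4 * D * R) M" "decay v (4 * D * R) N" using u[OF \<rho>] v[OF \<rho>] by blast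
  have "(\<lambda>j. C * M * N * half_geom j) summable_on (UNIV :: 'a jix set)"
    by (intro summable_on_cmult_right half_geom_summable)
  then show "(\<lambda>j. starbd C D u v j * R ^ msum (fst (jidx j))) summable_on UNIV"
    by (rule summable_on_comparison_test) (use starbd_term_le[OF C R MN] nn R in auto)
qed

text \<open>The kernel is a parameter because a modified one replaces \<open>kap\<close> near a
  pole.\<close>

definition starS :: "(('n::finite) midx \<Rightarrow> 'n midx \<Rightarrow> 'n midx \<Rightarrow> complex) \<Rightarrow> ('n bix \<Rightarrow> complex) \<Rightarrow> ('n bix \<Rightarrow> complex)
    \<Rightarrow> 'n hvec \<Rightarrow> complex" where
  "starS \<kappa> u v = mseries (starco \<kappa> u v) jidx"

lemma starS_term_le:
  assumes C: "C \<ge> 0" "D \<ge> 1" "R \<ge> 1" and k: "kernel_bound \<kappa> C D"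
    and u: "decay u (4 * D * R\<^sup>2) M" and v: "decay v (4 * D * R\<^sup>2) N" and w: "norm w \<le> R"
  shows "norm (starco \<kappa> u v j * hmono (jidx j) w) \<le> C * M * N * half_geom j"
proof -
  have R2: "R\<^sup>2 \<ge> 1" using C(3) by simp
  have "norm (starco \<kappa> u v j * hmono (jidx j) w) \<le> starbd C D u v j * (R\<^sup>2) ^ msum (fst (jidx j))"
    unfolding norm_mult
    by (intro mult_mono norm_starco_le[OF k] norm_hmono_le[OF C(3) w msum_jidx] norm_ge_zero
        order_trans[OF norm_ge_zero norm_starco_le[OF k]])
  also have "\<dots> \<le> C * M * N * half_geom j" by (rule starbd_term_le[OF C(1,2) R2 u v])
  finally show ?thesis .
qed

lemma starS_has_sum:
  assumes "C \<ge> 0" "D \<ge> 1" "R \<ge> 1" "kernel_bound \<kappa> C D"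
    and "decay u (4 * D * R\<^sup>2) M" "decay v (4 * D * R\<^sup>2) N" "norm w \<le> R"
  shows "((\<lambda>j. starco \<kappa> u v j * hmono (jidx j) w) has_sum starS \<kappa> u v w) UNIV"
proof -
  have "(\<lambda>j. C * M * N * half_geom j) summable_on (UNIV :: 'a jix set)"
    by (intro summable_on_cmult_right half_geom_summable)
  then have "(\<lambda>j. norm (starco \<kappa> u v j * hmono (jidx j) w)) summable_on UNIV"
    by (rule summable_on_comparison_test) (auto intro!: starS_term_le[OF assms])
  then show ?thesis unfolding starS_def mseries_def by (rule has_sum_infsum[OF abs_summable_summable])
qed

lemma norm_starS_le:
  fixes \<kappa> :: "('n::finite) midx \<Rightarrow> 'n midx \<Rightarrow> 'n midx \<Rightarrow> complex"
  assumes "C \<ge> 0" "D \<ge> 1" "R \<ge> 1" "kernel_bound \<kappa> C D"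
    and "decay u (4 * D * R\<^sup>2) M" "decay v (4 * D * R\<^sup>2) N" "norm w \<le> R"
  shows "norm (starS \<kappa> u v w) \<le> C * infsum half_geom (UNIV :: ('n::finite) jix set) * M * N"
proof -
  have "((\<lambda>j. C * M * N * half_geom j) has_sum (C * M * N * infsum half_geom (UNIV :: 'n jix set))) (UNIV :: 'n jix set)"
    by (intro has_sum_cmult_right has_sum_infsum half_geom_summable)
  from norm_infsum_le[OF starS_has_sum[OF assms] this starS_term_le[OF assms]]
  show ?thesis by (simp add: mult_ac)
qed

text \<open>Bilinearity: u'v' - uv = (u' - u)v' + u(v' - v).\<close>

lemma norm_starS_diff_le:
  fixes \<kappa> :: "('n::finite) midx \<Rightarrow> 'n midx \<Rightarrow> 'n midx \<Rightarrow> complex"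
  assumes C: "C \<ge> 0" "D \<ge> 1" "R \<ge> 1" "kernel_bound \<kappa> C D" and w: "norm w \<le> R"
    and d: "decay u (4 * D * R\<^sup>2) M" "decay v (4 * D * R\<^sup>2) N" "decay u' (4 * D * R\<^sup>2) M'" "decay v' (4 * D * R\<^sup>2) N'"
    and e: "decay (\<lambda>x. u' x - u x) (4 * D * R\<^sup>2) e1" "decay (\<lambda>x. v' x - v x) (4 * D * R\<^sup>2) e2"
  shows "norm (starS \<kappa> u' v' w - starS \<kappa> u v w) \<le>
    C * infsum half_geom (UNIV :: ('n::finite) jix set) * (e1 * N' + M * e2)"
proof -
  have e0: "starco \<kappa> u' v' j * hmono (jidx j) w - starco \<kappa> u v j * hmono (jidx j) w =
     starco \<kappa> (\<lambda>x. u' x - u x) v' j * hmono (jidx j) w + starco \<kappa> u (\<lambda>x. v' x - v x) j * hmono (jidx j) w" for j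
    by (cases j) (simp add: starco_def algebra_simps)
  have s1: "((\<lambda>j. starco \<kappa> u' v' j * hmono (jidx j) w - starco \<kappa> u v j * hmono (jidx j) w) has_sum (starS \<kappa> u' v' w - starS \<kappa> u v w)) UNIV"
    using has_sum_add[OF starS_has_sum[OF C d(3,4) w] has_sum_uminusI[OF starS_has_sum[OF C d(1,2) w]]] by simp
  have s2: "((\<lambda>j. starco \<kappa> (\<lambda>x. u' x - u x) v' j * hmono (jidx j) w + starco \<kappa> u (\<lambda>x. v' x - v x) j * hmono (jidx j) w)
     has_sum (starS \<kappa> (\<lambda>x. u' x - u x) v' w + starS \<kappa> u (\<lambda>x. v' x - v x) w)) UNIV"
    by (intro has_sum_add starS_has_sum[OF C e(1) d(4) w] starS_has_sum[OF C d(1) e(2) w])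
  have "starS \<kappa> u' v' w - starS \<kappa> u v w = starS \<kappa> (\<lambda>x. u' x - u x) v' w + starS \<kappa> u (\<lambda>x. v' x - v x) w"
    by (rule has_sum_unique[OF s1[unfolded e0] s2])
  also have "norm \<dots> \<le> C * infsum half_geom (UNIV :: ('n::finite) jix set) * e1 * N'
       + C * infsum half_geom (UNIV :: ('n::finite) jix set) * M * e2"
    by (rule norm_triangle_mono[OF norm_starS_le[OF C e(1) d(4) w] norm_starS_le[OF C d(1) e(2) w]])
  finally show ?thesis by (simp add: algebra_simps)
qed

lemma starS_cong:
  assumes "\<And>P S T. (\<And>i. T i \<le> P i \<and> T i \<le> S i) \<Longrightarrow> \<kappa> P S T = \<kappa>' P S T"
  shows "starS \<kappa> = starS \<kappa>'"
proof -
  have "starco \<kappa> u v j = starco \<kappa>' u v j" for u v j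
    using assms by (cases j) (auto simp: starco_def below_def)
  then have "starco \<kappa> u v = starco \<kappa>' u v" for u v by (rule ext)
  then show ?thesis by (intro ext) (simp add: starS_def)
qed

lemma starS_finite:
  assumes F: "finite F" "\<And>x. x \<notin> F \<Longrightarrow> u x = 0" and G: "finite G" "\<And>x. x \<notin> G \<Longrightarrow> v x = 0"
  shows "starS (kap hb) u v w = (\<Sum>x\<in>F. \<Sum>y\<in>G. u x * v y * shat hb (bidx x) (bidx y) w)"
proof -
  let ?B = "\<lambda>x y. {T. \<forall>i. T i \<le> fst (bidx x) i \<and> T i \<le> snd (bidx y) i}"
  have finB: "finite (?B x y)" for x y :: "'a bix"
    by (rule finite_subset[OF _ finite_midx_box[of "snd (bidx y)"]]) auto
  let ?J = "Sigma F (\<lambda>x. Sigma G (\<lambda>y. ?B x y))"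
  have fin: "finite ?J" using F G finB by auto
  have "starS (kap hb) u v w = (\<Sum>\<^sub>\<infinity>j\<in>?J. starco (kap hb) u v j * hmono (jidx j) w)"
    unfolding starS_def mseries_def
  proof (rule infsum_cong_neutral)
    fix j assume j: "j \<in> UNIV - ?J"
    obtain x y T where xyT: "j = (x, y, T)" by (cases j)
    have "u x = 0 \<or> v y = 0 \<or> \<not> below x y T" using j F(2)[of x] G(2)[of y] by (auto simp: xyT below_def)
    then show "starco (kap hb) u v j * hmono (jidx j) w = 0" by (auto simp: xyT starco_def)
  qed auto
  also have "\<dots> = (\<Sum>j\<in>?J. starco (kap hb) u v j * hmono (jidx j) w)" using fin by simp
  also have "\<dots> = (\<Sum>x\<in>F. \<Sum>j\<in>Sigma G (\<lambda>y. ?B x y). starco (kap hb) u v (x, j) * hmono (jidx (x, j)) w)"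
    using F(1) G(1) finB by (subst sum.Sigma) (auto simp: case_prod_unfold)
  also have "\<dots> = (\<Sum>x\<in>F. \<Sum>y\<in>G. \<Sum>T\<in>?B x y. starco (kap hb) u v (x, y, T) * hmono (jidx (x, y, T)) w)"
    using F(1) G(1) finB by (subst sum.Sigma) (auto simp: case_prod_unfold)
  also have "\<dots> = (\<Sum>x\<in>F. \<Sum>y\<in>G. u x * v y * shat hb (bidx x) (bidx y) w)"
  proof (intro sum.cong refl)
    fix x y
    show "(\<Sum>T\<in>?B x y. starco (kap hb) u v (x, y, T) * hmono (jidx (x, y, T)) w) = u x * v y * shat hb (bidx x) (bidx y) w"
      unfolding shat_def sum_distrib_left
      by (intro sum.cong refl) (auto simp: starco_def jidx_def below_def mult_ac)
  qed
  finally show ?thesis .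
qed

section \<open>Polynomials: the product depends only on the functions\<close>

definition hpoly :: "(('n::finite) hidx \<Rightarrow> complex) \<Rightarrow> 'n hvec \<Rightarrow> complex" where
  "hpoly \<alpha> w = (\<Sum>z\<in>{z. \<alpha> z \<noteq> 0}. \<alpha> z * hmono z w)"

lemma polyA_eq_resZ: "polyA \<alpha> = resZ (hpoly \<alpha>)"
  by (auto simp: fun_eq_iff polyA_def resZ_def hpoly_def mono_def hmono_def)

lemma holo_hatD_hpoly: "admissible \<alpha> \<Longrightarrow> holo_hatD (hpoly \<alpha>)"
  unfolding hpoly_def[abs_def] admissible_def by (intro holo_hatD_sum_hmono) auto

lemma hpoly_normal_form:
  assumes "admissible \<alpha>"
  obtains F where "finite F" "\<And>x. x \<notin> F \<Longrightarrow> bcoeff (hpoly \<alpha>) x = 0"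
    "\<And>\<Phi>. respects_hatZ \<Phi> \<Longrightarrow> (\<Sum>z\<in>{z. \<alpha> z \<noteq> 0}. \<alpha> z * \<Phi> z) = (\<Sum>x\<in>F. bcoeff (hpoly \<alpha>) x * \<Phi> (bidx x))"
proof -
  let ?A = "{z. \<alpha> z \<noteq> 0}"
  have fin: "finite ?A" and adm: "\<And>z. z \<in> ?A \<Longrightarrow> msum (fst z) = msum (snd z)"
    using assms by (auto simp: admissible_def)
  have bc: "bcoeff (hpoly \<alpha>) x = (\<Sum>z\<in>?A. \<alpha> z * bcoeff (hmono z) x)" for x
    unfolding hpoly_def[abs_def] using adm by (intro bcoeff_sum hmono_holo_hatD)
  have "\<forall>z\<in>?A. \<exists>F. finite F \<and> (\<forall>x. x \<notin> F \<longrightarrow> bcoeff (hmono z) x = 0) \<and>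
     (\<forall>\<Phi>. respects_hatZ \<Phi> \<longrightarrow> \<Phi> z = (\<Sum>x\<in>F. bcoeff (hmono z) x * \<Phi> (bidx x)))"
    using normal_form adm by blast
  from bchoice[OF this] obtain F where F: "\<And>z. z \<in> ?A \<Longrightarrow> finite (F z)" "\<And>z x. z \<in> ?A \<Longrightarrow> x \<notin> F z \<Longrightarrow> bcoeff (hmono z) x = 0"
     "\<And>z \<Phi>. z \<in> ?A \<Longrightarrow> respects_hatZ \<Phi> \<Longrightarrow> \<Phi> z = (\<Sum>x\<in>F z. bcoeff (hmono z) x * \<Phi> (bidx x))" by blast
  let ?F = "\<Union>z\<in>?A. F z"
  have finF: "finite ?F" using fin F(1) by blast
  show ?thesis
  proof (rule that[of ?F, OF finF])
    show "bcoeff (hpoly \<alpha>) x = 0" if "x \<notin> ?F" for x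
      unfolding bc
    proof (rule sum.neutral, rule ballI)
      fix z assume "z \<in> ?A"
      then have "bcoeff (hmono z) x = 0" using that by (intro F(2)) blast+
      then show "\<alpha> z * bcoeff (hmono z) x = 0" by simp
    qed
    fix \<Phi> :: "'a hidx \<Rightarrow> complex" assume \<Phi>: "respects_hatZ \<Phi>"
    have "\<Phi> z = (\<Sum>x\<in>?F. bcoeff (hmono z) x * \<Phi> (bidx x))" if z: "z \<in> ?A" for z
      unfolding F(3)[OF z \<Phi>]
    proof (rule sum.mono_neutral_left[OF finF])
      show "F z \<subseteq> ?F" using z by blast
      show "\<forall>x\<in>?F - F z. bcoeff (hmono z) x * \<Phi> (bidx x) = 0" using F(2)[OF z] by simp
    qed
    then have "(\<Sum>z\<in>?A. \<alpha> z * \<Phi> z) = (\<Sum>z\<in>?A. \<Sum>x\<in>?F. \<alpha> z * bcoeff (hmono z) x * \<Phi> (bidx x))"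
      by (intro sum.cong refl) (simp only: sum_distrib_left mult.assoc)
    also have "\<dots> = (\<Sum>x\<in>?F. \<Sum>z\<in>?A. \<alpha> z * bcoeff (hmono z) x * \<Phi> (bidx x))" by (rule sum.swap)
    also have "\<dots> = (\<Sum>x\<in>?F. bcoeff (hpoly \<alpha>) x * \<Phi> (bidx x))" unfolding bc sum_distrib_right ..
    finally show "(\<Sum>z\<in>?A. \<alpha> z * \<Phi> z) = (\<Sum>x\<in>?F. bcoeff (hpoly \<alpha>) x * \<Phi> (bidx x))" .
  qed
qed

text \<open>The normal form is applied to the left factor, with \<Phi> the product with all of
  \<beta>, and to the right factor with a basis monomial fixed on the left. The result mentions
  \<alpha> and \<beta> only through \<open>hpoly \<alpha>\<close> and
  \<open>hpoly \<beta>\<close>.\<close>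

lemma starP_eq_starS:
  assumes \<alpha>: "admissible \<alpha>" and \<beta>: "admissible \<beta>" and z: "\<And>k. 1 / (2 * hb) + of_nat k \<noteq> (0::complex)"
  shows "starP hb \<alpha> \<beta> = resZ (starS (kap hb) (bcoeff (hpoly \<alpha>)) (bcoeff (hpoly \<beta>)))"
proof -
  obtain F where F: "finite F" "\<And>x. x \<notin> F \<Longrightarrow> bcoeff (hpoly \<alpha>) x = 0"
    "\<And>\<Phi>. respects_hatZ \<Phi> \<Longrightarrow> (\<Sum>z\<in>{z. \<alpha> z \<noteq> 0}. \<alpha> z * \<Phi> z) = (\<Sum>x\<in>F. bcoeff (hpoly \<alpha>) x * \<Phi> (bidx x))"
    using hpoly_normal_form[OF \<alpha>] by blast
  obtain G where G: "finite G" "\<And>x. x \<notin> G \<Longrightarrow> bcoeff (hpoly \<beta>) x = 0"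
    "\<And>\<Phi>. respects_hatZ \<Phi> \<Longrightarrow> (\<Sum>z\<in>{z. \<beta> z \<noteq> 0}. \<beta> z * \<Phi> z) = (\<Sum>x\<in>G. bcoeff (hpoly \<beta>) x * \<Phi> (bidx x))"
    using hpoly_normal_form[OF \<beta>] by blast
  have main: "(\<Sum>x\<in>{x. \<alpha> x \<noteq> 0}. \<Sum>y\<in>{y. \<beta> y \<noteq> 0}. \<alpha> x * \<beta> y * shat hb x y w) =
      starS (kap hb) (bcoeff (hpoly \<alpha>)) (bcoeff (hpoly \<beta>)) w" if w: "w \<in> hatZ" for w
  proof -
    have r1: "respects_hatZ (\<lambda>x. \<Sum>y\<in>{y. \<beta> y \<noteq> 0}. \<beta> y * shat hb x y w)"
      unfolding respects_hatZ_def
    proof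
      fix v
      have "(\<Sum>\<mu>\<in>UNIV. sgn0 \<mu> * (\<Sum>y\<in>{y. \<beta> y \<noteq> 0}. \<beta> y * shat hb (inc v \<mu>) y w)) =
         (\<Sum>y\<in>{y. \<beta> y \<noteq> 0}. \<Sum>\<mu>\<in>UNIV. sgn0 \<mu> * (\<beta> y * shat hb (inc v \<mu>) y w))"
        unfolding sum_distrib_left by (rule sum.swap)
      also have "\<dots> = (\<Sum>y\<in>{y. \<beta> y \<noteq> 0}. \<beta> y * (\<Sum>\<mu>\<in>UNIV. sgn0 \<mu> * shat hb (inc v \<mu>) y w))"
        unfolding sum_distrib_left by (simp only: mult_ac)
      finally show "(\<Sum>y\<in>{y. \<beta> y \<noteq> 0}. \<beta> y * shat hb v y w) =
        (\<Sum>\<mu>\<in>UNIV. sgn0 \<mu> * (\<Sum>y\<in>{y. \<beta> y \<noteq> 0}. \<beta> y * shat hb (inc v \<mu>) y w))"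
        unfolding shat_relation[OF w z] by simp
    qed
    have r2: "respects_hatZ (\<lambda>y. shat hb x y w)" for x
      unfolding respects_hatZ_def using shat_relation_right[OF w z] by simp
    have "(\<Sum>x\<in>{x. \<alpha> x \<noteq> 0}. \<Sum>y\<in>{y. \<beta> y \<noteq> 0}. \<alpha> x * \<beta> y * shat hb x y w) =
       (\<Sum>x\<in>{x. \<alpha> x \<noteq> 0}. \<alpha> x * (\<Sum>y\<in>{y. \<beta> y \<noteq> 0}. \<beta> y * shat hb x y w))"
      by (simp only: sum_distrib_left mult.assoc)
    also have "\<dots> = (\<Sum>x\<in>F. bcoeff (hpoly \<alpha>) x * (\<Sum>y\<in>{y. \<beta> y \<noteq> 0}. \<beta> y * shat hb (bidx x) y w))"
      by (rule F(3)[OF r1])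
    also have "\<dots> = (\<Sum>x\<in>F. bcoeff (hpoly \<alpha>) x * (\<Sum>y\<in>G. bcoeff (hpoly \<beta>) y * shat hb (bidx x) (bidx y) w))"
      using G(3)[OF r2] by simp
    also have "\<dots> = starS (kap hb) (bcoeff (hpoly \<alpha>)) (bcoeff (hpoly \<beta>)) w"
      using starS_finite[of F "bcoeff (hpoly \<alpha>)" G "bcoeff (hpoly \<beta>)", OF F(1,2) G(1,2)] by (simp add: sum_distrib_left mult.assoc)
    finally show ?thesis .
  qed
  show ?thesis
    by (rule ext) (simp add: starP_def resZ_def star_mono_eq_shat main ZZ_hatZ)
qed

section \<open>Holomorphic dependence on the deformation parameter\<close>

text \<open>The excluded value -1/(2m) is the zero of the Pochhammer factor 1/(2t) + m; the factor
  with k = 0 has no zero at \<open>t \<noteq> 0\<close>.\<close>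

lemma Hset_iff: "t \<in> Hset \<longleftrightarrow> t \<noteq> 0 \<and> (\<forall>k. 1 / (2 * t) + of_nat k \<noteq> 0)"
proof (cases "t = 0")
  case False
  have eq: "1 / (2 * t) + of_nat k = 0 \<longleftrightarrow> t = - 1 / (2 * of_nat k)" if "k \<ge> 1" for k
  proof -
    have "1 / (2 * t) + of_nat k = (1 + t * (2 * of_nat k)) / (2 * t)" using False by (simp add: field_simps)
    moreover have "t = - 1 / (2 * of_nat k) \<longleftrightarrow> t * (2 * of_nat k) = - 1" using that by (subst eq_divide_eq) auto
    ultimately show ?thesis using False add_eq_0_iff[of 1 "t * (2 * of_nat k)"] by (simp only: divide_eq_0_iff mult_eq_0_iff) auto
  qed
  have "1 / (2 * t) + of_nat 0 \<noteq> 0" using False by simp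
  then have "(\<forall>k. 1 / (2 * t) + of_nat k \<noteq> 0) \<longleftrightarrow> (\<forall>k\<ge>1. 1 / (2 * t) + of_nat k \<noteq> 0)"
    by (metis less_one not_le)
  then show ?thesis using False eq by (auto simp: Hset_def)
qed (simp add: Hset_def)

lemma Hset_local:
  assumes "t0 \<in> Hset"
  shows "\<exists>r>0. ball t0 r \<subseteq> Hset \<and>
    (\<exists>D\<ge>1. \<forall>t\<in>ball t0 r. kernel_bound (krn {} t :: ('n::finite) midx \<Rightarrow> _) 1 D)"
proof -
  have nz: "\<And>k. 1 / (2 * t0) + of_nat k \<noteq> 0" and t00: "t0 \<noteq> 0" using assms unfolding Hset_iff by auto
  obtain r \<delta> M where r: "r > 0" "\<delta> > 0" "M \<ge> 1" "\<delta> \<le> 1" "\<And>t. t \<in> ball t0 r \<Longrightarrow> t \<noteq> 0 \<and> norm (1 / (2 * t)) \<le> M \<and>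
     (\<forall>k. 1 / (2 * t0) + of_nat k \<noteq> 0 \<longrightarrow> \<delta> * (real k + 1) \<le> norm (1 / (2 * t) + of_nat k))"
    using half_inverse_local[OF t00] by blast
  have lower: "\<delta> * (real k + 1) \<le> norm (1 / (2 * t) + of_nat k)" if "t \<in> ball t0 r" for t k
    using r(5)[OF that] nz by blast
  have "t \<in> Hset" if t: "t \<in> ball t0 r" for t
    unfolding Hset_iff
  proof (intro conjI allI)
    fix k
    have "0 < \<delta> * (real k + 1)" using r(2) by (intro mult_pos_pos) auto
    also note lower[OF t, of k]
    finally show "1 / (2 * t) + of_nat k \<noteq> 0" by auto
  qed (use r(5)[OF t] in blast)
  moreover have "kernel_bound (krn {} t :: 'n midx \<Rightarrow> _) 1 (4 * M / \<delta>)" if t: "t \<in> ball t0 r" for t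
  proof -
    have M: "norm (1 / (2 * t)) \<le> M" using r(5)[OF t] by blast
    have "norm (krn {} t P S T) \<le> (real 0 + 1) * (4 * M / \<delta>) ^ (msum P + msum S)"
      if "\<forall>i. T i \<le> P i \<and> T i \<le> S i" for P S T :: "'n midx"
      by (rule norm_krn_le[OF M r(3,2,4) lower[OF t]]) (use that in auto)
    then show ?thesis by (simp add: kernel_bound_def)
  qed
  moreover have "4 * M / \<delta> \<ge> 1" using r by (simp add: le_divide_eq)
  ultimately show ?thesis using r(1) by blast
qed

lemma open_Hset: "open Hset"
proof (rule openI)
  fix t0 assume "t0 \<in> Hset"
  from Hset_local[OF this] show "\<exists>e>0. ball t0 e \<subseteq> Hset" by blast
qed

lemma starS_kap_eq_krn:
  assumes "t \<in> Hset"
  shows "starS (kap t :: ('n::finite) midx \<Rightarrow> _) = starS (krn {} t)"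
  by (rule starS_cong, rule kap_eq_krn) (use assms in \<open>auto simp: Hset_iff\<close>)

lemma decay_bcoeff:
  assumes "holo_hatD h" "\<rho> > 0"
  shows "\<exists>M\<ge>0. decay (bcoeff h) \<rho> M"
  using bcoeff_decay[OF assms] by (auto simp: decay_def)

lemma holo_hatD_starS:
  assumes "kernel_bound \<kappa> C D" "C \<ge> 0" "D \<ge> 1" "holo_hatD f" "holo_hatD g"
  shows "holo_hatD (starS \<kappa> (bcoeff f) (bcoeff g))"
  unfolding starS_def
proof (rule mseries_holo_hatD[OF mbounded_starbd[OF assms(2,3)] norm_starco_le[OF assms(1)]])
  fix \<rho> :: real assume "\<rho> \<ge> 1"
  then show "\<exists>M. decay (bcoeff f) \<rho> M" "\<exists>M. decay (bcoeff g) \<rho> M"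
    using decay_bcoeff[OF assms(4), of \<rho>] decay_bcoeff[OF assms(5), of \<rho>] by auto
qed

lemma hatA_resZ_on: "holo_hatD h \<Longrightarrow> w \<in> hatZ \<Longrightarrow> hatA (resZ h) w = h w"
  by (simp add: hatA_resZ)

section \<open>Continuity, density and the extended product\<close>

text \<open>Uniform convergence on the single compact set \<open>gauge_compact \<rho>\<close>
  already makes all coordinates converge in the norm weighted by \<rho>.\<close>

lemma convA_decay:
  assumes s: "\<And>k. holo_hatD (h k)" and a: "holo_hatD g" and conv: "convA (\<lambda>k. resZ (h k)) (resZ g)" and "\<rho> > 0" "e > 0"
  shows "\<forall>\<^sub>F k in sequentially. decay (\<lambda>x. bcoeff (h k) x - bcoeff g x) \<rho> e"
proof -
  have "uniform_limit (gauge_compact \<rho>) (\<lambda>k. hatA (resZ (h k))) (hatA (resZ g)) sequentially"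
    using conv gauge_compact unfolding convA_def by blast
  then have "\<forall>\<^sub>F k in sequentially. \<forall>w\<in>gauge_compact \<rho>. dist (hatA (resZ (h k)) w) (hatA (resZ g) w) < e"
    using \<open>e > 0\<close> unfolding uniform_limit_iff by blast
  then show ?thesis
  proof eventually_elim
    case (elim k)
    have "norm (bcoeff (\<lambda>w. h k w - g w) x) \<le> e / \<rho> ^ sum x UNIV" for x
    proof (rule norm_bcoeff_le[OF holo_hatD_diff[OF s a] \<open>\<rho> > 0\<close>])
      fix w :: "'a hvec" assume w: "w \<in> gauge_compact \<rho>"
      then have "w \<in> hatZ" using gauge_compact(2) by blast
      then show "norm (h k w - g w) \<le> e" using elim w by (auto simp: hatA_resZ_on s a dist_norm intro: less_imp_le)
    qed
    then show ?case by (simp add: decay_def bcoeff_diff[OF s a])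
  qed
qed

lemma starS_continuous:
  fixes \<kappa> :: "('n::finite) midx \<Rightarrow> 'n midx \<Rightarrow> 'n midx \<Rightarrow> complex"
  assumes k: "kernel_bound \<kappa> C D" "C \<ge> 0" "D \<ge> 1"
    and f: "\<And>k. holo_hatD (f k)" "holo_hatD f0" "convA (\<lambda>k. resZ (f k)) (resZ f0)"
    and g: "\<And>k. holo_hatD (g k)" "holo_hatD g0" "convA (\<lambda>k. resZ (g k)) (resZ g0)"
  shows "convA (\<lambda>k. resZ (starS \<kappa> (bcoeff (f k)) (bcoeff (g k)))) (resZ (starS \<kappa> (bcoeff f0) (bcoeff g0)))"
  unfolding convA_def
proof (intro allI impI, elim conjE)
  let ?S = "\<lambda>k. starS \<kappa> (bcoeff (f k)) (bcoeff (g k))" and ?T = "starS \<kappa> (bcoeff f0) (bcoeff g0)"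
  fix K :: "'n hvec set" assume K: "compact K" "K \<subseteq> hatZ"
  obtain R where R: "R \<ge> 1" "\<And>w. w \<in> K \<Longrightarrow> norm w \<le> R" using compact_norm_bound[OF K(1)] by blast
  let ?\<rho> = "4 * D * R\<^sup>2"
  have \<rho>: "?\<rho> > 0" using k R by auto
  obtain M where M: "M \<ge> 0" "decay (bcoeff f0) ?\<rho> M" using decay_bcoeff[OF f(2) \<rho>] by blast
  obtain N where N: "N \<ge> 0" "decay (bcoeff g0) ?\<rho> N" using decay_bcoeff[OF g(2) \<rho>] by blast
  define A where "A = C * infsum half_geom (UNIV :: 'n jix set)"
  have A: "A \<ge> 0" unfolding A_def using k(2) by (intro mult_nonneg_nonneg infsum_nonneg) (auto simp: half_geom_def)
  show "uniform_limit K (\<lambda>k. hatA (resZ (?S k))) (hatA (resZ ?T)) sequentially"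
    unfolding uniform_limit_iff
  proof (intro allI impI)
    fix e :: real assume e: "e > 0"
    \<comment> \<open>The bound 1 makes \<open>N + 1\<close> a decay constant for the perturbed
      \<open>g i\<close>; the other bound keeps the final estimate below e/2.\<close>
    define \<eta> where "\<eta> = min 1 (e / (2 * (A + 1) * (N + 1 + M + 1)))"
    have \<eta>: "\<eta> > 0" "\<eta> \<le> 1" using e A M N by (auto simp: \<eta>_def)
    show "\<forall>\<^sub>F k in sequentially. \<forall>w\<in>K. dist (hatA (resZ (?S k)) w)
        (hatA (resZ ?T) w) < e"
      using convA_decay[OF f \<rho> \<eta>(1)] convA_decay[OF g \<rho> \<eta>(1)]
    proof eventually_elim
      case (elim i)
      obtain M' where M': "decay (bcoeff (f i)) ?\<rho> M'" using decay_bcoeff[OF f(1) \<rho>] by blast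
      have N': "decay (bcoeff (g i)) ?\<rho> (N + 1)"
        unfolding decay_def
      proof
        fix x
        have "norm (bcoeff (g i) x) \<le> norm (bcoeff g0 x) + norm (bcoeff (g i) x - bcoeff g0 x)"
          by (rule norm_triangle_sub)
        also have "\<dots> \<le> N / ?\<rho> ^ sum x UNIV + \<eta> / ?\<rho> ^ sum x UNIV"
          using N(2) elim(2) unfolding decay_def by (intro add_mono) auto
        also have "\<dots> \<le> N / ?\<rho> ^ sum x UNIV + 1 / ?\<rho> ^ sum x UNIV"
          using \<eta> \<rho> by (intro add_left_mono divide_right_mono) auto
        finally show "norm (bcoeff (g i) x) \<le> (N + 1) / ?\<rho> ^ sum x UNIV" by (simp add: add_divide_distrib)
      qed
      show ?case
      proof
        fix w assume w: "w \<in> K"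
        have "norm (?S i w - ?T w) \<le> A * (\<eta> * (N + 1) + M * \<eta>)"
          unfolding A_def
          by (rule norm_starS_diff_le[OF k(2,3) R(1) k(1) R(2)[OF w] M(2) N(2) M' N' elim])
        also have "\<dots> \<le> (A + 1) * (\<eta> * (N + 1 + M + 1))"
          using A M N \<eta> by (intro mult_mono) (auto simp: algebra_simps)
        also have "\<dots> = \<eta> * ((A + 1) * (N + 1 + M + 1))" by (simp only: mult_ac)
        also have "\<dots> \<le> (e / (2 * (A + 1) * (N + 1 + M + 1))) * ((A + 1) * (N + 1 + M + 1))"
          using A M N by (intro mult_right_mono) (auto simp: \<eta>_def)
        also have "\<dots> = e / 2"
        proof -
          have "A + 1 \<noteq> 0" "N + 1 + M + 1 \<noteq> 0" using A M N by linarith+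
          then show ?thesis by (simp add: divide_simps)
        qed
        also have "\<dots> < e" using e by simp
        finally show "dist (hatA (resZ (?S i)) w) (hatA (resZ ?T) w) < e"
          unfolding dist_norm using subsetD[OF K(2) w]
          by (simp only: hatA_resZ_on[OF holo_hatD_starS[OF k f(1) g(1)]] hatA_resZ_on[OF holo_hatD_starS[OF k f(2) g(2)]])
      qed
    qed
  qed
qed

text \<open>The k-th polynomial is a finite piece of the monomial expansion with error below 1/(k+1)
  on the ball of radius k+1; every compact set lies in these balls eventually.\<close>

lemma polyA_dense:
  fixes h :: "('n::finite) hvec \<Rightarrow> complex"
  assumes h: "holo_hatD h"
  shows "\<exists>\<alpha>. (\<forall>k. admissible (\<alpha> k)) \<and> convA (\<lambda>k. polyA (\<alpha> k)) (resZ h)"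
proof -
  let ?u = "bcoeff h"
  have "\<exists>F. finite F \<and> (\<forall>w. norm w \<le> real k + 1 \<longrightarrow> norm (mseries ?u bidx w - (\<Sum>x\<in>F. ?u x * hmono (bidx x) w)) < 1 / (real k + 1))" for k
  proof -
    have "\<forall>\<^sub>F F in finite_subsets_at_top UNIV. finite F \<and> (\<forall>w. norm w \<le> real k + 1 \<longrightarrow>
      norm (mseries ?u bidx w - (\<Sum>x\<in>F. ?u x * hmono (bidx x) w)) < 1 / (real k + 1))"
      by (intro eventually_conj mseries_tail[OF mbounded_bcoeff[OF h] order_refl])
         (auto simp: eventually_finite_subsets_at_top)
    from eventually_happens'[OF _ this] show ?thesis by (simp add: finite_subsets_at_top_neq_bot)
  qed
  then have "\<forall>k. \<exists>F. finite F \<and> (\<forall>w. norm w \<le> real k + 1 \<longrightarrow> norm (mseries ?u bidx w - (\<Sum>x\<in>F. ?u x * hmono (bidx x) w)) < 1 / (real k + 1))"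
    by (rule allI)
  from choice[OF this] obtain F where F: "\<And>k. finite (F k)" "\<And>k w. norm w \<le> real k + 1 \<Longrightarrow>
      norm (mseries ?u bidx w - (\<Sum>x\<in>F k. ?u x * hmono (bidx x) w)) < 1 / (real k + 1)"
    by blast
  define \<alpha> where "\<alpha> k z = (if z \<in> bidx ` F k then ?u (inv bidx z) else 0)" for k z
  have supp: "{z. \<alpha> k z \<noteq> 0} \<subseteq> bidx ` F k" for k by (auto simp: \<alpha>_def)
  have adm: "admissible (\<alpha> k)" for k
    unfolding admissible_def
  proof (intro conjI allI impI)
    show "finite {z. \<alpha> k z \<noteq> 0}" by (rule finite_subset[OF supp finite_imageI[OF F(1)]])
    fix z assume "\<alpha> k z \<noteq> 0"
    then obtain x where "z = bidx x" using supp by blast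
    then show "msum (fst z) = msum (snd z)" by (simp add: msum_bidx)
  qed
  have hp: "hpoly (\<alpha> k) w = (\<Sum>x\<in>F k. ?u x * hmono (bidx x) w)" for k w
  proof -
    have "hpoly (\<alpha> k) w = (\<Sum>z\<in>bidx ` F k. \<alpha> k z * hmono z w)"
      unfolding hpoly_def by (rule sum.mono_neutral_left) (use supp F(1) in auto)
    also have "\<dots> = (\<Sum>x\<in>F k. \<alpha> k (bidx x) * hmono (bidx x) w)"
      by (rule sum.reindex_cong[OF inj_on_subset[OF inj_bidx]]) auto
    also have "\<dots> = (\<Sum>x\<in>F k. ?u x * hmono (bidx x) w)"
      by (intro sum.cong) (auto simp: \<alpha>_def inv_f_f[OF inj_bidx])
    finally show ?thesis .
  qed
  have "convA (\<lambda>k. polyA (\<alpha> k)) (resZ h)"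
    unfolding convA_def
  proof (intro allI impI, elim conjE)
    fix K :: "'n hvec set" assume K: "compact K" "K \<subseteq> hatZ"
    obtain R where R: "R \<ge> 1" "\<And>w. w \<in> K \<Longrightarrow> norm w \<le> R" using compact_norm_bound[OF K(1)] by blast
    show "uniform_limit K (\<lambda>k. hatA (polyA (\<alpha> k))) (hatA (resZ h)) sequentially"
      unfolding uniform_limit_iff
    proof (intro allI impI)
      fix e :: real assume e: "e > 0"
      have "\<forall>\<^sub>F k in sequentially. R \<le> real k" by (rule eventually_sequentiallyI[of "nat \<lceil>R\<rceil>"]) linarith
      moreover have "\<forall>\<^sub>F k in sequentially. 1 / e \<le> real k" by (rule eventually_sequentiallyI[of "nat \<lceil>1 / e\<rceil>"]) linarith
      ultimately show "\<forall>\<^sub>F k in sequentially. \<forall>w\<in>K. dist (hatA (polyA (\<alpha> k)) w) (hatA (resZ h) w) < e"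
      proof eventually_elim
        case (elim k)
        show ?case
        proof
          fix w assume w: "w \<in> K"
          then have wZ: "w \<in> hatZ" using K by auto
          have "dist (hatA (polyA (\<alpha> k)) w) (hatA (resZ h) w) = norm (mseries ?u bidx w - (\<Sum>x\<in>F k. ?u x * hmono (bidx x) w))"
            by (simp add: polyA_eq_resZ hatA_resZ_on holo_hatD_hpoly adm h wZ hp dist_norm norm_minus_commute
                holo_hatD_expansion[OF h wZ, symmetric])
          also have "\<dots> < 1 / (real k + 1)" using R(2)[OF w] elim(1) by (intro F(2)) auto
          also have "\<dots> \<le> e"
          proof -
            have "1 / e \<le> real k + 1" using elim(2) by linarith
            then show ?thesis using e by (simp add: divide_le_eq mult.commute)
          qed
          finally show "dist (hatA (polyA (\<alpha> k)) w) (hatA (resZ h) w) < e" .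
        qed
      qed
    qed
  qed
  then show ?thesis using adm by blast
qed

lemma convA_unique:
  assumes "convA s c" "convA s c'" "c \<in> AD" "c' \<in> AD"
  shows "c = c'"
proof -
  have "hatA c w = hatA c' w" if "w \<in> hatZ" for w
  proof -
    have "compact {w}" "{w} \<subseteq> hatZ" using that by auto
    then have "uniform_limit {w} (\<lambda>k. hatA (s k)) (hatA c) sequentially" "uniform_limit {w} (\<lambda>k. hatA (s k)) (hatA c') sequentially"
      using assms(1,2) unfolding convA_def by blast+
    then have "(\<lambda>k. hatA (s k) w) \<longlonglongrightarrow> hatA c w" "(\<lambda>k. hatA (s k) w) \<longlonglongrightarrow> hatA c' w"
      by (auto intro: tendsto_uniform_limitI)
    then show ?thesis by (rule LIMSEQ_unique)
  qed
  then have "resZ (hatA c) = resZ (hatA c')" by (auto simp: resZ_def ZZ_hatZ)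
  then show ?thesis using holo_hatD_hatA(2) assms(3,4) by metis
qed

text \<open>Continuity shows that the series fits the description in \<open>starA\<close>.
  Uniqueness needs density: only because polynomial sequences converging to both factors exist does
  the condition determine the limit.\<close>

lemma starA_eq_starS:
  fixes f g :: "('n::finite) hvec \<Rightarrow> complex"
  assumes hb: "hb \<in> Hset" and f: "holo_hatD f" and g: "holo_hatD g"
  shows "starA hb (resZ f) (resZ g) = resZ (starS (kap hb) (bcoeff f) (bcoeff g))"
proof -
  have nz: "\<And>k. 1 / (2 * hb) + of_nat k \<noteq> 0" using hb unfolding Hset_iff by auto
  obtain D where D: "D \<ge> 1" "kernel_bound (krn {} hb :: 'n midx \<Rightarrow> _) 1 D"
    using Hset_local[OF hb] centre_in_ball by blast
  note kk = starS_kap_eq_krn[OF hb, where 'n='n]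
  let ?c = "resZ (starS (kap hb) (bcoeff f) (bcoeff g))"
  have cAD: "?c \<in> AD" unfolding kk by (rule resZ_in_AD[OF holo_hatD_starS[OF D(2) _ D(1) f g]]) simp
  have conv: "convA (\<lambda>k. starP hb (\<alpha> k) (\<beta> k)) ?c"
    if "\<And>k. admissible (\<alpha> k)" "\<And>k. admissible (\<beta> k)" "convA (\<lambda>k. polyA (\<alpha> k)) (resZ f)" "convA (\<lambda>k. polyA (\<beta> k)) (resZ g)" for \<alpha> \<beta>
    unfolding starP_eq_starS[OF that(1,2) nz] kk
    by (rule starS_continuous[OF D(2) _ D(1) holo_hatD_hpoly[OF that(1)] f _ holo_hatD_hpoly[OF that(2)] g])
       (use that(3,4) in \<open>simp_all add: polyA_eq_resZ\<close>)
  show ?thesis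
    unfolding starA_def
  proof (rule the_equality)
    show "?c \<in> AD \<and> (\<forall>\<alpha> \<beta>. (\<forall>k. admissible (\<alpha> k) \<and> admissible (\<beta> k)) \<and>
        convA (\<lambda>k. polyA (\<alpha> k)) (resZ f) \<and> convA (\<lambda>k. polyA (\<beta> k)) (resZ g) \<longrightarrow>
        convA (\<lambda>k. starP hb (\<alpha> k) (\<beta> k)) ?c)"
      using cAD conv by blast
    fix c assume c: "c \<in> AD \<and> (\<forall>\<alpha> \<beta>. (\<forall>k. admissible (\<alpha> k) \<and> admissible (\<beta> k)) \<and>
        convA (\<lambda>k. polyA (\<alpha> k)) (resZ f) \<and> convA (\<lambda>k. polyA (\<beta> k)) (resZ g) \<longrightarrow>
        convA (\<lambda>k. starP hb (\<alpha> k) (\<beta> k)) c)"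
    obtain \<alpha> where \<alpha>: "\<And>k. admissible (\<alpha> k)" "convA (\<lambda>k. polyA (\<alpha> k)) (resZ f)" using polyA_dense[OF f] by blast
    obtain \<beta> where \<beta>: "\<And>k. admissible (\<beta> k)" "convA (\<lambda>k. polyA (\<beta> k)) (resZ g)" using polyA_dense[OF g] by blast
    show "c = ?c"
      by (rule convA_unique[of "\<lambda>k. starP hb (\<alpha> k) (\<beta> k)"]) (use c \<alpha> \<beta> conv cAD in blast)+
  qed
qed

lemma holoA_cong:
  assumes "holoA U G" "\<And>t. t \<in> U \<Longrightarrow> F t = G t"
  shows "holoA U F"
  unfolding holoA_def
proof (intro conjI ballI)
  show U: "open U" using assms(1) by (simp add: holoA_def)
  show "F t \<in> AD" if "t \<in> U" for t using assms that by (simp add: holoA_def)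
  fix t0 assume t0: "t0 \<in> U"
  then obtain D where D: "D \<in> AD" "\<And>K. compact K \<and> K \<subseteq> hatZ \<Longrightarrow>
        uniform_limit K (\<lambda>t w. (hatA (G t) w - hatA (G t0) w) / (t - t0)) (hatA D) (at t0)"
    using assms(1) unfolding holoA_def by blast
  have ev: "\<forall>\<^sub>F t in at t0. t \<in> U" using U t0 by (rule eventually_at_in_open')
  show "\<exists>D\<in>AD. \<forall>K. compact K \<and> K \<subseteq> hatZ \<longrightarrow>
        uniform_limit K (\<lambda>t w. (hatA (F t) w - hatA (F t0) w) / (t - t0)) (hatA D) (at t0)"
  proof (intro bexI[of _ D] allI impI D(1))
    fix K :: "'a hvec set" assume "compact K \<and> K \<subseteq> hatZ"
    from D(2)[OF this]
    show "uniform_limit K (\<lambda>t w. (hatA (F t) w - hatA (F t0) w) / (t - t0)) (hatA D) (at t0)"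
    proof (rule uniform_limit_cong[THEN iffD1, rotated -1])
      show "\<forall>\<^sub>F t in at t0. \<forall>w\<in>K. (hatA (G t) w - hatA (G t0) w) / (t - t0) = (hatA (F t) w - hatA (F t0) w) / (t - t0)"
        using ev by eventually_elim (simp add: assms(2) t0)
    qed simp
  qed
qed

section \<open>Holomorphy on \<open>Hset\<close> and the poles\<close>

lemma krn_holomorphic:
  assumes "\<And>t. t \<in> U \<Longrightarrow> t \<noteq> 0" "\<And>t k. t \<in> U \<Longrightarrow> k \<notin> E \<Longrightarrow> 1 / (2 * t) + of_nat k \<noteq> 0"
  shows "(\<lambda>t. krn E t P S T) holomorphic_on U"
  unfolding krn_def prat_def using assms by (intro holomorphic_intros) auto

lemma starco_holomorphic:
  assumes "\<And>P S T. (\<lambda>t. \<kappa> t P S T) holomorphic_on U"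
  shows "(\<lambda>t. starco (\<kappa> t) u v j) holomorphic_on U"
proof (cases j)
  case (fields x y T)
  show ?thesis by (cases "below x y T") (auto simp: fields starco_def intro!: holomorphic_intros assms)
qed

text \<open>Serves both claims: with \<open>krn {}\<close> on \<open>Hset\<close>, and with the
  rescaled kernel on a ball around a pole.\<close>

lemma holoA_starS:
  fixes \<kappa> :: "complex \<Rightarrow> ('n::finite) midx \<Rightarrow> 'n midx \<Rightarrow> 'n midx \<Rightarrow> complex"
  assumes U: "open U" and hol: "\<And>P S T. (\<lambda>t. \<kappa> t P S T) holomorphic_on U"
    and bd: "\<And>t0. t0 \<in> U \<Longrightarrow> \<exists>r>0. ball t0 r \<subseteq> U \<and> (\<exists>C\<ge>0. \<exists>D\<ge>1. \<forall>t\<in>ball t0 r. kernel_bound (\<kappa> t) C D)"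
    and f: "holo_hatD f" and g: "holo_hatD g"
  shows "holoA U (\<lambda>t. resZ (starS (\<kappa> t) (bcoeff f) (bcoeff g)))"
  unfolding starS_def
proof (rule holoA_mseries[OF U starco_holomorphic[OF hol]])
  fix t0 assume "t0 \<in> U"
  then obtain r C D where r: "r > 0" "ball t0 r \<subseteq> U" "C \<ge> 0" "D \<ge> 1" "\<And>t. t \<in> ball t0 r \<Longrightarrow> kernel_bound (\<kappa> t) C D"
    using bd by blast
  have "mbounded (starbd C D (bcoeff f) (bcoeff g)) jidx"
  proof (rule mbounded_starbd[OF r(3,4)])
    fix \<rho> :: real assume "\<rho> \<ge> 1"
    then show "\<exists>M. decay (bcoeff f) \<rho> M" "\<exists>M. decay (bcoeff g) \<rho> M"
      using decay_bcoeff[OF f, of \<rho>] decay_bcoeff[OF g, of \<rho>] by auto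
  qed
  then show "\<exists>r>0. ball t0 r \<subseteq> U \<and> (\<exists>B. mbounded B jidx \<and> (\<forall>j. \<forall>s\<in>ball t0 r. norm (starco (\<kappa> s) (bcoeff f) (bcoeff g) j) \<le> B j))"
    using r(1,2) norm_starco_le[OF r(5)] by blast
qed

lemma holoA_star_regular:
  assumes f: "holo_hatD f" and g: "holo_hatD g"
  shows "holoA Hset (\<lambda>hb. starA hb (resZ f) (resZ g))"
proof (rule holoA_cong)
  show "holoA Hset (\<lambda>t. resZ (starS (krn {} t) (bcoeff f) (bcoeff g)))"
  proof (rule holoA_starS[OF open_Hset _ _ f g])
    show "(\<lambda>t. krn {} t P S T) holomorphic_on Hset" for P S T :: "'a midx"
      by (rule krn_holomorphic) (auto simp: Hset_iff)
    fix t0 assume "t0 \<in> Hset"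
    from Hset_local[OF this]
    show "\<exists>r>0. ball t0 r \<subseteq> Hset \<and> (\<exists>C\<ge>0. \<exists>D\<ge>1. \<forall>t\<in>ball t0 r. kernel_bound (krn {} t :: 'a midx \<Rightarrow> _) C D)"
      using zero_le_one by blast
  qed
  fix t assume t: "t \<in> Hset"
  show "starA t (resZ f) (resZ g) = resZ (starS (krn {} t) (bcoeff f) (bcoeff g))"
    unfolding starA_eq_starS[OF t f g] starS_kap_eq_krn[OF t] ..
qed

text \<open>Near the pole the factor \<open>t + 1/(2m)\<close> cancels the only vanishing factor \<open>1/(2t) + m\<close> of the
  denominator, because \<open>(t + 1/(2m)) / (1/(2t) + m) = t / m\<close>.\<close>

lemma prat_pole:
  assumes "m \<ge> 1" "t \<noteq> 0" "1 / (2 * t) + of_nat m \<noteq> (0::complex)"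
  shows "(t - (- 1 / (2 * of_nat m))) * prat {} (1 / (2 * t)) p s N =
     (if m < p then t / of_nat m else t - (- 1 / (2 * of_nat m))) * prat {m} (1 / (2 * t)) p s N"
proof (cases "m < p")
  case True
  have "(\<Prod>k<p. 1 / (2 * t) + of_nat k) = (1 / (2 * t) + of_nat m) * (\<Prod>k\<in>{..<p} - {m}. 1 / (2 * t) + of_nat k)"
    using True by (intro prod.remove) auto
  then have "prat {} (1 / (2 * t)) p s N = prat {m} (1 / (2 * t)) p s N / (1 / (2 * t) + of_nat m)"
    by (simp add: prat_def)
  moreover have "t - (- 1 / (2 * of_nat m)) = t / of_nat m * (1 / (2 * t) + of_nat m)"
    using assms by (simp add: field_simps)
  ultimately show ?thesis using True assms(3) by simp
next
  case False
  then have "{..<p} - {m} = {..<p}" by auto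
  then show ?thesis using False by (simp add: prat_def)
qed

text \<open>\<open>G\<close> is the same series with the kernel multiplied by t - t0 and the
  cancellation carried out, so it is defined and bounded at t0 too. One power of t - t0 suffices
  because only the factor with k = m vanishes at t0, and the denominator of \<open>prat\<close>
  contains it at most once.\<close>

lemma holoA_star_pole:
  fixes f g :: "('n::finite) hvec \<Rightarrow> complex"
  assumes f: "holo_hatD f" and g: "holo_hatD g" and m: "m \<ge> 1"
  shows "\<exists>\<rho>>0. \<exists>G. holoA (ball (- 1 / (2 * of_nat m)) \<rho>) G \<and>
         (\<forall>hb \<in> ball (- 1 / (2 * of_nat m)) \<rho> - {- 1 / (2 * of_nat m)}.
            G hb = (\<lambda>r. (hb - (- 1 / (2 * of_nat m))) * starA hb (resZ f) (resZ g) r))"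
proof -
  define t0 :: complex where "t0 = - 1 / (2 * of_nat m)"
  have t00: "t0 \<noteq> 0" using m by (simp add: t0_def)
  have z0: "1 / (2 * t0) = - of_nat m" using m by (simp add: t0_def)
  obtain \<rho> \<delta> M where r: "\<rho> > 0" "\<rho> \<le> 1" "\<delta> > 0" "M \<ge> 1" "\<delta> \<le> 1" "\<And>t. t \<in> ball t0 \<rho> \<Longrightarrow> t \<noteq> 0 \<and> norm (1 / (2 * t)) \<le> M \<and>
       (\<forall>k. 1 / (2 * t0) + of_nat k \<noteq> 0 \<longrightarrow> \<delta> * (real k + 1) \<le> norm (1 / (2 * t) + of_nat k))"
    using half_inverse_local[OF t00] by blast
  have lower: "\<delta> * (real k + 1) \<le> norm (1 / (2 * t) + of_nat k)" if "t \<in> ball t0 \<rho>" "k \<notin> {m}" for t k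
    using r(6)[OF that(1)] that(2) unfolding z0 by (auto simp: add_eq_0_iff)
  have nz: "1 / (2 * t) + of_nat k \<noteq> 0" if "t \<in> ball t0 \<rho>" "k \<notin> {m}" for t k
  proof -
    have "0 < \<delta> * (real k + 1)" using r(3) by (intro mult_pos_pos) auto
    also note lower[OF that]
    finally show ?thesis by auto
  qed
  \<comment> \<open>What is left of t - t0: the quotient \<open>t / of_nat m\<close> if the
    vanishing factor is among the first \<open>p\<close>, and t - t0 itself otherwise.\<close>
  define \<phi> where "\<phi> t p = (if m < p then t / of_nat m else t - t0)" for t p
  define \<kappa> where "\<kappa> t P S T = \<phi> t (msum P) * krn {m} t P S T" for t and P S T :: "'n midx"
  \<comment> \<open>Bounds both cases of \<open>\<phi>\<close>, as the ball has radius at most 1 and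
    \<open>m \<ge> 1\<close>.\<close>
  define F where "F = norm t0 + 1"
  have \<phi>b: "norm (\<phi> t p) \<le> F" if t: "t \<in> ball t0 \<rho>" for t p
  proof -
    have d: "norm (t - t0) \<le> 1" using t r(2) by (simp add: dist_norm norm_minus_commute)
    then have "norm t \<le> F" unfolding F_def using norm_triangle_sub[of t t0] by simp
    moreover have "norm (t / of_nat m) \<le> norm t"
      using m by (simp add: norm_divide divide_le_eq mult_le_cancel_left1)
    moreover have "norm (t - t0) \<le> F" unfolding F_def using d norm_ge_zero[of t0] by linarith
    ultimately show ?thesis unfolding \<phi>_def by auto
  qed
  let ?G = "\<lambda>t. resZ (starS (\<kappa> t) (bcoeff f) (bcoeff g))"
  have "holoA (ball t0 \<rho>) ?G"
  proof (rule holoA_starS[OF open_ball _ _ f g])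
    show "(\<lambda>t. \<kappa> t P S T) holomorphic_on ball t0 \<rho>" for P S T
    proof -
      have "(\<lambda>t. \<phi> t (msum P)) holomorphic_on ball t0 \<rho>"
        unfolding \<phi>_def using m by (cases "m < msum P") (auto intro!: holomorphic_intros)
      moreover have "(\<lambda>t. krn {m} t P S T) holomorphic_on ball t0 \<rho>"
        by (rule krn_holomorphic) (use r(6) nz in blast)+
      ultimately show ?thesis unfolding \<kappa>_def by (intro holomorphic_intros)
    qed
    have kb: "kernel_bound (\<kappa> t) (F * (real m + 1)) (4 * M / \<delta>)" if t: "t \<in> ball t0 \<rho>" for t
      unfolding kernel_bound_def
    proof (intro allI impI)
      fix P S T :: "'n midx" assume T: "\<forall>i. T i \<le> P i \<and> T i \<le> S i"
      have M: "norm (1 / (2 * t)) \<le> M" using r(6)[OF t] by blast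
      have "norm (krn {m} t P S T) \<le> (real m + 1) * (4 * M / \<delta>) ^ (msum P + msum S)"
        by (rule norm_krn_le[OF M r(4,3,5) lower[OF t]]) (use T in auto)
      then show "norm (\<kappa> t P S T) \<le> F * (real m + 1) * (4 * M / \<delta>) ^ (msum P + msum S)"
        unfolding \<kappa>_def norm_mult mult.assoc using \<phi>b[OF t, of "msum P"] by (intro mult_mono) (auto simp: F_def)
    qed
    fix t1 assume "t1 \<in> ball t0 \<rho>"
    then obtain s where s: "s > 0" "ball t1 s \<subseteq> ball t0 \<rho>" by (metis open_ball openE)
    have "F * (real m + 1) \<ge> 0" "4 * M / \<delta> \<ge> 1" using r by (auto simp: F_def le_divide_eq)
    then show "\<exists>r>0. ball t1 r \<subseteq> ball t0 \<rho> \<and> (\<exists>C\<ge>0. \<exists>D\<ge>1. \<forall>t\<in>ball t1 r. kernel_bound (\<kappa> t) C D)"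
      using s kb by blast
  qed
  moreover have "?G t = (\<lambda>r. (t - t0) * starA t (resZ f) (resZ g) r)" if t: "t \<in> ball t0 \<rho> - {t0}" for t
  proof -
    have tn: "t \<noteq> 0" using r(6) t by blast
    \<comment> \<open>Since t determines and is determined by 1/(2t), the factor with k = m vanishes
      only at the centre; hence the punctured ball lies in \<open>Hset\<close>.\<close>
    have nm: "1 / (2 * t) + of_nat m \<noteq> 0"
    proof
      assume "1 / (2 * t) + of_nat m = 0"
      then have "1 / (2 * t) = 1 / (2 * t0)" unfolding z0 by (simp add: add_eq_0_iff2)
      then have "t = t0" by simp
      then show False using t by simp
    qed
    have nzt: "1 / (2 * t) + of_nat k \<noteq> 0" for k using nz[of t k] nm t by (cases "k = m") auto
    then have tH: "t \<in> Hset" using tn by (simp add: Hset_iff)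
    have keq: "\<kappa> t P S T = (t - t0) * kap t P S T" if T: "\<And>i. T i \<le> P i \<and> T i \<le> S i" for P S T
    proof -
      let ?N = "msum (\<lambda>i. P i + S i - T i)"
      let ?c = "(-1) ^ (T None) * of_nat (mfact T) * of_nat (mbinom P T) * of_nat (mbinom S T) :: complex"
      have pp: "(t - t0) * prat {} (1 / (2 * t)) (msum P) (msum S) ?N = \<phi> t (msum P) * prat {m} (1 / (2 * t)) (msum P) (msum S) ?N"
        using prat_pole[OF m tn nm, of "msum P" "msum S" ?N] unfolding t0_def \<phi>_def .
      have "\<kappa> t P S T = ?c * (\<phi> t (msum P) * prat {m} (1 / (2 * t)) (msum P) (msum S) ?N)"
        unfolding \<kappa>_def krn_def by (simp only: mult_ac)
      also have "\<dots> = (t - t0) * kap t P S T"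
        unfolding pp[symmetric] kap_eq_krn[OF nzt T] krn_def by (simp only: mult_ac)
      finally show ?thesis .
    qed
    have "starS (\<kappa> t) = starS (\<lambda>P S T. (t - t0) * kap t P S T)" by (rule starS_cong) (rule keq)
    moreover have "starS (\<lambda>P S T. (t - t0) * kap t P S T) u v w = (t - t0) * starS (kap t) u v w" for u v w
    proof -
      have "starco (\<lambda>P S T. (t - t0) * kap t P S T) u v j * hmono (jidx j) w = (t - t0) * (starco (kap t) u v j * hmono (jidx j) w)" for j
        by (cases j) (simp add: starco_def mult_ac)
      then show ?thesis unfolding starS_def mseries_def by (simp only: infsum_cmult_right')
    qed
    ultimately show ?thesis unfolding starA_eq_starS[OF tH f g] by (auto simp: resZ_def fun_eq_iff)
  qed
  ultimately show ?thesis unfolding t0_def[symmetric] using r(1) by blast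
qed

theorem theorem4p1:
  fixes a b :: "('n::finite) cvec \<Rightarrow> complex"
  assumes "a \<in> AD" and "b \<in> AD"
  shows "holoA Hset (\<lambda>hb. starA hb a b) \<and>
    (\<forall>m::nat. m \<ge> 1 \<longrightarrow>
      (\<exists>\<rho>>0. \<exists>G. holoA (ball (- 1 / (2 * of_nat m)) \<rho>) G \<and>
         (\<forall>hb \<in> ball (- 1 / (2 * of_nat m)) \<rho> - {- 1 / (2 * of_nat m)}.
            G hb = (\<lambda>r. (hb - (- 1 / (2 * of_nat m))) * starA hb a b r))))"
proof -
  obtain f where f: "holo_hatD f" "a = resZ f" using AD_eq_resZ[OF assms(1)] .
  obtain g where g: "holo_hatD g" "b = resZ g" using AD_eq_resZ[OF assms(2)] .
  show ?thesis
    unfolding f(2) g(2) using holoA_star_regular[OF f(1) g(1)] holoA_star_pole[OF f(1) g(1)] by blast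
qed

end
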